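(* Let $n\geq 3$. For fixed positive real numbers $d_1,\ldots,d_{n-1}$, among all hyperbolic $n$-gons with $n-1$ sides of these lengths, area is maximized by the semicyclic ones with final side length greater than $\max\{d_i\}_{i=1}^{n-1}$.
   Context: A hyperbolic $n$-gon is a polygon in the hyperbolic plane $\mathbb{H}^2$, i.e. a compact region bounded by a simple closed curve consisting of $n$ geodesic segments (its sides). "With $n-1$ sides of these lengths" means that $n-1$ of its sides have lengths $d_1,\ldots,d_{n-1}$ in some order; the final side is the remaining one. A cyclic $n$-gon is a set $\{x_0,\ldots,x_{n-1}\}$ of points on a hyperbolic metric circle (its circumcircle), cyclically ordered counterclockwise; it is identified with its convex hull, a compact convex polygon with vertices $x_0,\ldots,x_{n-1}$ and sides the geodesic arcs joining cyclically consecutive $x_i$. It is semicyclic if the radius of its circumcircle equals half of its longest side length (equivalently, its longest side is a diameter of the circumcircle). *)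

theory Defs
  imports "HOL-Analysis.Analysis"
begin

text \<open>
  The hyperbolic plane is the Beltrami--Klein model on the open unit disc (curvature \<open>-1\<close>).
  In this model the geodesic segment from \<open>x\<close> to \<open>y\<close> is the Euclidean segment, parametrised by
  \<open>linepath x y\<close>, so that the hyperbolic convex hull is the Euclidean one.
\<close>

definition klein_disc :: "complex set" where
  "klein_disc = ball 0 1"

definition hyp_dist :: "complex \<Rightarrow> complex \<Rightarrow> real" where
  "hyp_dist x y = arcosh ((1 - x \<bullet> y) / (sqrt (1 - (cmod x)\<^sup>2) * sqrt (1 - (cmod y)\<^sup>2)))"

text \<open>
  The Riemannian area form of the Klein metric is \<open>(1 - |z|\<^sup>2) powr (-3/2) dx dy\<close>; for instance
  the hyperbolic disc of radius \<open>r\<close> about \<open>0\<close>, which is the Euclidean disc of radius \<open>tanh r\<close>,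
  has area \<open>2 * pi * (cosh r - 1)\<close>.
\<close>

definition hyp_area :: "complex set \<Rightarrow> real" where
  "hyp_area P = (LINT z:P|lborel. (1 - (cmod z)\<^sup>2) powr (- 3 / 2))"

text \<open>
  A polygon is given by the list of its vertices in the order in which the boundary curve
  passes through them (in either orientation). Side \<open>i\<close> joins vertex \<open>i\<close> to the next one
  cyclically.
\<close>

fun polygonal_path :: "complex list \<Rightarrow> real \<Rightarrow> complex" where
  "polygonal_path [] = linepath 0 0"
| "polygonal_path [a] = linepath a a"
| "polygonal_path [a, b] = linepath a b"
| "polygonal_path (a # b # c # xs) = linepath a b +++ polygonal_path (b # c # xs)"

definition boundary_path :: "complex list \<Rightarrow> real \<Rightarrow> complex" where
  "boundary_path xs = polygonal_path (xs @ [hd xs])"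

definition hyp_polygon :: "complex list \<Rightarrow> bool" where
  "hyp_polygon xs \<longleftrightarrow> 3 \<le> length xs \<and> set xs \<subseteq> klein_disc \<and> simple_path (boundary_path xs)"

definition polygon_region :: "complex list \<Rightarrow> complex set" where
  "polygon_region xs = path_image (boundary_path xs) \<union> inside (path_image (boundary_path xs))"

definition side_length :: "complex list \<Rightarrow> nat \<Rightarrow> real" where
  "side_length xs i = hyp_dist (xs ! i) (xs ! (Suc i mod length xs))"

text \<open>
  The sides other than side \<open>k\<close> (the final side) have lengths \<open>d 1, \<dots>, d (n - 1)\<close> in some order.
\<close>

definition sides_except :: "complex list \<Rightarrow> nat \<Rightarrow> (nat \<Rightarrow> real) \<Rightarrow> bool" where
  "sides_except xs k d \<longleftrightarrow> k < length xs \<and>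
     (\<exists>\<sigma>. bij_betw \<sigma> {1..length xs - 1} ({..<length xs} - {k}) \<and>
          (\<forall>i\<in>{1..length xs - 1}. side_length xs (\<sigma> i) = d i))"

text \<open>
  The vertices lie on the metric circle of centre \<open>c\<close> and radius \<open>r\<close>, in counterclockwise cyclic
  order. Here \<open>\<theta> i\<close> is the Euclidean direction of vertex \<open>i\<close> seen from \<open>c\<close>. The Klein model is
  not conformal, but geodesic rays from \<open>c\<close> are straight, so the counterclockwise order of these
  directions is the hyperbolic one.
\<close>

definition cyclic_polygon :: "complex list \<Rightarrow> complex \<Rightarrow> real \<Rightarrow> bool" where
  "cyclic_polygon xs c r \<longleftrightarrow> 3 \<le> length xs \<and> c \<in> klein_disc \<and> 0 < r \<and>
     (\<forall>x\<in>set xs. x \<in> klein_disc \<and> hyp_dist c x = r) \<and>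
     (\<exists>\<theta>::nat \<Rightarrow> real.
        (\<forall>i<length xs. xs ! i - c = of_real (cmod (xs ! i - c)) * cis (\<theta> i)) \<and>
        (\<forall>i j. i < j \<and> j < length xs \<longrightarrow> \<theta> i < \<theta> j \<and> \<theta> j < \<theta> i + 2 * pi))"

definition semicyclic_polygon :: "complex list \<Rightarrow> bool" where
  "semicyclic_polygon xs \<longleftrightarrow>
     (\<exists>c r. cyclic_polygon xs c r \<and> r = Max (side_length xs ` {..<length xs}) / 2)"

definition ngons_with_sides :: "nat \<Rightarrow> (nat \<Rightarrow> real) \<Rightarrow> complex set set" where
  "ngons_with_sides n d =
     {polygon_region xs | xs. hyp_polygon xs \<and> length xs = n \<and> (\<exists>k. sides_except xs k d)}"

text \<open>A cyclic polygon, as a region, is the convex hull of its vertices.\<close>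

definition semicyclic_ngons_with_sides :: "nat \<Rightarrow> (nat \<Rightarrow> real) \<Rightarrow> complex set set" where
  "semicyclic_ngons_with_sides n d =
     {convex hull (set xs) | xs. semicyclic_polygon xs \<and> length xs = n \<and>
        (\<exists>k. sides_except xs k d \<and> side_length xs k > Max (d ` {1..n - 1}))}"

end

theory Submission
  imports Defs "HOL-Complex_Analysis.Complex_Analysis"
begin

text \<open>
  In the Poincare disc the signed area of the triangle \<open>0, p, q\<close> is \<open>2 Arg (1 - p * cnj q)\<close>, so by
  additivity of winding numbers the area of a simple polygon is, up to sign, the cyclic sum of these
  terms over its sides. This expression makes sense for all closed chains, simple or not, and
  chains with prescribed lengths and a free closing side form a compact set up to isometry, so
  a maximiser exists. Rotating its tail about a vertex changes only the triangle formed by that vertex and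
  the two ends of the chain; maximality therefore gives
  \<open>sinh\<^sup>2(c/2) = sinh\<^sup>2(a/2) + sinh\<^sup>2(b/2)\<close> for the sides of this triangle, which is
  Thales' condition: every vertex lies on the circle whose diameter is the closing side. The half central
  angles \<open>arcsin (sinh(d/2) / sinh R)\<close> of the chain then add up to at least \<open>\<pi>/2\<close>, so \<open>R\<close> is at
  most the semicyclic radius, and the area of an isosceles triangle with given base increases with \<open>R\<close>.
\<close>
section \<open>Areas and chords in the Poincare disc\<close>

text \<open>Two models share the work. In the Klein disc geodesics are straight, so segments, hulls
  and winding numbers are the Euclidean ones; the Poincare disc supplies conformal isometries and
  the \<open>Arg\<close> formula. Distances, areas of triangles with apex 0 and signs of
  orientations are carried from one model to the other. Angles are not, because the Klein model is
  not conformal. The rotation argument rests on a cocycle property: an isometry changes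
  \<open>half_area p q\<close> by a term \<open>g p - g q\<close>. Around a closed chain these terms
  cancel; when only a tail is rotated, they leave just the triangle at the pivot. An extremal chain
  may turn back or wind too far, so its half central angles obey only an inequality, and the
  comparison is made with the \<open>S\<close> of a given semicyclic polygon. The resulting bound is
  symmetric in the side lengths, so the order of the sides does not matter. The unknown orientation
  of a simple polygon is absorbed by applying the bound to the complex conjugate chain as
  well.\<close>

definition half_area :: "complex \<Rightarrow> complex \<Rightarrow> real" where
  "half_area p q = Arg (1 - p * cnj q)"

text \<open>In the Poincare disc this is \<open>sinh\<^sup>2(d/2)\<close> for the distance \<open>d\<close> of \<open>p\<close> and \<open>q\<close>.\<close>

definition chord_sq :: "complex \<Rightarrow> complex \<Rightarrow> real" where
  "chord_sq p q = (cmod (p - q))\<^sup>2 / ((1 - (cmod p)\<^sup>2) * (1 - (cmod q)\<^sup>2))"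

text \<open>
  Half the area of the triangle with two sides \<open>R\<close> and base \<open>d\<close>, where \<open>S = sinh R\<close> and
  \<open>D = sinh (d/2)\<close>.
\<close>

definition isosceles_half_area :: "real \<Rightarrow> real \<Rightarrow> real" where
  "isosceles_half_area S D = arctan (D * sqrt (S\<^sup>2 - D\<^sup>2) / (sqrt (1 + S\<^sup>2) + 1 + D\<^sup>2))"

abbreviation moebius :: "complex \<Rightarrow> complex \<Rightarrow> complex" where
  "moebius c \<equiv> Moebius_function 0 c"

lemma Re_one_minus_cnj_pos:
  assumes "cmod p < 1" "cmod q < 1"
  shows "Re (1 - p * cnj q) > 0"
proof -
  have "cmod (p * cnj q) < 1"
    using assms by (simp add: norm_mult) (metis mult_less_cancel_right1 norm_ge_zero norm_mult_less norm_mult mult_1)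
  then show ?thesis
    using complex_Re_le_cmod[of "p * cnj q"] by (simp del: complex_cnj times_complex.simps)
qed

lemma one_minus_cnj_nonzero:
  assumes "cmod p < 1" "cmod q < 1"
  shows "1 - p * cnj q \<noteq> 0"
  using Re_one_minus_cnj_pos[OF assms] by (metis less_irrefl zero_complex.simps(1))

text \<open>This bound keeps a sum of four such terms within one period, so an identity known modulo
  \<open>2 * pi\<close> becomes an equality.\<close>

lemma abs_half_area_less:
  assumes "cmod p < 1" "cmod q < 1"
  shows "\<bar>half_area p q\<bar> < pi / 2"
  using Re_one_minus_cnj_pos[OF assms] unfolding half_area_def Arg_Re_pos by simp

lemma norm_sq_cnj: "(complex_of_real (cmod z))\<^sup>2 = z * cnj z"
  by (simp flip: complex_norm_square of_real_power)

lemma half_area_swap: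
  assumes "cmod p < 1" "cmod q < 1"
  shows "half_area q p = - half_area p q"
proof -
  have "1 - q * cnj p = cnj (1 - p * cnj q)"
    by simp
  then show ?thesis
    using Re_one_minus_cnj_pos[OF assms]
    unfolding half_area_def by (metis Arg_cnj Arg_real order_less_imp_le neg_0_equal_iff_equal)
qed

lemma half_area_cnj:
  assumes "cmod p < 1" "cmod q < 1"
  shows "half_area (cnj p) (cnj q) = - half_area p q"
  using half_area_swap[OF assms] by (simp add: half_area_def mult.commute)

lemma half_area_opposite [simp]: "cmod p < 1 \<Longrightarrow> half_area p (- p) = 0"
proof -
  have "1 - p * cnj (- p) = of_real (1 + (cmod p)\<^sup>2)"
    by (simp add: norm_sq_cnj)
  then show ?thesis
    unfolding half_area_def by (metis Arg_of_real add_nonneg_nonneg linorder_not_less zero_le_one zero_le_power2)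
qed

lemma half_area_rotate: "cmod u = 1 \<Longrightarrow> half_area (u * p) (u * q) = half_area p q"
proof -
  assume "cmod u = 1"
  then have "u * cnj u = 1"
    by (metis complex_norm_square of_real_1 one_power2)
  then have "u * p * cnj (u * q) = p * cnj q"
    by (metis (no_types, opaque_lifting) complex_cnj_mult mult.assoc mult.commute mult_1)
  then show ?thesis unfolding half_area_def by (simp only:)
qed

section \<open>Behaviour of chords and signed areas under Moebius maps\<close>

lemma norm_moebius_less: "cmod c < 1 \<Longrightarrow> cmod p < 1 \<Longrightarrow> cmod (moebius c p) < 1"
  by (rule Moebius_function_norm_lt_1)

lemma moebius_inverse: "cmod c < 1 \<Longrightarrow> cmod p < 1 \<Longrightarrow> moebius (- c) (moebius c p) = p"
  by (rule Moebius_function_compose) auto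

lemma moebius_self [simp]: "moebius c c = 0"
  by (rule Moebius_function_eq_zero)

lemma moebius_zero [simp]: "moebius c 0 = - c"
  by (simp add: Moebius_function_of_zero)

text \<open>Polarised form of the formula for \<open>1 - |moebius c p|^2\<close>, which is the case
  \<open>q = p\<close>. The denominator is a factor in \<open>p\<close> times the conjugate of the
  same factor in \<open>q\<close>, so under \<open>Arg\<close> the two contributions
  subtract.\<close>

lemma moebius_cross_ratio:
  assumes "cmod c < 1" "cmod p < 1" "cmod q < 1"
  shows "1 - moebius c p * cnj (moebius c q)
    = (1 - p * cnj q) * of_real (1 - (cmod c)\<^sup>2) / ((1 - p * cnj c) * cnj (1 - q * cnj c))"
proof -
  have nz: "1 - cnj c * p \<noteq> 0" "1 - c * cnj q \<noteq> 0"
    using one_minus_cnj_nonzero[of p c] one_minus_cnj_nonzero[of c q] assms by (simp_all add: mult.commute)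
  have n: "of_real (1 - (cmod c)\<^sup>2) = 1 - c * cnj c"
    by (simp add: norm_sq_cnj)
  show ?thesis
    unfolding n Moebius_function_simple using nz
    by (simp add: divide_simps mult.commute) (simp add: algebra_simps)
qed

lemma one_minus_norm_moebius:
  assumes "cmod c < 1" "cmod p < 1"
  shows "1 - (cmod (moebius c p))\<^sup>2
    = (1 - (cmod p)\<^sup>2) * (1 - (cmod c)\<^sup>2) / (cmod (1 - p * cnj c))\<^sup>2"
proof -
  have "of_real (1 - (cmod (moebius c p))\<^sup>2) = 1 - moebius c p * cnj (moebius c p)"
    by (simp add: norm_sq_cnj)
  also have "\<dots> = (1 - p * cnj p) * of_real (1 - (cmod c)\<^sup>2) / ((1 - p * cnj c) * cnj (1 - p * cnj c))"
    using assms by (rule_tac moebius_cross_ratio) auto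
  also have "\<dots> = of_real ((1 - (cmod p)\<^sup>2) * (1 - (cmod c)\<^sup>2) / (cmod (1 - p * cnj c))\<^sup>2)"
    by (simp only: complex_norm_square[symmetric]) (simp add: norm_sq_cnj)
  finally show ?thesis by (simp only: of_real_eq_iff)
qed

lemma chord_sq_moebius:
  assumes "cmod c < 1" "cmod p < 1" "cmod q < 1"
  shows "chord_sq (moebius c p) (moebius c q) = chord_sq p q"
proof -
  have nz: "1 - p * cnj c \<noteq> 0" "1 - q * cnj c \<noteq> 0"
    using one_minus_cnj_nonzero assms by simp_all
  have "moebius c p - moebius c q = (p - q) * of_real (1 - (cmod c)\<^sup>2) / ((1 - p * cnj c) * (1 - q * cnj c))"
    using nz unfolding Moebius_function_simple of_real_diff complex_norm_square
    by (simp add: divide_simps mult.commute complex_norm_square) (simp add: algebra_simps)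
  then have d: "(cmod (moebius c p - moebius c q))\<^sup>2
      = (cmod (p - q))\<^sup>2 * (1 - (cmod c)\<^sup>2)\<^sup>2 / ((cmod (1 - p * cnj c))\<^sup>2 * (cmod (1 - q * cnj c))\<^sup>2)"
    by (simp only: norm_divide norm_mult norm_of_real power_divide power_mult_distrib power2_abs)
  have "1 - (cmod c)\<^sup>2 > 0"
    using assms by (simp add: abs_square_less_1)
  then show ?thesis
    unfolding chord_sq_def d one_minus_norm_moebius[OF assms(1,2)] one_minus_norm_moebius[OF assms(1,3)]
    using nz by (simp add: divide_simps power2_eq_square)
qed

lemma chord_sq_rotate: "cmod u = 1 \<Longrightarrow> chord_sq (u * p) (u * q) = chord_sq p q"
  by (simp add: chord_sq_def norm_mult flip: right_diff_distrib)

text \<open>Additivity of area: the left side belongs to the triangle \<open>c, p, q\<close> with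
  \<open>c\<close> moved to the origin, the right side is the sum of the terms for
  \<open>p q\<close>, \<open>q c\<close> and \<open>c p\<close>. Taking arguments in
  \<open>moebius_cross_ratio\<close> gives the identity modulo \<open>2 * pi\<close>, and
  \<open>abs_half_area_less\<close> removes the ambiguity.\<close>

lemma half_area_moebius:
  assumes c: "cmod c < 1" and p: "cmod p < 1" and q: "cmod q < 1"
  shows "half_area (moebius c p) (moebius c q) = half_area p q - half_area p c + half_area q c"
proof -
  let ?A = "half_area (moebius c p) (moebius c q)" and ?B = "half_area p q - half_area p c + half_area q c"
  have nz: "1 - p * cnj c \<noteq> 0" "1 - q * cnj c \<noteq> 0" "1 - p * cnj q \<noteq> 0" "1 - moebius c p * cnj (moebius c q) \<noteq> 0"
    using one_minus_cnj_nonzero assms norm_moebius_less by blast+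
  have cpos: "1 - (cmod c)\<^sup>2 > 0"
    using c by (simp add: abs_square_less_1)
  have "cis ?A = sgn (1 - moebius c p * cnj (moebius c q))"
    using nz by (simp add: half_area_def cis_Arg)
  also have "\<dots> = sgn (1 - p * cnj q) / (sgn (1 - p * cnj c) * cnj (sgn (1 - q * cnj c)))"
  proof -
    have "sgn (complex_of_real (1 - (cmod c)\<^sup>2)) = 1"
      using cpos by (simp only: sgn_of_real sgn_pos of_real_1)
    moreover have "sgn (cnj z) = cnj (sgn z)" for z :: complex
      by (simp add: sgn_eq)
    ultimately show ?thesis
      unfolding moebius_cross_ratio[OF assms] sgn_divide sgn_mult by (simp only: mult_1_right)
  qed
  also have "\<dots> = cis ?B"
    using nz by (simp add: half_area_def cis_Arg [symmetric] cis_cnj)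
      (simp add: cis_mult cis_divide algebra_simps)
  finally have eq: "cis ?A = cis ?B" .
  then obtain k where k: "?A = ?B + of_int k * (2 * pi)"
    by (metis (no_types, opaque_lifting) sin_cos_eq_iff cis.simps mult.commute mult.assoc)
  have "\<bar>?A - ?B\<bar> < 2 * pi"
    using abs_half_area_less[of p q] abs_half_area_less[of p c] abs_half_area_less[of q c]
      abs_half_area_less[of "moebius c p" "moebius c q"] assms norm_moebius_less by auto
  then have "\<bar>real_of_int k\<bar> < 1"
    using k by (simp add: abs_mult)
  then have "k = 0"
    by linarith
  then show ?thesis using k by simp
qed

section \<open>Extremal triangles and the condition of Thales\<close>

lemma norm_sq_diff: "(cmod (p - q))\<^sup>2 = (cmod p)\<^sup>2 + (cmod q)\<^sup>2 - 2 * Re (p * cnj q)"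
  unfolding cmod_power2 by (simp add: power2_eq_square algebra_simps)

lemma Im_sq_mult_cnj: "(Im (p * cnj q))\<^sup>2 = (cmod p)\<^sup>2 * (cmod q)\<^sup>2 - (Re (p * cnj q))\<^sup>2"
  unfolding cmod_power2 by (simp add: power2_eq_square algebra_simps)

lemma half_area_arctan:
  assumes "cmod p < 1" "cmod q < 1"
  shows "half_area p q = arctan (- Im (p * cnj q) / (1 - Re (p * cnj q)))"
  using Re_one_minus_cnj_pos[OF assms] by (simp add: half_area_def arg_conv_arctan)

text \<open>Put \<open>w = a * cnj b\<close>. As \<open>a\<close> is rotated, \<open>1 - w\<close>
  runs over the circle of radius \<open>|w|\<close> about 1, and its argument is largest where the
  ray from 0 is tangent to that circle. There \<open>1 - w\<close> is orthogonal to
  \<open>w\<close>, that is, \<open>Re w = |w|^2\<close>.\<close>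

lemma Re_mult_cnj_of_half_area_max:
  assumes a: "cmod a < 1" and b: "cmod b < 1"
    and max: "\<And>u. cmod u = 1 \<Longrightarrow> half_area (u * a) b \<le> half_area a b"
  shows "Re (a * cnj b) = (cmod a)\<^sup>2 * (cmod b)\<^sup>2"
proof (cases "a * cnj b = 0")
  case True
  then show ?thesis by auto
next
  case False
  define w where "w = a * cnj b"
  define k where "k = cmod w"
  have k: "k = cmod a * cmod b" "0 < k" "k < 1"
    using False a b mult_strict_mono'[of "cmod a" 1 "cmod b" 1] by (auto simp: k_def w_def norm_mult)
  then have k2: "k\<^sup>2 < 1"
    by (simp add: abs_square_less_1)
  \<comment> \<open>The value of \<open>w\<close> at the upper point of tangency. Comparing the
    given \<open>w\<close> with it leads to \<open>(Re w - k^2)^2 \<le> 0\<close>.\<close>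
  define v where "v = Complex (k\<^sup>2) (- k * sqrt (1 - k\<^sup>2))"
  have "(cmod v)\<^sup>2 = k\<^sup>2"
    using k2 unfolding v_def cmod_power2
    by (simp add: power_mult_distrib) (simp add: power2_eq_square power4_eq_xxxx algebra_simps)
  then have nv: "cmod v = k"
    using k by (simp add: power2_eq_iff_nonneg)
  define u where "u = v / w"
  have u: "cmod u = 1" "u * w = v"
    using k nv False by (auto simp: u_def norm_divide k_def w_def)
  have ua: "cmod (u * a) < 1" "u * a * cnj b = v"
    using u a by (auto simp: norm_mult w_def mult.assoc)
  have "arctan (- Im v / (1 - Re v)) \<le> arctan (- Im w / (1 - Re w))"
    using max[OF u(1)] unfolding half_area_arctan[OF ua(1) b] half_area_arctan[OF a b] ua(2) w_def .
  then have "- Im v / (1 - Re v) \<le> - Im w / (1 - Re w)"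
    by (simp only: arctan_le_iff)
  moreover have re: "1 - Re w > 0" "1 - Re v > 0"
    using complex_Re_le_cmod[of w] k k2 by (auto simp: k_def v_def)
  ultimately have "k * sqrt (1 - k\<^sup>2) * (1 - Re w) \<le> - Im w * (1 - k\<^sup>2)"
    by (simp add: divide_simps v_def split: if_splits)
  then have "k * (1 - Re w) * sqrt (1 - k\<^sup>2) \<le> - Im w * sqrt (1 - k\<^sup>2) * sqrt (1 - k\<^sup>2)"
    using k2 by (simp add: algebra_simps)
  then have le: "k * (1 - Re w) \<le> - Im w * sqrt (1 - k\<^sup>2)"
    by (rule mult_right_le_imp_le) (use k2 in simp)
  have "(k * (1 - Re w))\<^sup>2 \<le> (- Im w * sqrt (1 - k\<^sup>2))\<^sup>2"
    using le k re by (intro power_mono) auto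
  also have "\<dots> = (k\<^sup>2 - (Re w)\<^sup>2) * (1 - k\<^sup>2)"
    using k2 Im_sq_mult_cnj[of a b] by (simp add: power_mult_distrib k(1) flip: w_def)
  finally have "(Re w - k\<^sup>2)\<^sup>2 \<le> 0"
    by (simp add: power2_eq_square algebra_simps)
  then have "Re w = k\<^sup>2"
    by simp
  then show ?thesis
    by (simp add: w_def k power_mult_distrib)
qed

lemma one_minus_norm_sq_pos: "cmod p < 1 \<Longrightarrow> 0 < 1 - (cmod p)\<^sup>2"
  by (simp add: abs_square_less_1)

lemma chord_sq_pythagoras:
  assumes "cmod a < 1" "cmod b < 1" and "Re (a * cnj b) = (cmod a)\<^sup>2 * (cmod b)\<^sup>2"
  shows "chord_sq b a = chord_sq b 0 + chord_sq 0 a"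
proof -
  have d: "(cmod (b - a))\<^sup>2 = (cmod a)\<^sup>2 + (cmod b)\<^sup>2 - 2 * ((cmod a)\<^sup>2 * (cmod b)\<^sup>2)"
    using norm_sq_diff[of a b] assms(3) by (simp add: norm_minus_commute)
  then show ?thesis
    using one_minus_norm_sq_pos[OF assms(1)] one_minus_norm_sq_pos[OF assms(2)]
    unfolding chord_sq_def d by (simp add: divide_simps algebra_simps)
qed

text \<open>Thales, with the ends of the diameter at \<open>- r\<close> and \<open>r\<close>: by the
  parallelogram law the terms \<open>Re (x * cnj r)\<close> cancel in the sum of the two chords,
  which leaves an equation in \<open>|x|^2\<close> and \<open>|r|^2\<close> alone.\<close>

lemma norm_eq_of_chord_sq_pythagoras:
  assumes "cmod r < 1" "cmod x < 1" and "chord_sq (- r) r = chord_sq (- r) x + chord_sq x r"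
  shows "cmod x = cmod r"
proof -
  define R X where "R = (cmod r)\<^sup>2" and "X = (cmod x)\<^sup>2"
  have pos: "0 < 1 - R" "0 < 1 - X" "R \<ge> 0"
    using assms one_minus_norm_sq_pos by (auto simp: R_def X_def)
  have "(cmod (- r - x))\<^sup>2 = R + X + 2 * Re (x * cnj r)" "(cmod (x - r))\<^sup>2 = R + X - 2 * Re (x * cnj r)"
    "(cmod (- r - r))\<^sup>2 = 4 * R"
    unfolding norm_sq_diff R_def X_def by (simp_all add: cmod_power2) (simp_all add: algebra_simps power2_eq_square)
  then have "4 * R / ((1 - R) * (1 - R)) = (2 * R + 2 * X) / ((1 - R) * (1 - X))"
    using assms(3) by (simp add: chord_sq_def R_def X_def mult.commute flip: add_divide_distrib)
  then have "4 * R * (1 - X) = (2 * R + 2 * X) * (1 - R)"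
    using pos by (simp add: divide_simps)
  then have "(X - R) * (1 + R) = 0"
    by (simp add: algebra_simps)
  then have "X = R"
    using pos by simp
  then show ?thesis
    unfolding R_def X_def by (simp add: power2_eq_iff_nonneg)
qed

text \<open>The circle about 0 of Euclidean radius \<open>\<rho> = tanh (R / 2)\<close> has
  hyperbolic radius \<open>R\<close>, and then \<open>S = sinh R\<close>. A chord fixes the real
  part of \<open>p * cnj q\<close> but the imaginary part only up to sign. That the square of the
  latter is nonnegative is what bounds the chord by the diameter.\<close>

lemma chord_circle_facts:
  fixes p q :: complex and \<rho> S D :: real
  assumes \<rho>: "cmod p = \<rho>" "cmod q = \<rho>" "\<rho> < 1" and S: "S = 2 * \<rho> / (1 - \<rho>\<^sup>2)"
    and D: "chord_sq p q = D\<^sup>2" "0 \<le> D"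
  shows "Re (p * cnj q) = \<rho>\<^sup>2 - D\<^sup>2 * (1 - \<rho>\<^sup>2)\<^sup>2 / 2"
    and "(Im (p * cnj q))\<^sup>2 = (D * (1 - \<rho>\<^sup>2)\<^sup>2 / 2)\<^sup>2 * (S\<^sup>2 - D\<^sup>2)"
    and "D \<le> S"
proof -
  have \<rho>0: "0 \<le> \<rho>" "0 < 1 - \<rho>\<^sup>2"
    using \<rho> one_minus_norm_sq_pos[of p] by auto
  show re: "Re (p * cnj q) = \<rho>\<^sup>2 - D\<^sup>2 * (1 - \<rho>\<^sup>2)\<^sup>2 / 2"
  proof -
    have "(2 * \<rho>\<^sup>2 - 2 * Re (p * cnj q)) / (1 - \<rho>\<^sup>2)\<^sup>2 = D\<^sup>2"
      using D(1) unfolding chord_sq_def norm_sq_diff \<rho> power2_eq_square[of "1 - \<rho>\<^sup>2"] by simp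
    then have "2 * \<rho>\<^sup>2 - 2 * Re (p * cnj q) = D\<^sup>2 * (1 - \<rho>\<^sup>2)\<^sup>2"
      using \<rho>0 by (simp add: divide_eq_eq)
    then show ?thesis by linarith
  qed
  have S2: "S\<^sup>2 * (1 - \<rho>\<^sup>2)\<^sup>2 = 4 * \<rho>\<^sup>2"
    using \<rho>0 by (simp add: S power_divide power_mult_distrib)
  show im: "(Im (p * cnj q))\<^sup>2 = (D * (1 - \<rho>\<^sup>2)\<^sup>2 / 2)\<^sup>2 * (S\<^sup>2 - D\<^sup>2)"
  proof -
    define E F where "E = (1 - \<rho>\<^sup>2)\<^sup>2" and "F = D\<^sup>2 * E / 2"
    have SE: "S\<^sup>2 * E = 4 * \<rho>\<^sup>2"
      unfolding E_def by (rule S2)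
    have "(D * E / 2)\<^sup>2 * (S\<^sup>2 - D\<^sup>2) = F * (S\<^sup>2 * E) / 2 - F * F"
      by (simp add: F_def field_simps power2_eq_square)
    then have "(D * E / 2)\<^sup>2 * (S\<^sup>2 - D\<^sup>2) = 2 * F * \<rho>\<^sup>2 - F * F"
      unfolding SE by simp
    moreover have "(Im (p * cnj q))\<^sup>2 = \<rho>\<^sup>2 * \<rho>\<^sup>2 - (\<rho>\<^sup>2 - F)\<^sup>2"
      unfolding Im_sq_mult_cnj re \<rho> E_def F_def ..
    moreover have "\<rho>\<^sup>2 * \<rho>\<^sup>2 - (\<rho>\<^sup>2 - F)\<^sup>2 = 2 * F * \<rho>\<^sup>2 - F * F"
      by (simp add: power2_eq_square algebra_simps)
    ultimately show ?thesis
      unfolding E_def[symmetric] by (simp only:)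
  qed
  show "D \<le> S"
  proof (cases "D = 0")
    case True
    then show ?thesis using S \<rho>0 by simp
  next
    case False
    then have "0 < (D * (1 - \<rho>\<^sup>2)\<^sup>2 / 2)\<^sup>2"
      using \<rho>0 by simp
    moreover have "0 \<le> (D * (1 - \<rho>\<^sup>2)\<^sup>2 / 2)\<^sup>2 * (S\<^sup>2 - D\<^sup>2)"
      unfolding im[symmetric] by (rule zero_le_power2)
    ultimately have "0 \<le> S\<^sup>2 - D\<^sup>2"
      unfolding zero_le_mult_iff by linarith
    then have "D\<^sup>2 \<le> S\<^sup>2" by linarith
    moreover have "0 \<le> S" using S \<rho>0 by simp
    ultimately show ?thesis
      by (rule power2_le_imp_le)
  qed
qed

text \<open>Origin of the formula in \<open>isosceles_half_area\<close>: the imaginary and real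
  parts of \<open>1 - p * cnj q\<close> share the factor \<open>(1 - \<rho>^2)^2 / 2\<close>, and
  \<open>sqrt (1 + S^2)\<close> is \<open>cosh R\<close>. The absolute value allows either direction
  of travel along the circle.\<close>

lemma abs_half_area_circle:
  fixes p q :: complex and \<rho> S D :: real
  assumes \<rho>: "cmod p = \<rho>" "cmod q = \<rho>" "\<rho> < 1" and S: "S = 2 * \<rho> / (1 - \<rho>\<^sup>2)"
    and D: "chord_sq p q = D\<^sup>2" "0 \<le> D"
  shows "\<bar>half_area p q\<bar> = isosceles_half_area S D"
proof -
  note facts = chord_circle_facts[OF assms]
  have \<rho>0: "0 \<le> \<rho>" "0 < 1 - \<rho>\<^sup>2"
    using \<rho> one_minus_norm_sq_pos[of p] by auto
  have SD: "0 \<le> S\<^sup>2 - D\<^sup>2"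
    using facts(3) D by (simp add: power_mono)
  have "\<bar>Im (p * cnj q)\<bar> = D * (1 - \<rho>\<^sup>2)\<^sup>2 / 2 * sqrt (S\<^sup>2 - D\<^sup>2)"
  proof -
    have "\<bar>Im (p * cnj q)\<bar> = sqrt ((Im (p * cnj q))\<^sup>2)" by simp
    also have "\<dots> = D * (1 - \<rho>\<^sup>2)\<^sup>2 / 2 * sqrt (S\<^sup>2 - D\<^sup>2)"
      unfolding facts(2) real_sqrt_mult using D by simp
    finally show ?thesis .
  qed
  moreover have "1 - Re (p * cnj q) = (1 - \<rho>\<^sup>2)\<^sup>2 / 2 * (sqrt (1 + S\<^sup>2) + 1 + D\<^sup>2)"
  proof -
    have sq: "sqrt (1 + S\<^sup>2) = (1 + \<rho>\<^sup>2) / (1 - \<rho>\<^sup>2)"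
    proof (rule real_sqrt_unique)
      show "((1 + \<rho>\<^sup>2) / (1 - \<rho>\<^sup>2))\<^sup>2 = 1 + S\<^sup>2"
        using \<rho>0 unfolding S by (simp add: divide_simps) (simp add: power2_eq_square algebra_simps)
    qed (use \<rho>0 in auto)
    show ?thesis
      unfolding facts(1) sq using \<rho>0 by (simp add: divide_simps) (simp add: power2_eq_square algebra_simps)
  qed
  ultimately have "\<bar>- Im (p * cnj q) / (1 - Re (p * cnj q))\<bar>
      = D * sqrt (S\<^sup>2 - D\<^sup>2) / (sqrt (1 + S\<^sup>2) + 1 + D\<^sup>2)"
  proof -
    assume im: "\<bar>Im (p * cnj q)\<bar> = D * (1 - \<rho>\<^sup>2)\<^sup>2 / 2 * sqrt (S\<^sup>2 - D\<^sup>2)"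
      and re: "1 - Re (p * cnj q) = (1 - \<rho>\<^sup>2)\<^sup>2 / 2 * (sqrt (1 + S\<^sup>2) + 1 + D\<^sup>2)"
    have "0 < sqrt (1 + S\<^sup>2) + 1 + D\<^sup>2"
      by (simp add: add_pos_nonneg)
    then show ?thesis
      unfolding abs_divide abs_minus_cancel im re using \<rho>0 by (simp add: abs_mult)
  qed
  moreover have "\<bar>arctan x\<bar> = arctan \<bar>x\<bar>" for x
    by (cases "x \<ge> 0") (auto simp: arctan_minus)
  ultimately show ?thesis
    using \<rho> by (simp add: half_area_arctan isosceles_half_area_def)
qed

text \<open>In terms of \<open>C = cosh R\<close> and \<open>K = cosh^2 (d / 2)\<close> the tangent
  of the half area is \<open>D * sqrt (f C)\<close>. After cross-multiplication the difference of
  two values of \<open>f\<close> has the factor \<open>b - a\<close>, and the cofactor is visibly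
  nonnegative.\<close>

lemma isosceles_half_area_mono:
  assumes "0 \<le> D" "D \<le> S" "S \<le> T"
  shows "isosceles_half_area S D \<le> isosceles_half_area T D"
proof -
  define K where "K = 1 + D\<^sup>2"
  define f where "f C = (C\<^sup>2 - K) / (C + K)\<^sup>2" for C :: real
  have K: "K \<ge> 1" by (simp add: K_def)
  have f_mono: "f a \<le> f b" if ab: "0 \<le> a" "a \<le> b" for a b
  proof -
    have "a + K > 0" "b + K > 0"
      using ab K by linarith+
    then have pos: "0 < (a + K)\<^sup>2" "0 < (b + K)\<^sup>2"
      by simp_all
    have "(b\<^sup>2 - K) * (a + K)\<^sup>2 - (a\<^sup>2 - K) * (b + K)\<^sup>2
        = (b - a) * K * (2 * a * b + (a + b) * K + (a + b) + 2 * K)"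
      by (simp add: power2_eq_square algebra_simps)
    also have "\<dots> \<ge> 0"
      using ab K by (intro mult_nonneg_nonneg add_nonneg_nonneg) auto
    finally have "(a\<^sup>2 - K) * (b + K)\<^sup>2 \<le> (b\<^sup>2 - K) * (a + K)\<^sup>2"
      by linarith
    then have "(a\<^sup>2 - K) \<le> (b\<^sup>2 - K) * (a + K)\<^sup>2 / (b + K)\<^sup>2"
      by (simp only: pos_le_divide_eq[OF pos(2)])
    then show ?thesis
      unfolding f_def pos_divide_le_eq[OF pos(1)] by (simp only: times_divide_eq_left)
  qed
  have iso: "isosceles_half_area X D = arctan (D * sqrt (f (sqrt (1 + X\<^sup>2))))" if "X \<ge> D" for X
  proof -
    have "sqrt (1 + X\<^sup>2) + K > 0"
      using K by (simp add: add_nonneg_pos)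
    moreover have "X\<^sup>2 - D\<^sup>2 = (sqrt (1 + X\<^sup>2))\<^sup>2 - K"
      by (simp add: K_def)
    ultimately show ?thesis
      unfolding isosceles_half_area_def f_def
      by (simp add: real_sqrt_divide K_def add.assoc)
  qed
  have "sqrt (1 + S\<^sup>2) \<le> sqrt (1 + T\<^sup>2)"
    using assms by (simp add: power_mono)
  then have "f (sqrt (1 + S\<^sup>2)) \<le> f (sqrt (1 + T\<^sup>2))"
    by (intro f_mono) auto
  then have "D * sqrt (f (sqrt (1 + S\<^sup>2))) \<le> D * sqrt (f (sqrt (1 + T\<^sup>2)))"
    using assms by (intro mult_left_mono real_sqrt_le_mono) auto
  moreover have "T \<ge> D" using assms by linarith
  ultimately show ?thesis
    unfolding iso[OF assms(2)] iso[OF \<open>T \<ge> D\<close>] arctan_le_iff by blast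
qed

section \<open>Optimal chains\<close>

text \<open>A chord determines the central angle up to its sense of rotation, which is the sign
  \<open>\<epsilon>\<close>; \<open>arcsin (D / S)\<close> is half that angle.\<close>

lemma circle_chord_rotation:
  fixes p q :: complex and \<rho> S D :: real
  assumes \<rho>: "cmod p = \<rho>" "cmod q = \<rho>" "0 < \<rho>" "\<rho> < 1" and S: "S = 2 * \<rho> / (1 - \<rho>\<^sup>2)"
    and D: "chord_sq p q = D\<^sup>2" "0 \<le> D"
  obtains \<epsilon> where "\<bar>\<epsilon>\<bar> = 1" "q = p * cis (\<epsilon> * (2 * arcsin (D / S)))"
proof -
  have pos: "0 < 1 - \<rho>\<^sup>2"
    using \<rho> one_minus_norm_sq_pos[of p] by auto
  have DS: "D \<le> S" "0 < S"
    using chord_circle_facts(3)[OF \<rho>(1,2,4) S D] \<rho> pos S by auto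
  define t where "t = arcsin (D / S)"
  have sint: "sin t = D / S"
    unfolding t_def using DS D by (intro sin_arcsin) (auto simp: divide_simps)
  define w where "w = q * cnj p / of_real (\<rho>\<^sup>2)"
  have nw: "cmod w = 1"
    using \<rho> by (simp add: w_def norm_divide norm_mult power2_eq_square)
  have pp: "p * cnj p = of_real (\<rho>\<^sup>2)"
    using \<rho>(1) by (simp flip: norm_sq_cnj)
  have q: "q = p * w"
  proof -
    have "p * w = q * (p * cnj p) / of_real (\<rho>\<^sup>2)"
      by (simp add: w_def)
    then show ?thesis
      unfolding pp using \<rho> by simp
  qed
  have "Re w * \<rho>\<^sup>2 = Re (p * cnj q)"
    using \<rho> by (simp add: w_def)
  also have "\<dots> = \<rho>\<^sup>2 - D\<^sup>2 * (1 - \<rho>\<^sup>2)\<^sup>2 / 2"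
    by (rule chord_circle_facts(1)[OF \<rho>(1,2,4) S D])
  also have "\<dots> = (1 - 2 * (sin t)\<^sup>2) * \<rho>\<^sup>2"
    unfolding sint S using \<rho> pos by (simp add: field_simps power2_eq_square)
  finally have "Re w = cos (2 * t)"
    using \<rho> by (simp add: cos_double_sin)
  moreover have "(Re w)\<^sup>2 + (Im w)\<^sup>2 = 1"
    using nw by (simp flip: cmod_power2)
  ultimately have "(Im w)\<^sup>2 = (sin (2 * t))\<^sup>2"
    using sin_cos_squared_add[of "2 * t"] by (simp only:)
  then have "Im w = sin (2 * t) \<or> Im w = - sin (2 * t)"
    by (simp add: power2_eq_iff)
  then have "w = cis (1 * (2 * t)) \<or> w = cis (- 1 * (2 * t))"
    using \<open>Re w = cos (2 * t)\<close> by (auto simp: complex_eq_iff)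
  then show ?thesis
    using q that[of 1] that[of "- 1"] unfolding t_def by fastforce
qed

text \<open>The signed half angles add up to some \<open>T\<close> with
  \<open>cis (2 * T) = - 1\<close>, hence to an odd multiple of \<open>pi / 2\<close>. Dropping the
  signs can only increase the sum. Equality may fail, as the chain may turn back or go round more
  than half of the circle.\<close>

lemma circle_chain_angle_sum:
  fixes p :: "nat \<Rightarrow> complex" and D :: "nat \<Rightarrow> real"
  assumes \<rho>: "\<And>i. i \<le> m \<Longrightarrow> cmod (p i) = \<rho>" "0 < \<rho>" "\<rho> < 1" and S: "S = 2 * \<rho> / (1 - \<rho>\<^sup>2)"
    and D: "\<And>i. i < m \<Longrightarrow> chord_sq (p i) (p (Suc i)) = (D i)\<^sup>2" "\<And>i. i < m \<Longrightarrow> 0 \<le> D i"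
    and ends: "p m = - p 0"
  shows "pi / 2 \<le> (\<Sum>i<m. arcsin (D i / S))"
proof -
  have "\<exists>\<epsilon>. \<bar>\<epsilon>\<bar> = 1 \<and> p (Suc i) = p i * cis (\<epsilon> * (2 * arcsin (D i / S)))" if "i < m" for i
    using circle_chord_rotation[OF \<rho>(1)[of i] \<rho>(1)[of "Suc i"] \<rho>(2,3) S D(1)[OF that] D(2)[OF that]] that
    by (metis Suc_leI less_imp_le)
  then obtain \<epsilon> where \<epsilon>: "\<And>i. i < m \<Longrightarrow> \<bar>\<epsilon> i\<bar> = 1"
      "\<And>i. i < m \<Longrightarrow> p (Suc i) = p i * cis (\<epsilon> i * (2 * arcsin (D i / S)))"
    by metis
  have prod: "p k = p 0 * cis (2 * (\<Sum>i<k. \<epsilon> i * arcsin (D i / S)))" if "k \<le> m" for k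
    using that
  proof (induction k)
    case (Suc k)
    then show ?case
      using \<epsilon>(2)[of k] by (simp add: mult.assoc cis_mult algebra_simps)
  qed simp
  define T where "T = (\<Sum>i<m. \<epsilon> i * arcsin (D i / S))"
  have "p 0 \<noteq> 0"
    using \<rho>(1)[of 0] \<rho>(2) by auto
  then have "cis (2 * T) = - 1"
    using prod[of m] ends by (simp add: T_def) (metis mult_cancel_left mult_minus1_right)
  then have "cos (2 * T) = - 1"
    by (metis cis.sel(1) one_complex.sel(1) uminus_complex.sel(1))
  have "\<bar>T\<bar> \<ge> pi / 2"
  proof (rule ccontr)
    assume "\<not> ?thesis"
    then have "- (pi / 2) < T" "T < pi / 2" by auto
    then have "cos T > 0" by (intro cos_gt_zero_pi)
    then show False
      using \<open>cos (2 * T) = - 1\<close> by (simp add: cos_double_cos)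
  qed
  also have "\<bar>T\<bar> \<le> (\<Sum>i<m. \<bar>\<epsilon> i * arcsin (D i / S)\<bar>)"
    unfolding T_def by (rule sum_abs)
  also have "\<dots> = (\<Sum>i<m. arcsin (D i / S))"
  proof (rule sum.cong)
    fix i assume i: "i \<in> {..<m}"
    have "D i \<le> S"
      using chord_circle_facts(3)[OF \<rho>(1)[of i] \<rho>(1)[of "Suc i"] \<rho>(3) S D(1)[of i] D(2)[of i]] i by auto
    then have "0 \<le> arcsin (D i / S)"
      using D(2)[of i] i by (intro arcsin_le_arcsin[of 0, simplified]) (auto simp: divide_simps)
    then show "\<bar>\<epsilon> i * arcsin (D i / S)\<bar> = arcsin (D i / S)"
      using \<epsilon>(1)[of i] i by (simp add: abs_mult)
  qed simp
  finally show ?thesis .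
qed

section \<open>Signed area of a closed chain and rotation of its tail\<close>

definition chain_half_area :: "nat \<Rightarrow> (nat \<Rightarrow> complex) \<Rightarrow> real" where
  "chain_half_area m p = (\<Sum>i<m. half_area (p i) (p (Suc i))) + half_area (p m) (p 0)"

lemma chain_half_area_cong:
  "(\<And>i. i \<le> m \<Longrightarrow> p i = q i) \<Longrightarrow> chain_half_area m p = chain_half_area m q"
  by (simp add: chain_half_area_def)

text \<open>Serves both uses of the cocycle property: moving the whole chain, where the closing side
  cancels the two end terms, and moving its tail alone.\<close>

lemma sum_half_area_telescope:
  assumes "\<And>i. i < m \<Longrightarrow> half_area (p' i) (p' (Suc i)) = half_area (p i) (p (Suc i)) + g i - g (Suc i)"
  shows "(\<Sum>i<m. half_area (p' i) (p' (Suc i))) = (\<Sum>i<m. half_area (p i) (p (Suc i))) + g 0 - g m"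
proof -
  have "(\<Sum>i<m. half_area (p' i) (p' (Suc i))) = (\<Sum>i<m. half_area (p i) (p (Suc i)) + (g i - g (Suc i)))"
    using assms by (intro sum.cong) auto
  also have "\<dots> = (\<Sum>i<m. half_area (p i) (p (Suc i))) + g 0 - g m"
    using sum_lessThan_telescope'[of g m] by (simp only: sum.distrib)
  finally show ?thesis .
qed

lemma chain_half_area_moebius:
  assumes "cmod c < 1" "\<And>i. i \<le> m \<Longrightarrow> cmod (p i) < 1"
  shows "chain_half_area m (\<lambda>i. moebius c (p i)) = chain_half_area m p"
proof -
  have "(\<Sum>i<m. half_area (moebius c (p i)) (moebius c (p (Suc i))))
      = (\<Sum>i<m. half_area (p i) (p (Suc i))) + (- half_area (p 0) c) - (- half_area (p m) c)"
    using assms by (intro sum_half_area_telescope) (simp add: half_area_moebius)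
  then show ?thesis
    using assms by (simp add: chain_half_area_def half_area_moebius)
qed

definition rotation_about :: "complex \<Rightarrow> complex \<Rightarrow> complex \<Rightarrow> complex" where
  "rotation_about c u p = moebius (- c) (u * moebius c p)"

lemma rotation_about_self [simp]: "rotation_about c u c = c"
  by (simp add: rotation_about_def)

context
  fixes c u :: complex
  assumes c: "cmod c < 1" and u: "cmod u = 1"
begin

lemma norm_rotated_moebius: "cmod p < 1 \<Longrightarrow> cmod (u * moebius c p) < 1"
  using c u norm_moebius_less by (simp add: norm_mult)

lemma norm_rotation_about_less: "cmod p < 1 \<Longrightarrow> cmod (rotation_about c u p) < 1"
  unfolding rotation_about_def using c norm_rotated_moebius by (intro norm_moebius_less) auto

lemma moebius_rotation_about: "cmod p < 1 \<Longrightarrow> moebius c (rotation_about c u p) = u * moebius c p"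
  unfolding rotation_about_def using moebius_inverse[of "- c"] c norm_rotated_moebius by simp

lemma chord_sq_rotation_about:
  "cmod p < 1 \<Longrightarrow> cmod q < 1 \<Longrightarrow> chord_sq (rotation_about c u p) (rotation_about c u q) = chord_sq p q"
  unfolding rotation_about_def
  using c u norm_rotated_moebius by (simp add: chord_sq_moebius chord_sq_rotate)

lemma half_area_rotation_about:
  assumes "cmod p < 1" "cmod q < 1"
  shows "half_area (rotation_about c u p) (rotation_about c u q) = half_area p q
    + (- half_area p c - half_area (u * moebius c p) (- c)) - (- half_area q c - half_area (u * moebius c q) (- c))"
  unfolding rotation_about_def
  using assms c norm_rotated_moebius by (simp add: half_area_moebius half_area_rotate[OF u])

end

text \<open>Moving the tail leaves every side of the open chain intact, so by telescoping only the
  triangle \<open>p j, p m, p 0\<close> changes its area. Seen from \<open>p j\<close> at the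
  origin, the tail end \<open>a\<close> is multiplied by \<open>u\<close> while \<open>b\<close>
  stays fixed, so \<open>Re_mult_cnj_of_half_area_max\<close> applies to this triangle.\<close>

lemma chord_sq_pythagoras_of_max:
  assumes p: "\<And>i. i \<le> m \<Longrightarrow> cmod (p i) < 1" and j: "j \<le> m"
    and max: "\<And>u. cmod u = 1 \<Longrightarrow>
      chain_half_area m (\<lambda>i. if i \<le> j then p i else rotation_about (p j) u (p i)) \<le> chain_half_area m p"
  shows "chord_sq (p 0) (p m) = chord_sq (p 0) (p j) + chord_sq (p j) (p m)"
proof -
  define c where "c = p j"
  have c: "cmod c < 1" and p0: "cmod (p 0) < 1" and pm: "cmod (p m) < 1"
    using p j by (auto simp: c_def)
  define a b where "a = moebius c (p m)" and "b = moebius c (p 0)"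
  have ab: "cmod a < 1" "cmod b < 1"
    using c p0 pm by (auto simp: a_def b_def norm_moebius_less)
  have "half_area (u * a) b \<le> half_area a b" if u: "cmod u = 1" for u
  proof -
    define R where "R = rotation_about c u"
    define H where "H x = - half_area x c - half_area (u * moebius c x) (- c)" for x
    define p' where "p' i = (if i \<le> j then p i else R (p i))" for i
    \<comment> \<open>Up to the pivot nothing moves and the potential is constant. The constant
      \<open>H c\<close> makes the two branches agree at \<open>j\<close>, where the rotation fixes
      \<open>p j = c\<close>.\<close>
    define g where "g i = (if i \<le> j then H c else H (p i))" for i
    have R: "half_area (R x) (R y) = half_area x y + H x - H y" if "cmod x < 1" "cmod y < 1" for x y
      unfolding R_def H_def by (rule half_area_rotation_about[OF c u that])
    have Rc: "R c = c" by (simp add: R_def)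
    have p'_eq: "p' i = R (p i)" "g i = H (p i)" if "j \<le> i" for i
      using that Rc by (auto simp: p'_def g_def c_def)
    have "(\<Sum>i<m. half_area (p' i) (p' (Suc i))) = (\<Sum>i<m. half_area (p i) (p (Suc i))) + g 0 - g m"
    proof (rule sum_half_area_telescope)
      fix i assume i: "i < m"
      show "half_area (p' i) (p' (Suc i)) = half_area (p i) (p (Suc i)) + g i - g (Suc i)"
      proof (cases "j \<le> i")
        case True
        then show ?thesis
          using i p R by (simp add: p'_eq)
      next
        case False
        then show ?thesis by (simp add: p'_def g_def)
      qed
    qed
    moreover have "g 0 = H c" "g m = H (p m)" "p' 0 = p 0" "p' m = R (p m)"
      using p'_eq[OF j] by (simp_all add: g_def p'_def)
    ultimately have "H c - H (p m) + half_area (R (p m)) (p 0) \<le> half_area (p m) (p 0)"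
      using max[OF u] unfolding chain_half_area_def p'_def[abs_def, unfolded R_def c_def, symmetric]
      by (simp add: R_def c_def)
    moreover have "half_area (R (p m)) c = half_area (p m) c + H (p m) - H c"
      using R[OF pm c] Rc by simp
    moreover have "half_area (u * a) b = half_area (R (p m)) (p 0) - half_area (R (p m)) c + half_area (p 0) c"
      using half_area_moebius[OF c _ p0, of "R (p m)"] norm_rotation_about_less[OF c u pm]
        moebius_rotation_about[OF c u pm] by (simp add: a_def b_def R_def)
    moreover have "half_area a b = half_area (p m) (p 0) - half_area (p m) c + half_area (p 0) c"
      unfolding a_def b_def by (rule half_area_moebius[OF c pm p0])
    ultimately show ?thesis by linarith
  qed
  then have "chord_sq b a = chord_sq b 0 + chord_sq 0 a"
    using ab by (intro chord_sq_pythagoras Re_mult_cnj_of_half_area_max)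
  moreover have "chord_sq b a = chord_sq (p 0) (p m)" "chord_sq b 0 = chord_sq (p 0) c" "chord_sq 0 a = chord_sq c (p m)"
    using chord_sq_moebius[OF c p0 pm] chord_sq_moebius[OF c p0 c] chord_sq_moebius[OF c c pm]
    by (simp_all add: a_def b_def)
  ultimately show ?thesis by (simp add: c_def)
qed

section \<open>Centring a chain, and compactness of the space of chains\<close>

text \<open>
  Read in the Poincare disc, \<open>poincare x\<close> is the point \<open>x\<close> of the Klein disc; it is also the
  midpoint of \<open>0\<close> and the point \<open>x\<close> of the Poincare disc.
\<close>

definition poincare :: "complex \<Rightarrow> complex" where
  "poincare x = x / of_real (1 + sqrt (1 - (cmod x)\<^sup>2))"

lemma norm_poincare_sq:
  assumes "cmod x < 1"
  shows "(cmod (poincare x))\<^sup>2 = (1 - sqrt (1 - (cmod x)\<^sup>2)) / (1 + sqrt (1 - (cmod x)\<^sup>2))"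
proof -
  define s where "s = sqrt (1 - (cmod x)\<^sup>2)"
  have s: "0 < s" "(cmod x)\<^sup>2 = 1 - s\<^sup>2"
    using one_minus_norm_sq_pos[OF assms] by (simp_all add: s_def)
  have "(cmod (poincare x))\<^sup>2 = (1 - s\<^sup>2) / (1 + s)\<^sup>2"
    using s(1) unfolding poincare_def s_def[symmetric] norm_divide power_divide s(2) norm_of_real by simp
  also have "\<dots> = (1 - s) / (1 + s)"
    using s(1) by (simp add: divide_simps) (simp add: power2_eq_square algebra_simps)
  finally show ?thesis by (simp add: s_def)
qed

lemma norm_poincare_less:
  assumes "cmod x < 1"
  shows "cmod (poincare x) < 1"
proof -
  have "0 < sqrt (1 - (cmod x)\<^sup>2)"
    using one_minus_norm_sq_pos[OF assms] by simp
  then have "(cmod (poincare x))\<^sup>2 < 1"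
    unfolding norm_poincare_sq[OF assms] by (simp add: divide_less_eq add_pos_pos)
  then show ?thesis
    by (simp add: abs_square_less_1)
qed

text \<open>Together with \<open>moebius_zero\<close> this sends the ends \<open>0\<close> and
  \<open>x\<close> of a chain to the opposite points \<open>- c\<close> and \<open>c\<close>, where
  \<open>c = poincare x\<close>; this is the position that the Thales lemma asks for.\<close>

lemma moebius_poincare_midpoint:
  assumes "cmod x < 1"
  shows "moebius (poincare x) x = poincare x"
proof -
  define s where "s = sqrt (1 - (cmod x)\<^sup>2)"
  define c where "c = poincare x"
  have s: "0 < s"
    using one_minus_norm_sq_pos[OF assms] by (simp add: s_def)
  have x: "x = of_real (1 + s) * c"
  proof -
    have "complex_of_real (1 + s) \<noteq> 0"
      using s by (simp only: of_real_eq_0_iff)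
    then show ?thesis
      unfolding c_def poincare_def s_def[symmetric] by (simp del: of_real_add)
  qed
  have cc: "cnj c * c = of_real ((1 - s) / (1 + s))"
    using norm_poincare_sq[OF assms] norm_sq_cnj[of c]
    by (metis c_def mult.commute of_real_power s_def)
  have "cnj c * (of_real (1 + s) * c) = of_real (1 + s) * (cnj c * c)"
    by (rule mult.left_commute)
  then have "1 - cnj c * x = 1 - of_real (1 + s) * of_real ((1 - s) / (1 + s))"
    by (simp only: x cc)
  also have "\<dots> = of_real s"
    using s unfolding of_real_mult[symmetric] by simp
  finally have d: "1 - cnj c * x = of_real s" .
  have "x - c = of_real s * c"
    unfolding x by (simp add: algebra_simps)
  then show ?thesis
    using s d by (simp add: Moebius_function_simple flip: c_def)
qed

text \<open>Compactness needs all chains that start at 0 to stay in one closed disc inside the open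
  unit disc. Hyperbolically this is the triangle inequality; here the radius is found by induction
  along the chain.\<close>

lemma chain_norm_bound:
  fixes D :: "nat \<Rightarrow> real"
  shows "\<exists>r. 0 \<le> r \<and> r < 1 \<and> (\<forall>p. p 0 = 0 \<longrightarrow> (\<forall>i\<le>m. cmod (p i) < 1) \<longrightarrow>
    (\<forall>i<m. (cmod (p i - p (Suc i)))\<^sup>2 = (D i)\<^sup>2 * (1 - (cmod (p i))\<^sup>2) * (1 - (cmod (p (Suc i)))\<^sup>2)) \<longrightarrow>
    (\<forall>i\<le>m. cmod (p i) \<le> r))"
proof (induction m)
  case 0
  show ?case by (intro exI[of _ 0]) auto
next
  case (Suc m)
  then obtain r where r: "0 \<le> r" "r < 1" and
    IH: "\<And>p i. p 0 = 0 \<Longrightarrow> (\<forall>i\<le>m. cmod (p i) < 1) \<Longrightarrow>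
    (\<forall>i<m. (cmod (p i - p (Suc i)))\<^sup>2 = (D i)\<^sup>2 * (1 - (cmod (p i))\<^sup>2) * (1 - (cmod (p (Suc i)))\<^sup>2)) \<Longrightarrow>
    i \<le> m \<Longrightarrow> cmod (p i) \<le> r"
    by blast
  \<comment> \<open>For consecutive moduli \<open>x \<le> r\<close> and \<open>y\<close>, the
    identity \<open>(1 - x y)^2 = (x - y)^2 + (1 - x^2) (1 - y^2)\<close> and the side equation give
    \<open>(1 - r)^2 \<le> 2 (D^2 + 1) (1 - y)\<close>. So \<open>e\<close> is a lower bound for
    \<open>1 - y\<close>.\<close>
  define e where "e = (1 - r)\<^sup>2 / (2 * ((D m)\<^sup>2 + 1))"
  have den: "0 < (D m)\<^sup>2 + 1"
    by (simp add: add_nonneg_pos)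
  have e: "0 < e" "e \<le> 1"
  proof -
    show "0 < e"
      using r den by (simp add: e_def)
    have "(1 - r)\<^sup>2 \<le> 1"
      using r by (simp add: power_le_one)
    also have "1 \<le> 2 * ((D m)\<^sup>2 + 1)"
      by simp
    finally have "(1 - r)\<^sup>2 \<le> 2 * ((D m)\<^sup>2 + 1)" .
    then show "e \<le> 1"
      using den by (simp add: e_def)
  qed
  show ?case
  proof (intro exI[of _ "max r (1 - e)"] conjI allI impI)
    show "0 \<le> max r (1 - e)" "max r (1 - e) < 1"
      using r e by auto
    fix p :: "nat \<Rightarrow> complex" and i
    assume p: "p 0 = 0" "\<forall>i\<le>Suc m. cmod (p i) < 1"
      "\<forall>i<Suc m. (cmod (p i - p (Suc i)))\<^sup>2 = (D i)\<^sup>2 * (1 - (cmod (p i))\<^sup>2) * (1 - (cmod (p (Suc i)))\<^sup>2)"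
      and i: "i \<le> Suc m"
    have IHp: "i \<le> m \<Longrightarrow> cmod (p i) \<le> r" for i
      using p by (intro IH[of p]) auto
    show "cmod (p i) \<le> max r (1 - e)"
    proof (cases "i \<le> m")
      case True
      then show ?thesis using IHp by (simp add: le_max_iff_disj)
    next
      case False
      then have i: "i = Suc m" using i by simp
      define x y where "x = cmod (p m)" and "y = cmod (p (Suc m))"
      have x: "0 \<le> x" "x \<le> r" and y: "0 \<le> y" "y < 1"
        using IHp p by (auto simp: x_def y_def)
      have "(y - x)\<^sup>2 \<le> (cmod (p m - p (Suc m)))\<^sup>2"
        unfolding x_def y_def using norm_triangle_ineq3[of "p (Suc m)" "p m"]
        by (intro abs_le_square_iff[THEN iffD1]) (simp add: norm_minus_commute)
      also have "\<dots> = (D m)\<^sup>2 * (1 - x\<^sup>2) * (1 - y\<^sup>2)"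
        using p by (simp add: x_def y_def)
      finally have "(1 - x * y)\<^sup>2 \<le> ((D m)\<^sup>2 + 1) * ((1 - x\<^sup>2) * (1 - y\<^sup>2))"
        by (simp add: power2_eq_square algebra_simps)
      also have "\<dots> \<le> ((D m)\<^sup>2 + 1) * (1 * (2 * (1 - y)))"
      proof (intro mult_left_mono mult_mono)
        have "(1 - y) * (1 + y) \<le> (1 - y) * 2"
          using y by (intro mult_left_mono) auto
        then show "1 - y\<^sup>2 \<le> 2 * (1 - y)"
          by (simp add: power2_eq_square algebra_simps)
        show "0 \<le> 1 - y\<^sup>2"
          using y by (simp add: power_le_one)
      qed (use x r den in auto)
      finally have "(1 - x * y)\<^sup>2 \<le> 2 * ((D m)\<^sup>2 + 1) * (1 - y)"
        by (simp only: mult_ac mult_1)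
      moreover have "(1 - r)\<^sup>2 \<le> (1 - x * y)\<^sup>2"
      proof (rule power_mono)
        have "x * y \<le> x * 1" using x y by (intro mult_left_mono) auto
        then show "1 - r \<le> 1 - x * y" using x by simp
      qed (use r in auto)
      ultimately have "(1 - r)\<^sup>2 \<le> (1 - y) * (2 * ((D m)\<^sup>2 + 1))"
        by (simp add: mult.commute)
      then have "e \<le> 1 - y"
        using den unfolding e_def by (subst pos_divide_le_eq) auto
      then show ?thesis
        unfolding i y_def by simp
    qed
  qed
qed

text \<open>Chains are points of the product space of all sequences: compactness is Tychonoff's
  theorem, and each vertex is a continuous coordinate.\<close>

lemma compact_cball_functions:
  "compact {p :: nat \<Rightarrow> complex. \<forall>i. p i \<in> cball 0 r}"
proof -
  have "compactin (product_topology (\<lambda>_. euclidean) UNIV) (PiE UNIV (\<lambda>_::nat. cball (0::complex) r))"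
    unfolding compactin_PiE by auto
  moreover have "{p. \<forall>i. p i \<in> cball 0 r} = PiE UNIV (\<lambda>_::nat. cball (0::complex) r)"
    by (auto simp: PiE_UNIV_domain)
  ultimately show ?thesis
    by (simp only: euclidean_product_topology compactin_euclidean_iff)
qed

lemma isosceles_half_area_nonneg: "0 \<le> D \<Longrightarrow> D \<le> S \<Longrightarrow> 0 \<le> isosceles_half_area S D"
  unfolding isosceles_half_area_def
  by (simp add: zero_le_arctan_iff power_mono add_nonneg_nonneg)

lemma chord_sq_eq_iff:
  assumes "cmod p < 1" "cmod q < 1"
  shows "chord_sq p q = D \<longleftrightarrow> (cmod (p - q))\<^sup>2 = D * (1 - (cmod p)\<^sup>2) * (1 - (cmod q)\<^sup>2)"
  using one_minus_norm_sq_pos[OF assms(1)] one_minus_norm_sq_pos[OF assms(2)]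
  unfolding chord_sq_def by (simp add: divide_eq_eq mult.assoc)

text \<open>The chain lies on a circle whose \<open>T\<close> may be smaller than \<open>S\<close>.
  Monotonicity in the radius absorbs this, and passing to absolute values absorbs sides that run
  backwards.\<close>

lemma pythagorean_chain_half_area_le:
  fixes p :: "nat \<Rightarrow> complex" and D :: "nat \<Rightarrow> real"
  assumes m: "0 < m"
    and p: "p 0 = 0" "\<And>i. i \<le> m \<Longrightarrow> cmod (p i) < 1"
    and D: "\<And>i. i < m \<Longrightarrow> chord_sq (p i) (p (Suc i)) = (D i)\<^sup>2" "\<And>i. i < m \<Longrightarrow> 0 < D i"
    and S: "\<And>i. i < m \<Longrightarrow> D i \<le> S" "(\<Sum>i<m. arcsin (D i / S)) \<le> pi / 2"
    and pyth: "\<And>j. j \<le> m \<Longrightarrow> chord_sq (p 0) (p m) = chord_sq (p 0) (p j) + chord_sq (p j) (p m)"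
  shows "chain_half_area m p \<le> (\<Sum>i<m. isosceles_half_area S (D i))"
proof -
  define c where "c = poincare (p m)"
  define y where "y i = moebius c (p i)" for i
  define \<rho> where "\<rho> = cmod c"
  have c: "cmod c < 1"
    using p(2)[of m] by (simp add: c_def norm_poincare_less)
  have y1: "cmod (y i) < 1" if "i \<le> m" for i
    using that p(2) c by (simp add: y_def norm_moebius_less)
  have y0: "y 0 = - c" and ym: "y m = c"
    using p(2)[of m] by (simp_all add: y_def p(1) c_def moebius_poincare_midpoint)
  have chord: "chord_sq (y i) (y j) = chord_sq (p i) (p j)" if "i \<le> m" "j \<le> m" for i j
    using that p(2) c by (simp add: y_def chord_sq_moebius)
  have yr: "cmod (y i) = \<rho>" if "i \<le> m" for i
    unfolding \<rho>_def
  proof (rule norm_eq_of_chord_sq_pythagoras[OF c y1[OF that]])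
    show "chord_sq (- c) c = chord_sq (- c) (y i) + chord_sq (y i) c"
      using pyth[OF that] chord[of 0 m] chord[of 0 i] chord[of i m] that y0 ym by simp
  qed
  have D': "chord_sq (y i) (y (Suc i)) = (D i)\<^sup>2" if "i < m" for i
    using that D(1) chord by simp
  have \<rho>: "0 < \<rho>" "\<rho> < 1"
  proof -
    show "0 < \<rho>"
    proof (rule ccontr)
      assume "\<not> ?thesis"
      then have "\<rho> = 0" by (simp add: \<rho>_def)
      then have "y 0 = 0" "y 1 = 0"
        using yr[of 0] yr[of 1] m by auto
      then show False
        using D'[of 0] D(2)[of 0] m by (simp add: chord_sq_def)
    qed
  qed (use c in \<open>simp add: \<rho>_def\<close>)
  define T where "T = 2 * \<rho> / (1 - \<rho>\<^sup>2)"
  have DT: "D i \<le> T" if "i < m" for i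
    using chord_circle_facts(3)[OF yr[of i] yr[of "Suc i"] \<rho>(2) T_def D'[OF that]] D(2)[OF that] that by simp
  have angle: "pi / 2 \<le> (\<Sum>i<m. arcsin (D i / T))"
    by (rule circle_chain_angle_sum[where p = y and \<rho> = \<rho>])
      (use yr \<rho> T_def D' D(2) y0 ym in \<open>auto intro: less_imp_le\<close>)
  have TS: "T \<le> S"
  proof (rule ccontr)
    \<comment> \<open>A larger circle would make every half angle strictly smaller, so their sum
      would fall below \<open>pi / 2\<close>.\<close>
    assume "\<not> T \<le> S"
    then have ST: "S < T" by simp
    have "(\<Sum>i<m. arcsin (D i / T)) < (\<Sum>i<m. arcsin (D i / S))"
    proof (rule sum_strict_mono)
      fix i assume "i \<in> {..<m}"
      then have i: "0 < D i" "D i \<le> S"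
        using D(2) S(1) by auto
      then have "D i / T < D i / S" "0 \<le> D i / T" "D i / S \<le> 1"
        using ST by (auto simp: frac_less2 divide_simps)
      then show "arcsin (D i / T) < arcsin (D i / S)"
        by (intro arcsin_less_arcsin) auto
    qed (use m in auto)
    then show False
      using angle S(2) by linarith
  qed
  have "chain_half_area m p = chain_half_area m y"
    unfolding y_def using chain_half_area_moebius[OF c p(2)] by simp
  \<comment> \<open>The closing side is a diameter through the origin and contributes no
    area.\<close>
  also have "\<dots> = (\<Sum>i<m. half_area (y i) (y (Suc i)))"
    using c by (simp add: chain_half_area_def y0 ym)
  also have "\<dots> \<le> (\<Sum>i<m. isosceles_half_area S (D i))"
  proof (rule sum_mono)
    fix i assume "i \<in> {..<m}"
    then have i: "i < m" by simp
    have "half_area (y i) (y (Suc i)) \<le> \<bar>half_area (y i) (y (Suc i))\<bar>" by simp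
    also have "\<dots> = isosceles_half_area T (D i)"
      using i D(2)[OF i] by (intro abs_half_area_circle[OF yr yr \<rho>(2) T_def D'[OF i]]) auto
    also have "\<dots> \<le> isosceles_half_area S (D i)"
      using D(2)[OF i] DT[OF i] TS by (intro isosceles_half_area_mono) auto
    finally show "half_area (y i) (y (Suc i)) \<le> isosceles_half_area S (D i)" .
  qed
  finally show ?thesis .
qed

text \<open>Pinning the first vertex at 0 removes the noncompact group of isometries. Rotating the
  part of the chain behind a vertex keeps the first vertex in place, so the comparison chains stay
  in the same compact family.\<close>

theorem chain_half_area_le:
  fixes p :: "nat \<Rightarrow> complex" and D :: "nat \<Rightarrow> real"
  assumes m: "0 < m"
    and p: "\<And>i. i \<le> m \<Longrightarrow> cmod (p i) < 1"
    and D: "\<And>i. i < m \<Longrightarrow> chord_sq (p i) (p (Suc i)) = (D i)\<^sup>2" "\<And>i. i < m \<Longrightarrow> 0 < D i"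
    and S: "\<And>i. i < m \<Longrightarrow> D i \<le> S" "(\<Sum>i<m. arcsin (D i / S)) \<le> pi / 2"
  shows "chain_half_area m p \<le> (\<Sum>i<m. isosceles_half_area S (D i))"
proof -
  \<comment> \<open>With the denominators cleared, the side conditions are polynomial equations and
    so define a closed set in the space of all sequences.\<close>
  define is_chain where "is_chain q \<longleftrightarrow>
    (\<forall>i<m. (cmod (q i - q (Suc i)))\<^sup>2 = (D i)\<^sup>2 * (1 - (cmod (q i))\<^sup>2) * (1 - (cmod (q (Suc i)))\<^sup>2))" for q
  obtain r where r: "0 \<le> r" "r < 1" and
    bound: "\<And>q i. q 0 = 0 \<Longrightarrow> (\<forall>i\<le>m. cmod (q i) < 1) \<Longrightarrow> is_chain q \<Longrightarrow> i \<le> m \<Longrightarrow> cmod (q i) \<le> r"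
    using chain_norm_bound[of m D] unfolding is_chain_def by blast
  define K where "K = {q. \<forall>i. q i \<in> cball 0 r} \<inter> {q. q 0 = 0 \<and> is_chain q}"
  \<comment> \<open>Every entry of a sequence in \<open>K\<close> has to lie in the ball, so the
    entries behind \<open>m\<close>, which no side condition involves, are set to 0.\<close>
  have trunc: "(\<lambda>i. if i \<le> m then q i else 0) \<in> K"
    if q: "q 0 = 0" "\<And>i. i \<le> m \<Longrightarrow> cmod (q i) < 1"
      "\<And>i. i < m \<Longrightarrow> chord_sq (q i) (q (Suc i)) = (D i)\<^sup>2" for q
  proof -
    have "is_chain q"
      using q(2,3) unfolding is_chain_def by (simp add: chord_sq_eq_iff)
    then have "cmod (q i) \<le> r" if "i \<le> m" for i
      using bound[of q i] q that by blast
    then show ?thesis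
      using q(1) r(1) \<open>is_chain q\<close> by (auto simp: K_def is_chain_def)
  qed
  have "compact K"
  proof -
    have cont: "continuous_on UNIV (\<lambda>q :: nat \<Rightarrow> complex. q i)" for i
      by (rule continuous_on_product_coordinates)
    have "closed {q. q 0 = 0 \<and> is_chain q}"
      unfolding is_chain_def
      by (intro closed_Collect_conj closed_Collect_all closed_Collect_imp closed_Collect_eq
          continuous_intros cont open_Collect_const)
    then show ?thesis
      unfolding K_def using compact_cball_functions[of r] by (rule compact_Int_closed[rotated])
  qed
  have K1: "cmod (q i) < 1" if "q \<in> K" for q i
    using that r by (auto simp: K_def intro: le_less_trans)
  have Kchord: "chord_sq (q i) (q (Suc i)) = (D i)\<^sup>2" if "q \<in> K" "i < m" for q i
    using that K1 by (auto simp: K_def is_chain_def chord_sq_eq_iff)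
  have "continuous_on K (\<lambda>q. half_area (q i) (q j))" for i j
    unfolding half_area_def
  proof (intro continuous_intros)
    show "continuous_on K (\<lambda>q. q i)" "continuous_on K (\<lambda>q. q j)"
      by (rule continuous_on_subset[OF continuous_on_product_coordinates], simp)+
    show "1 - q i * cnj (q j) \<notin> \<real>\<^sub>\<le>\<^sub>0" if "q \<in> K" for q
      using Re_one_minus_cnj_pos[OF K1[OF that] K1[OF that], of i j]
      by (auto simp: complex_nonpos_Reals_iff simp del: minus_complex.simps)
  qed
  then have cont: "continuous_on K (chain_half_area m)"
    unfolding chain_half_area_def[abs_def] by (intro continuous_intros)
  define p0 where "p0 = (\<lambda>i. if i \<le> m then moebius (p 0) (p i) else 0)"
  have "p0 \<in> K"
    unfolding p0_def using p D(1)
    by (intro trunc) (simp_all add: norm_moebius_less chord_sq_moebius)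
  then obtain q where q: "q \<in> K" and max: "\<And>q'. q' \<in> K \<Longrightarrow> chain_half_area m q' \<le> chain_half_area m q"
    using continuous_attains_sup[OF \<open>compact K\<close> _ cont] by blast
  have q0: "q 0 = 0"
    using q by (simp add: K_def)
  have pyth: "chord_sq (q 0) (q m) = chord_sq (q 0) (q j) + chord_sq (q j) (q m)" if j: "j \<le> m" for j
  proof (rule chord_sq_pythagoras_of_max[OF K1[OF q] j])
    fix u :: complex assume u: "cmod u = 1"
    let ?R = "rotation_about (q j) u"
    let ?q = "\<lambda>i. if i \<le> j then q i else ?R (q i)"
    have "?q i = ?R (q i)" if "j \<le> i" for i
      using that by auto
    then have "chord_sq (?q i) (?q (Suc i)) = (D i)\<^sup>2" if "i < m" for i
      using that Kchord[OF q] chord_sq_rotation_about[OF K1[OF q] u K1[OF q] K1[OF q]]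
      by (cases "j \<le> i") (simp_all only: Suc_leI if_True not_le less_imp_le)
    moreover have "cmod (?q i) < 1" for i
      using K1[OF q] norm_rotation_about_less[OF K1[OF q] u] by simp
    ultimately have "(\<lambda>i. if i \<le> m then ?q i else 0) \<in> K"
      using q0 by (intro trunc) auto
    then have "chain_half_area m (\<lambda>i. if i \<le> m then ?q i else 0) \<le> chain_half_area m q"
      by (rule max)
    also have "chain_half_area m (\<lambda>i. if i \<le> m then ?q i else 0) = chain_half_area m ?q"
      by (rule chain_half_area_cong) simp
    finally show "chain_half_area m ?q \<le> chain_half_area m q" .
  qed
  have "chain_half_area m p = chain_half_area m (\<lambda>i. moebius (p 0) (p i))"
    using p by (intro chain_half_area_moebius[symmetric]) auto
  also have "\<dots> = chain_half_area m p0"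
    by (rule chain_half_area_cong) (simp add: p0_def)
  also have "\<dots> \<le> chain_half_area m q"
    using \<open>p0 \<in> K\<close> by (rule max)
  also have "\<dots> \<le> (\<Sum>i<m. isosceles_half_area S (D i))"
    by (rule pythagorean_chain_half_area_le[OF m q0 K1[OF q] Kchord[OF q] D(2) S pyth])
  finally show ?thesis .
qed

section \<open>The area of a polygon\<close>

lemma lborel_complex_eq: "(lborel :: complex measure) = distr (lborel \<Otimes>\<^sub>M lborel) borel (\<lambda>(x, y). Complex x y)"
proof (rule lborel_eqI)
  have meas [measurable]: "(\<lambda>(x, y). Complex x y) \<in> borel_measurable (lborel \<Otimes>\<^sub>M lborel)"
    unfolding lborel_prod borel_measurable_complex_iff split_beta'
    by (auto intro!: borel_measurable_continuous_onI continuous_intros)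
  fix l u :: complex
  assume lu: "\<And>b. b \<in> Basis \<Longrightarrow> l \<bullet> b \<le> u \<bullet> b"
  have le: "Re l \<le> Re u" "Im l \<le> Im u"
    using lu[of 1] lu[of \<i>] by (auto simp: Basis_complex_def)
  have "(\<lambda>(x, y). Complex x y) -` box l u = {Re l<..<Re u} \<times> {Im l<..<Im u}"
    by (auto simp: box_def Basis_complex_def)
  then have "emeasure (distr (lborel \<Otimes>\<^sub>M lborel) borel (\<lambda>(x, y). Complex x y)) (box l u)
      = emeasure (lborel \<Otimes>\<^sub>M lborel) ({Re l<..<Re u} \<times> {Im l<..<Im u})"
    by (subst emeasure_distr) (auto simp: space_pair_measure)
  also have "\<dots> = ennreal (Re u - Re l) * ennreal (Im u - Im l)"
    using le by (simp add: lborel.emeasure_pair_measure_Times)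
  also have "\<dots> = ennreal (\<Prod>b\<in>Basis. (u - l) \<bullet> b)"
    using le by (simp add: Basis_complex_def ennreal_mult complex_i_not_one)
  finally show "emeasure (distr (lborel \<Otimes>\<^sub>M lborel) borel (\<lambda>(x, y). Complex x y)) (box l u)
    = ennreal (\<Prod>b\<in>Basis. (u - l) \<bullet> b)" .
qed simp

lemma borel_measurable_affine_pair [measurable]:
  fixes a b :: complex
  shows "(\<lambda>(x, y). of_real x * a + of_real y * b) \<in> borel_measurable (borel \<Otimes>\<^sub>M borel)"
  unfolding borel_prod split_beta' by (intro borel_measurable_continuous_onI continuous_intros)

lemma nn_integral_complex:
  fixes f :: "complex \<Rightarrow> ennreal"
  assumes [measurable]: "f \<in> borel_measurable borel"
  shows "(\<integral>\<^sup>+z. f z \<partial>lborel) = (\<integral>\<^sup>+x. \<integral>\<^sup>+y. f (of_real x + of_real y * \<i>) \<partial>lborel \<partial>lborel)"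
proof -
  have [measurable]: "(\<lambda>(x, y). Complex x y) \<in> borel_measurable (borel \<Otimes>\<^sub>M borel)"
    using borel_measurable_affine_pair[of 1 \<i>] by (simp add: Complex_eq mult.commute)
  have "(\<integral>\<^sup>+z. f z \<partial>lborel) = (\<integral>\<^sup>+z. f (Complex (fst z) (snd z)) \<partial>(lborel \<Otimes>\<^sub>M lborel))"
    by (subst lborel_complex_eq, subst nn_integral_distr) (auto simp: split_beta')
  also have "\<dots> = (\<integral>\<^sup>+x. \<integral>\<^sup>+y. f (Complex x y) \<partial>lborel \<partial>lborel)"
    by (subst lborel.nn_integral_fst[symmetric]) (auto simp: split_beta')
  finally show ?thesis
    by (simp add: Complex_eq mult.commute)
qed

text \<open>The substitution \<open>z = r a + q b\<close> is carried out as two affine substitutions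
  on the line: \<open>y\<close> is replaced by \<open>q\<close> for fixed \<open>x\<close>, then
  \<open>x\<close> by \<open>r\<close> for fixed \<open>q\<close>. Their factors
  \<open>|k / Re a|\<close> and \<open>|Re a|\<close> multiply to the Jacobian. Division by
  \<open>Re a\<close> excludes \<open>Re a = 0\<close>, a case treated afterwards by exchanging
  \<open>a\<close> and \<open>b\<close>.\<close>

lemma nn_integral_linear_complex_aux:
  fixes f :: "complex \<Rightarrow> ennreal"
  assumes [measurable]: "f \<in> borel_measurable borel" and a: "Re a \<noteq> 0" and k: "Im (cnj a * b) \<noteq> 0"
  shows "(\<integral>\<^sup>+z. f z \<partial>lborel)
    = ennreal \<bar>Im (cnj a * b)\<bar> * (\<integral>\<^sup>+r. \<integral>\<^sup>+q. f (of_real r * a + of_real q * b) \<partial>lborel \<partial>lborel)"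
proof -
  define k where "k = Im (cnj a * b)"
  have k': "k / Re a \<noteq> 0"
    using a k by (simp add: k_def)
  define g where "g q x = f (of_real x * (1 + of_real (Im a / Re a) * \<i>) + of_real q * (of_real (k / Re a) * \<i>))" for q x
  have [measurable]: "case_prod g \<in> borel_measurable (borel \<Otimes>\<^sub>M borel)"
  proof -
    have "(\<lambda>(q, x). of_real q * (of_real (k / Re a) * \<i>) + of_real x * (1 + of_real (Im a / Re a) * \<i>))
        \<in> borel_measurable (borel \<Otimes>\<^sub>M borel)"
      by (rule borel_measurable_affine_pair)
    then show ?thesis
      unfolding g_def split_beta' by (subst add.commute) measurable
  qed
  have inner: "(\<integral>\<^sup>+x. g q x \<partial>lborel)
      = ennreal \<bar>Re a\<bar> * (\<integral>\<^sup>+r. f (of_real r * a + of_real q * b) \<partial>lborel)" for q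
  proof -
    have "(\<integral>\<^sup>+x. g q x \<partial>lborel) = ennreal \<bar>Re a\<bar> * (\<integral>\<^sup>+r. g q (q * Re b + Re a * r) \<partial>lborel)"
      by (rule nn_integral_real_affine) (use a in auto)
    moreover have "g q (q * Re b + Re a * r) = f (of_real r * a + of_real q * b)" for r
      unfolding g_def k_def using a
      by (intro arg_cong[of _ _ f]) (simp add: complex_eq_iff field_simps)
    ultimately show ?thesis by simp
  qed
  have outer: "(\<integral>\<^sup>+y. f (of_real x + of_real y * \<i>) \<partial>lborel)
      = ennreal \<bar>k / Re a\<bar> * (\<integral>\<^sup>+q. g q x \<partial>lborel)" for x
  proof -
    have [measurable]: "(\<lambda>y. f (of_real x + of_real y * \<i>)) \<in> borel_measurable borel"
      by measurable
    have "(\<integral>\<^sup>+y. f (of_real x + of_real y * \<i>) \<partial>lborel)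
        = ennreal \<bar>k / Re a\<bar> * (\<integral>\<^sup>+q. f (of_real x + of_real (x * Im a / Re a + k / Re a * q) * \<i>) \<partial>lborel)"
      by (rule nn_integral_real_affine) (use k' in auto)
    moreover have "f (of_real x + of_real (x * Im a / Re a + k / Re a * q) * \<i>) = g q x" for q
      unfolding g_def by (intro arg_cong[of _ _ f]) (simp add: complex_eq_iff mult.commute)
    ultimately show ?thesis by simp
  qed
  have F [measurable]: "(\<lambda>(q, r). f (of_real r * a + of_real q * b)) \<in> borel_measurable (borel \<Otimes>\<^sub>M borel)"
  proof -
    have "(\<lambda>(q, r). of_real q * b + of_real r * a) \<in> borel_measurable (borel \<Otimes>\<^sub>M borel)"
      by (rule borel_measurable_affine_pair)
    then show ?thesis
      unfolding split_beta' by (subst add.commute) measurable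
  qed
  have "(\<integral>\<^sup>+z. f z \<partial>lborel) = (\<integral>\<^sup>+x. ennreal \<bar>k / Re a\<bar> * (\<integral>\<^sup>+q. g q x \<partial>lborel) \<partial>lborel)"
    by (simp add: nn_integral_complex outer)
  also have "\<dots> = ennreal \<bar>k / Re a\<bar> * (\<integral>\<^sup>+x. \<integral>\<^sup>+q. g q x \<partial>lborel \<partial>lborel)"
    by (rule nn_integral_cmult) measurable
  also have "(\<integral>\<^sup>+x. \<integral>\<^sup>+q. g q x \<partial>lborel \<partial>lborel) = (\<integral>\<^sup>+q. \<integral>\<^sup>+x. g q x \<partial>lborel \<partial>lborel)"
    by (rule lborel_pair.Fubini') measurable
  also have "\<dots> = ennreal \<bar>Re a\<bar> * (\<integral>\<^sup>+q. \<integral>\<^sup>+r. f (of_real r * a + of_real q * b) \<partial>lborel \<partial>lborel)"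
    unfolding inner by (rule nn_integral_cmult) measurable
  also have "(\<integral>\<^sup>+q. \<integral>\<^sup>+r. f (of_real r * a + of_real q * b) \<partial>lborel \<partial>lborel)
      = (\<integral>\<^sup>+r. \<integral>\<^sup>+q. f (of_real r * a + of_real q * b) \<partial>lborel \<partial>lborel)"
  proof (rule lborel_pair.Fubini')
    show "(\<lambda>(r, q). f (of_real r * a + of_real q * b)) \<in> borel_measurable (lborel \<Otimes>\<^sub>M lborel)"
      by measurable
  qed
  also have "ennreal \<bar>k / Re a\<bar> * (ennreal \<bar>Re a\<bar> * X) = ennreal \<bar>k\<bar> * X" for X
    using a by (simp add: mult.assoc[symmetric] ennreal_mult[symmetric] abs_divide)
  finally show ?thesis
    by (simp add: k_def)
qed

lemma nn_integral_linear_complex: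
  fixes f :: "complex \<Rightarrow> ennreal"
  assumes f [measurable]: "f \<in> borel_measurable borel" and k: "Im (cnj a * b) \<noteq> 0"
  shows "(\<integral>\<^sup>+z. f z \<partial>lborel)
    = ennreal \<bar>Im (cnj a * b)\<bar> * (\<integral>\<^sup>+r. \<integral>\<^sup>+q. f (of_real r * a + of_real q * b) \<partial>lborel \<partial>lborel)"
proof (cases "Re a = 0")
  case False
  then show ?thesis using nn_integral_linear_complex_aux[OF f _ k] by blast
next
  case True
  have k': "Im (cnj b * a) = - Im (cnj a * b)"
    by simp
  have "Re b \<noteq> 0"
    using k True by auto
  then have "(\<integral>\<^sup>+z. f z \<partial>lborel)
      = ennreal \<bar>Im (cnj b * a)\<bar> * (\<integral>\<^sup>+q. \<integral>\<^sup>+r. f (of_real q * b + of_real r * a) \<partial>lborel \<partial>lborel)"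
    using k by (intro nn_integral_linear_complex_aux[OF f]) (simp_all only: k' neg_equal_0_iff_equal not_False_eq_True)
  also have "(\<integral>\<^sup>+q. \<integral>\<^sup>+r. f (of_real q * b + of_real r * a) \<partial>lborel \<partial>lborel)
      = (\<integral>\<^sup>+r. \<integral>\<^sup>+q. f (of_real q * b + of_real r * a) \<partial>lborel \<partial>lborel)"
    by (rule lborel_pair.Fubini') measurable
  finally show ?thesis
    unfolding k' abs_minus_cancel by (simp only: add.commute)
qed

section \<open>The area of a triangle with apex at the origin\<close>

abbreviation hyp_density :: "complex \<Rightarrow> real" where
  "hyp_density z \<equiv> (1 - (cmod z)\<^sup>2) powr (- 3 / 2)"

text \<open>The antiderivative is \<open>(1 - r^2 C) powr (- 1 / 2) / C\<close>. Writing
  \<open>C = (1 - s) (1 + s)\<close> brings its increment to the form that reappears in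
  \<open>DERIV_half_area_along_segment\<close>.\<close>

lemma nn_integral_radial_density:
  assumes C: "0 < C" "C < 1"
  shows "(\<integral>\<^sup>+r. ennreal (r * (1 - r\<^sup>2 * C) powr (- 3 / 2)) * indicator {0..1} r \<partial>lborel)
    = ennreal (1 / (sqrt (1 - C) * (1 + sqrt (1 - C))))"
proof -
  have pos: "0 < 1 - r\<^sup>2 * C" if "r \<in> {0..1}" for r
  proof -
    have "r\<^sup>2 * C \<le> 1 * C"
      using that C by (intro mult_right_mono) (auto simp: power_le_one)
    then show ?thesis using C by linarith
  qed
  define F where "F r = (1 - r\<^sup>2 * C) powr (- 1 / 2) / C" for r
  have "(\<integral>\<^sup>+r. ennreal (r * (1 - r\<^sup>2 * C) powr (- 3 / 2)) * indicator {0..1} r \<partial>lborel) = ennreal (F 1 - F 0)"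
  proof (rule nn_integral_FTC_Icc)
    fix r :: real assume r: "r \<in> {0..1}"
    show "0 \<le> r * (1 - r\<^sup>2 * C) powr (- 3 / 2)"
      using r by simp
    have "((\<lambda>r. (1 - r\<^sup>2 * C) powr (- 1 / 2)) has_real_derivative
        (- 1 / 2) * (1 - r\<^sup>2 * C) powr (- 1 / 2 - 1) * (- (2 * r * C))) (at r)"
      using pos[OF r] by (auto intro!: derivative_eq_intros simp: powr_diff)
    from DERIV_cdivide[OF this, of C]
    show "(F has_real_derivative r * (1 - r\<^sup>2 * C) powr (- 3 / 2)) (at r)"
      unfolding F_def[abs_def] using C by (simp add: mult.commute)
  qed auto
  also have "F 1 - F 0 = 1 / (sqrt (1 - C) * (1 + sqrt (1 - C)))"
  proof -
    define s where "s = sqrt (1 - C)"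
    have s: "0 < s" "C = 1 - s\<^sup>2" "s \<noteq> 1"
      using C by (auto simp: s_def)
    have "(1 - C) powr (- 1 / 2) = 1 / s"
      using C by (simp add: s_def powr_minus_divide powr_half_sqrt)
    moreover have "1 - s\<^sup>2 = (1 - s) * (1 + s)"
      by (simp add: power2_eq_square algebra_simps)
    ultimately have "F 1 - F 0 = (1 / s - 1) / ((1 - s) * (1 + s))"
      unfolding F_def using s(2) by (simp add: diff_divide_distrib)
    also have "\<dots> = 1 / (s * (1 + s))"
      using s by (simp add: divide_simps)
    finally show ?thesis by (simp add: s_def)
  qed
  finally show ?thesis .
qed

text \<open>Cone coordinates: with \<open>q = r t\<close> the point is
  \<open>r (a + t (b - a))\<close>, where \<open>t\<close> picks a point of the side opposite to 0
  and \<open>r\<close> scales towards the apex.\<close>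

lemma triangle_hull_eq:
  fixes a b :: complex
  shows "convex hull {0, a, b} = {of_real r * a + of_real q * (b - a) | r q. 0 \<le> q \<and> q \<le> r \<and> r \<le> 1}"
proof -
  have "\<exists>r q. u *\<^sub>R a + v *\<^sub>R b = of_real r * a + of_real q * (b - a) \<and> 0 \<le> q \<and> q \<le> r \<and> r \<le> 1"
    if "0 \<le> u" "0 \<le> v" "u + v \<le> 1" for u v
    using that by (intro exI[of _ "u + v"] exI[of _ v]) (auto simp: scaleR_conv_of_real algebra_simps)
  moreover have "\<exists>u v. of_real r * a + of_real q * (b - a) = u *\<^sub>R a + v *\<^sub>R b \<and> 0 \<le> u \<and> 0 \<le> v \<and> u + v \<le> 1"
    if "0 \<le> q" "q \<le> r" "r \<le> 1" for r q
    using that by (intro exI[of _ "r - q"] exI[of _ q]) (auto simp: scaleR_conv_of_real algebra_simps)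
  ultimately show ?thesis
    unfolding convex_hull_3_alt by fastforce
qed

lemma triangle_hull_iff:
  fixes a b :: complex
  assumes k: "Im (cnj a * (b - a)) \<noteq> 0"
  shows "of_real r * a + of_real q * (b - a) \<in> convex hull {0, a, b} \<longleftrightarrow> 0 \<le> q \<and> q \<le> r \<and> r \<le> 1"
proof
  define e where "e = b - a"
  have uniq: "r' = r \<and> q' = q" if "of_real r' * a + of_real q' * e = of_real r * a + of_real q * e" for r' q' :: real
  proof -
    have z: "of_real (r' - r) * a + of_real (q' - q) * e = 0"
      using that by (simp add: algebra_simps)
    have "(q' - q) * Im (cnj a * e) = Im (cnj a * (of_real (r' - r) * a + of_real (q' - q) * e))"
      by (simp add: algebra_simps)
    then have q: "q' = q"
      using k z by (simp only: e_def[symmetric]) simp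
    then have "of_real (r' - r) * a = 0"
      using z by simp
    then show ?thesis
      using k q by auto
  qed
  assume "of_real r * a + of_real q * (b - a) \<in> convex hull {0, a, b}"
  then show "0 \<le> q \<and> q \<le> r \<and> r \<le> 1"
    unfolding triangle_hull_eq e_def[symmetric] using uniq by fastforce
next
  assume "0 \<le> q \<and> q \<le> r \<and> r \<le> 1"
  then show "of_real r * a + of_real q * (b - a) \<in> convex hull {0, a, b}"
    unfolding triangle_hull_eq by blast
qed

lemma norm_segment_less:
  fixes a b :: complex
  assumes "cmod a < 1" "cmod b < 1" "t \<in> {0..1}"
  shows "cmod (a + of_real t * (b - a)) < 1"
proof -
  have "a + of_real t * (b - a) = (1 - t) *\<^sub>R a + t *\<^sub>R b"
    by (simp add: scaleR_conv_of_real algebra_simps)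
  then have "a + of_real t * (b - a) \<in> ball 0 1"
    using assms convexD_alt[OF convex_ball, of a 0 1 b t] by simp
  then show ?thesis by simp
qed

text \<open>In cone coordinates the area element is \<open>|k| r dr dt\<close>. Fubini's theorem
  puts the radial integral inside, where the density is a function of \<open>r^2 |c t|^2\<close>,
  and what remains is an integral along the side \<open>a b\<close>.\<close>

lemma nn_integral_triangle_density:
  fixes a b :: complex
  defines "k \<equiv> Im (cnj a * (b - a))"
  assumes ab: "cmod a < 1" "cmod b < 1" and k: "k \<noteq> 0"
  shows "(\<integral>\<^sup>+z. ennreal (hyp_density z) * indicator (convex hull {0, a, b}) z \<partial>lborel)
    = (\<integral>\<^sup>+t. ennreal (\<bar>k\<bar> / (sqrt (1 - (cmod (a + of_real t * (b - a)))\<^sup>2)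
        * (1 + sqrt (1 - (cmod (a + of_real t * (b - a)))\<^sup>2)))) * indicator {0..1} t \<partial>lborel)"
proof -
  define e where "e = b - a"
  define c where "c t = a + of_real t * e" for t :: real
  define s where "s t = sqrt (1 - (cmod (c t))\<^sup>2)" for t
  have hull [measurable]: "convex hull {0, a, b} \<in> sets borel"
    by (intro borel_closed compact_imp_closed compact_convex_hull) auto
  define g where "g = (\<lambda>r t. ennreal (r * (1 - r\<^sup>2 * (cmod (c t))\<^sup>2) powr (- 3 / 2)) * indicator {0..1} r * indicator {0..1} t)"
  \<comment> \<open>The substitution \<open>q = r t\<close> needs \<open>r \<noteq> 0\<close>; the
    single value 0 is discarded as a null set when the equation is integrated over
    \<open>r\<close>.\<close>
  have inner: "(\<integral>\<^sup>+q. ennreal (hyp_density (of_real r * a + of_real q * e)) *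
      indicator (convex hull {0, a, b}) (of_real r * a + of_real q * e) \<partial>lborel) = (\<integral>\<^sup>+t. g r t \<partial>lborel)"
    if r: "r \<noteq> 0" for r
  proof (cases "0 < r \<and> r \<le> 1")
    case True
    have ind: "indicator (convex hull {0, a, b}) (of_real r * a + of_real q * e) = (indicator {0..r} q :: ennreal)" for q
      using triangle_hull_iff[OF k[unfolded k_def], of r q] True by (auto simp: indicator_def e_def)
    have "(\<integral>\<^sup>+q. ennreal (hyp_density (of_real r * a + of_real q * e)) * indicator {0..r} q \<partial>lborel)
        = ennreal \<bar>r\<bar> * (\<integral>\<^sup>+t. ennreal (hyp_density (of_real r * a + of_real (0 + r * t) * e)) * indicator {0..r} (0 + r * t) \<partial>lborel)"
      by (rule nn_integral_real_affine) (use r in auto)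
    also have "\<dots> = (\<integral>\<^sup>+t. ennreal \<bar>r\<bar> * (ennreal (hyp_density (of_real r * a + of_real (0 + r * t) * e)) * indicator {0..r} (0 + r * t)) \<partial>lborel)"
      by (rule nn_integral_cmult[symmetric]) measurable
    also have "\<dots> = (\<integral>\<^sup>+t. g r t \<partial>lborel)"
    proof (rule nn_integral_cong)
      fix t
      have "of_real r * a + of_real (0 + r * t) * e = of_real r * c t"
        by (simp add: c_def algebra_simps)
      moreover have "indicator {0..r} (0 + r * t) = (indicator {0..1} t :: ennreal)"
        using True by (auto simp: indicator_def zero_le_mult_iff mult_le_cancel_left1)
      ultimately show "ennreal \<bar>r\<bar> * (ennreal (hyp_density (of_real r * a + of_real (0 + r * t) * e)) * indicator {0..r} (0 + r * t)) = g r t"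
        using True by (simp add: g_def norm_mult power_mult_distrib ennreal_mult mult.assoc)
    qed
    finally show ?thesis
      unfolding ind .
  next
    case False
    have "indicator (convex hull {0, a, b}) (of_real r * a + of_real q * e) = (0 :: ennreal)" for q
      using triangle_hull_iff[OF k[unfolded k_def], of r q] False r by (auto simp: indicator_def e_def)
    moreover have "g r t = 0" for t
      using False r by (auto simp: g_def indicator_def)
    ultimately show ?thesis by simp
  qed
  have [measurable]: "case_prod g \<in> borel_measurable (borel \<Otimes>\<^sub>M borel)"
    unfolding g_def c_def by measurable
  have "(\<integral>\<^sup>+z. ennreal (hyp_density z) * indicator (convex hull {0, a, b}) z \<partial>lborel)
      = ennreal \<bar>k\<bar> * (\<integral>\<^sup>+r. \<integral>\<^sup>+q. ennreal (hyp_density (of_real r * a + of_real q * e)) *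
          indicator (convex hull {0, a, b}) (of_real r * a + of_real q * e) \<partial>lborel \<partial>lborel)"
    unfolding k_def e_def by (rule nn_integral_linear_complex) (use k in \<open>auto simp: k_def\<close>)
  also have "(\<integral>\<^sup>+r. \<integral>\<^sup>+q. ennreal (hyp_density (of_real r * a + of_real q * e)) *
          indicator (convex hull {0, a, b}) (of_real r * a + of_real q * e) \<partial>lborel \<partial>lborel)
      = (\<integral>\<^sup>+r. \<integral>\<^sup>+t. g r t \<partial>lborel \<partial>lborel)"
    by (rule nn_integral_cong_AE[OF eventually_mono[OF AE_lborel_singleton[of 0]]]) (rule inner)
  also have "\<dots> = (\<integral>\<^sup>+t. \<integral>\<^sup>+r. g r t \<partial>lborel \<partial>lborel)"
    by (rule lborel_pair.Fubini'[symmetric]) measurable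
  also have "\<dots> = (\<integral>\<^sup>+t. ennreal (1 / (s t * (1 + s t))) * indicator {0..1} t \<partial>lborel)"
  proof (rule nn_integral_cong)
    fix t :: real
    show "(\<integral>\<^sup>+r. g r t \<partial>lborel) = ennreal (1 / (s t * (1 + s t))) * indicator {0..1} t"
    proof (cases "t \<in> {0..1}")
      case True
      \<comment> \<open>The line through \<open>a\<close> and \<open>b\<close> misses the origin
        because \<open>k \<noteq> 0\<close>; the radial integral is stated for positive
        \<open>C\<close>.\<close>
      have "c t \<noteq> 0"
      proof
        assume "c t = 0"
        then have "Im (cnj a * c t) = 0" by simp
        then have "t * k = 0"
          unfolding c_def k_def e_def by (simp add: algebra_simps)
        then show False
          using \<open>c t = 0\<close> k by (auto simp: c_def k_def)
      qed
      moreover have "cmod (c t) < 1"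
        unfolding c_def e_def using ab True by (rule norm_segment_less)
      ultimately show ?thesis
        using True nn_integral_radial_density[of "(cmod (c t))\<^sup>2"] one_minus_norm_sq_pos[of "c t"]
        by (simp add: g_def s_def)
    qed (simp add: g_def)
  qed
  also have "ennreal \<bar>k\<bar> * \<dots> = (\<integral>\<^sup>+t. ennreal \<bar>k\<bar> * (ennreal (1 / (s t * (1 + s t))) * indicator {0..1} t) \<partial>lborel)"
    unfolding s_def c_def by (rule nn_integral_cmult[symmetric]) measurable
  also have "\<dots> = (\<integral>\<^sup>+t. ennreal (\<bar>k\<bar> / (s t * (1 + s t))) * indicator {0..1} t \<partial>lborel)"
    by (intro nn_integral_cong) (simp add: mult.assoc[symmetric] ennreal_mult'[symmetric])
  finally show ?thesis
    by (simp only: s_def c_def e_def)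
qed

lemma half_area_poincare:
  assumes a: "cmod a < 1" and b: "cmod b < 1"
  shows "half_area (poincare a) (poincare b) = arctan (Im (cnj a * b) /
    ((1 + sqrt (1 - (cmod a)\<^sup>2)) * (1 + sqrt (1 - (cmod b)\<^sup>2)) - a \<bullet> b))"
proof -
  define N where "N = (1 + sqrt (1 - (cmod a)\<^sup>2)) * (1 + sqrt (1 - (cmod b)\<^sup>2))"
  have N: "N > 0"
    using one_minus_norm_sq_pos[OF a] one_minus_norm_sq_pos[OF b] by (simp add: N_def add_pos_pos)
  have "poincare a * cnj (poincare b) = a * cnj b / of_real N"
    by (simp add: poincare_def N_def)
  then have im: "Im (poincare a * cnj (poincare b)) = Im (a * cnj b) / N"
    and re: "Re (poincare a * cnj (poincare b)) = a \<bullet> b / N"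
    by (simp_all add: inner_complex_def)
  have "1 - a \<bullet> b / N = (N - a \<bullet> b) / N"
    using N by (simp add: diff_divide_distrib)
  then have "- Im (poincare a * cnj (poincare b)) / (1 - Re (poincare a * cnj (poincare b))) = Im (cnj a * b) / (N - a \<bullet> b)"
    unfolding im re using N by simp
  then show ?thesis
    using half_area_arctan[OF norm_poincare_less[OF a] norm_poincare_less[OF b]] by (simp add: N_def)
qed

lemma inner_less_one:
  fixes a b :: complex
  assumes "cmod a < 1" "cmod b < 1"
  shows "a \<bullet> b < 1"
proof -
  have "a \<bullet> b \<le> cmod a * cmod b"
    by (rule norm_cauchy_schwarz)
  also have "\<dots> \<le> cmod a * 1"
    using assms by (intro mult_left_mono) auto
  finally show ?thesis using assms by simp
qed

text \<open>By \<open>half_area_poincare\<close>, \<open>F x\<close> is twice the half area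
  belonging to \<open>a\<close> and the point at parameter \<open>x\<close> of the line. Its
  derivative is the integrand left by \<open>nn_integral_triangle_density\<close>, up to the sign of
  \<open>k\<close>, so the fundamental theorem of calculus yields the area of the triangle.\<close>

lemma DERIV_half_area_along_segment:
  fixes a e :: complex and t :: real
  defines "s \<equiv> (\<lambda>x. sqrt (1 - (cmod (a + of_real x * e))\<^sup>2))"
  defines "F \<equiv> (\<lambda>x. 2 * arctan (x * Im (cnj a * e) / ((1 + s 0) * (1 + s x) - a \<bullet> (a + of_real x * e))))"
  assumes a: "cmod a < 1" and t: "cmod (a + of_real t * e) < 1"
  shows "(F has_real_derivative Im (cnj a * e) / (s t * (1 + s t))) (at t)"
proof -
  define k where "k = Im (cnj a * e)"
  define A where "A = a \<bullet> e"
  define E where "E = e \<bullet> e"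
  define c2 where "c2 x = (cmod a)\<^sup>2 + 2 * x * A + x\<^sup>2 * E" for x
  define M where "M x = (1 + s 0) * (1 + s x) - ((cmod a)\<^sup>2 + x * A)" for x
  have c2: "(cmod (a + of_real x * e))\<^sup>2 = c2 x" for x
    unfolding c2_def A_def E_def cmod_power2 inner_complex_def
    by simp (simp add: power2_eq_square algebra_simps)
  have s_eq: "s x = sqrt (1 - c2 x)" for x
    by (simp add: s_def c2)
  have inner_eq: "a \<bullet> (a + of_real x * e) = (cmod a)\<^sup>2 + x * A" for x
    unfolding A_def cmod_power2 inner_complex_def
    by simp (simp add: power2_eq_square algebra_simps)
  have F_eq: "F = (\<lambda>x. 2 * arctan (x * k / M x))"
    unfolding F_def inner_eq k_def M_def ..
  have pos: "0 < 1 - c2 t"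
    using one_minus_norm_sq_pos[OF t] by (simp add: c2)
  have st: "0 < s t" "(s t)\<^sup>2 = 1 - c2 t"
    using pos by (simp_all add: s_eq)
  have s0: "0 < s 0" "(s 0)\<^sup>2 = 1 - (cmod a)\<^sup>2"
    using one_minus_norm_sq_pos[OF a] by (simp_all add: s_eq c2_def)
  have ds: "(s has_real_derivative - (A + t * E) / s t) (at t)"
  proof -
    have "((\<lambda>x. sqrt (1 - c2 x)) has_real_derivative (- (2 * A + 2 * t * E)) * (inverse (sqrt (1 - c2 t)) / 2)) (at t)"
      unfolding c2_def using pos
      by (auto intro!: derivative_eq_intros simp: c2_def)
    moreover have "(- (2 * A + 2 * t * E)) * (inverse r / 2) = - (A + t * E) / r" for r
      by (cases "r = 0") (simp_all add: divide_simps)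
    moreover have "s = (\<lambda>x. sqrt (1 - c2 x))"
      using s_eq by blast
    ultimately show ?thesis
      by (simp only: s_eq)
  qed
  have Mpos: "0 < M t"
  proof -
    have "a \<bullet> (a + of_real t * e) < 1"
      by (rule inner_less_one[OF a t])
    moreover have "1 * 1 \<le> (1 + s 0) * (1 + s t)"
      using s0 st by (intro mult_mono) auto
    ultimately show ?thesis
      by (simp add: M_def inner_eq)
  qed
  define M' where "M' = (1 + s 0) * (- (A + t * E) / s t) - A"
  have "(M has_real_derivative M') (at t)"
    unfolding M_def M'_def by (auto intro!: derivative_eq_intros ds)
  then have dF: "(F has_real_derivative 2 * (((k * M t - t * k * M') / (M t * M t)) / (1 + (t * k / M t)\<^sup>2))) (at t)"
  proof -
    assume dM: "(M has_real_derivative M') (at t)"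
    have "((\<lambda>x. x * k) has_real_derivative k) (at t)"
      by (auto intro!: derivative_eq_intros)
    then have "((\<lambda>x. x * k / M x) has_real_derivative (k * M t - t * k * M') / (M t * M t)) (at t)"
      using DERIV_divide[OF _ dM] Mpos by force
    then have "((\<lambda>x. arctan (x * k / M x)) has_real_derivative
        inverse (1 + (t * k / M t)\<^sup>2) * ((k * M t - t * k * M') / (M t * M t))) (at t)"
      by (rule DERIV_chain2[OF DERIV_arctan])
    then show ?thesis
      unfolding F_eq by (intro DERIV_cmult) (simp only: divide_inverse mult.commute)
  qed
  have lagrange: "(t * k)\<^sup>2 = (cmod a)\<^sup>2 * c2 t - ((cmod a)\<^sup>2 + t * A)\<^sup>2"
    unfolding k_def c2_def A_def E_def cmod_power2 inner_complex_def
    by simp (simp add: power2_eq_square algebra_simps)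
  \<comment> \<open>The common factor of \<open>M^2 + (t k)^2\<close>, found with Lagrange's
    identity, and of the numerator \<open>k M - t k M'\<close>. Its cancellation makes the
    derivative simple.\<close>
  define J where "J = 1 + s 0 * s t - ((cmod a)\<^sup>2 + t * A)"
  have MJ: "M t * M t + (t * k)\<^sup>2 = 2 * (1 + s 0) * (1 + s t) * J"
  proof -
    have aa: "(cmod a)\<^sup>2 = 1 - s 0 * s 0" and cc: "c2 t = 1 - s t * s t"
      using s0 st by (simp_all add: power2_eq_square)
    show ?thesis
      unfolding lagrange M_def J_def aa cc by (simp add: power2_eq_square algebra_simps)
  qed
  have NJ: "k * M t - t * k * M' = k * (1 + s 0) * J / s t"
  proof -
    have tE: "t * A + t * t * E = 1 - s t * s t - (cmod a)\<^sup>2 - t * A"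
      using st by (simp add: c2_def power2_eq_square)
    have "(k * M t - t * k * M') * s t = k * ((M t + t * A) * s t + (1 + s 0) * (t * A + t * t * E))"
      unfolding M'_def using st(1) by (simp add: field_simps)
    also have "\<dots> = k * (1 + s 0) * J"
    proof -
      have aa: "(cmod a)\<^sup>2 = 1 - s 0 * s 0"
        using s0 by (simp add: power2_eq_square)
      show ?thesis
        unfolding tE M_def J_def aa by (simp add: algebra_simps)
    qed
    finally show ?thesis
      using st(1) by (simp add: eq_divide_eq)
  qed
  have "0 < J"
  proof -
    have "0 < M t * M t + (t * k)\<^sup>2"
      using Mpos by (simp add: add_pos_nonneg)
    then have "0 < 2 * (1 + s 0) * (1 + s t) * J"
      by (simp only: MJ)
    moreover have "0 < 2 * (1 + s 0) * (1 + s t)"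
      using s0(1) st(1) by simp
    ultimately show ?thesis
      by (simp only: zero_less_mult_pos)
  qed
  have "((k * M t - t * k * M') / (M t * M t)) / (1 + (t * k / M t)\<^sup>2)
      = (k * M t - t * k * M') / (M t * M t + (t * k)\<^sup>2)"
  proof -
    have "1 + (t * k / M t)\<^sup>2 = (M t * M t + (t * k)\<^sup>2) / (M t * M t)"
      using Mpos by (simp add: power_divide add_divide_distrib power2_eq_square[of "M t"])
    then show ?thesis
      using Mpos by simp
  qed
  also have "\<dots> = k * (1 + s 0) * J / s t / (2 * (1 + s 0) * (1 + s t) * J)"
    by (simp only: MJ NJ)
  also have "\<dots> = k / (s t * (1 + s t)) / 2"
  proof -
    have "k * u * J / v / (2 * u * w * J) = k / (v * w) / 2" if "0 < u" "0 < v" "0 < w" for u v w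
      using that \<open>0 < J\<close> by simp
    from this[of "1 + s 0" "s t" "1 + s t"] show ?thesis
      using s0(1) st(1) by simp
  qed
  finally have "2 * (((k * M t - t * k * M') / (M t * M t)) / (1 + (t * k / M t)\<^sup>2)) = k / (s t * (1 + s t))"
    by simp
  then show ?thesis
    using dF by (simp add: k_def)
qed

lemma nn_integral_triangle:
  fixes a b :: complex
  assumes ab: "cmod a < 1" "cmod b < 1" and k: "Im (cnj a * b) \<noteq> 0"
  shows "(\<integral>\<^sup>+z. ennreal (hyp_density z) * indicator (convex hull {0, a, b}) z \<partial>lborel)
    = ennreal (2 * sgn (Im (cnj a * b)) * half_area (poincare a) (poincare b))"
proof -
  define k where "k = Im (cnj a * (b - a))"
  have k_eq: "k = Im (cnj a * b)"
    by (simp add: k_def algebra_simps)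
  define s where "s = (\<lambda>x. sqrt (1 - (cmod (a + of_real x * (b - a)))\<^sup>2))"
  define F where "F = (\<lambda>x. 2 * arctan (x * k / ((1 + s 0) * (1 + s x) - a \<bullet> (a + of_real x * (b - a)))))"
  have spos: "0 < s t" if "t \<in> {0..1}" for t
    using one_minus_norm_sq_pos[OF norm_segment_less[OF ab that]] by (simp add: s_def)
  have "(\<integral>\<^sup>+z. ennreal (hyp_density z) * indicator (convex hull {0, a, b}) z \<partial>lborel)
      = (\<integral>\<^sup>+t. ennreal (\<bar>k\<bar> / (s t * (1 + s t))) * indicator {0..1} t \<partial>lborel)"
    unfolding k_def s_def using nn_integral_triangle_density[OF ab] k k_eq by (simp add: k_def)
  also have "\<dots> = ennreal (sgn k * F 1 - sgn k * F 0)"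
  proof (rule nn_integral_FTC_Icc)
    show "(\<lambda>t. \<bar>k\<bar> / (s t * (1 + s t))) \<in> borel_measurable borel"
      unfolding s_def by measurable
    fix t :: real assume t: "t \<in> {0..1}"
    show "0 \<le> \<bar>k\<bar> / (s t * (1 + s t))"
      using spos[OF t] by simp
    have "(F has_real_derivative k / (s t * (1 + s t))) (at t)"
      unfolding F_def s_def k_def by (rule DERIV_half_area_along_segment[OF ab(1) norm_segment_less[OF ab t]])
    then have "((\<lambda>t. sgn k * F t) has_real_derivative sgn k * (k / (s t * (1 + s t)))) (at t)"
      by (rule DERIV_cmult)
    then show "((\<lambda>t. sgn k * F t) has_real_derivative \<bar>k\<bar> / (s t * (1 + s t))) (at t)"
      by (simp add: abs_sgn mult.commute)
  qed simp
  also have "sgn k * F 1 - sgn k * F 0 = 2 * sgn k * half_area (poincare a) (poincare b)"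
    unfolding half_area_poincare[OF ab] by (simp add: F_def s_def k_eq)
  finally show ?thesis
    by (simp only: k_eq)
qed

text \<open>The sign belongs to the integrand so that overlapping triangles of opposite orientation
  can cancel pointwise. A degenerate triangle then gives 0 on both sides.\<close>

lemma has_bochner_integral_triangle:
  fixes a b :: complex
  assumes ab: "cmod a < 1" "cmod b < 1"
  shows "has_bochner_integral lborel
    (\<lambda>z. sgn (Im (cnj a * b)) * indicator (convex hull {0, a, b}) z * hyp_density z)
    (2 * half_area (poincare a) (poincare b))"
proof (cases "Im (cnj a * b) = 0")
  case True
  then show ?thesis
    unfolding half_area_poincare[OF ab] by (simp add: has_bochner_integral_zero)
next
  case False
  define k where "k = Im (cnj a * b)"
  define h where "h = half_area (poincare a) (poincare b)"
  have [measurable]: "convex hull {0, a, b} \<in> sets borel"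
    by (intro borel_closed compact_imp_closed compact_convex_hull) auto
  have "0 \<le> 2 * sgn k * h"
  proof -
    define N where "N = (1 + sqrt (1 - (cmod a)\<^sup>2)) * (1 + sqrt (1 - (cmod b)\<^sup>2)) - a \<bullet> b"
    have "1 * 1 \<le> (1 + sqrt (1 - (cmod a)\<^sup>2)) * (1 + sqrt (1 - (cmod b)\<^sup>2))"
      using one_minus_norm_sq_pos[OF ab(1)] one_minus_norm_sq_pos[OF ab(2)] by (intro mult_mono) auto
    then have "N > 0"
      using inner_less_one[OF ab] by (simp add: N_def)
    then show ?thesis
      unfolding h_def half_area_poincare[OF ab] k_def[symmetric] N_def[symmetric]
      by (auto simp: sgn_if zero_le_arctan_iff arctan_le_zero_iff divide_nonpos_pos)
  qed
  moreover have "ennreal (hyp_density z * indicator H z) = ennreal (hyp_density z) * indicator H z" for z H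
    by (simp add: indicator_def)
  then have "(\<integral>\<^sup>+z. ennreal (hyp_density z * indicator (convex hull {0, a, b}) z) \<partial>lborel) = ennreal (2 * sgn k * h)"
    using nn_integral_triangle[OF ab False] by (simp only: k_def h_def)
  ultimately have "has_bochner_integral lborel (\<lambda>z. hyp_density z * indicator (convex hull {0, a, b}) z) (2 * sgn k * h)"
  proof (intro has_bochner_integral_nn_integral)
    show "(\<lambda>z. hyp_density z * indicator (convex hull {0, a, b}) z) \<in> borel_measurable lborel"
      by measurable
  qed (auto intro: AE_I2)
  then have "has_bochner_integral lborel (\<lambda>z. sgn k * (hyp_density z * indicator (convex hull {0, a, b}) z)) (sgn k * (2 * sgn k * h))"
    by (rule has_bochner_integral_mult_right)
  moreover have "sgn k * (2 * sgn k * h) = 2 * h"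
    using False unfolding k_def[symmetric] by (simp add: sgn_if)
  ultimately have "has_bochner_integral lborel (\<lambda>z. sgn k * (hyp_density z * indicator (convex hull {0, a, b}) z)) (2 * h)"
    by (simp only:)
  then show ?thesis
    unfolding k_def h_def by (simp only: mult_ac)
qed

section \<open>Winding numbers and decomposition into triangles\<close>

lemma interior_triangle_degenerate:
  fixes a b :: complex
  assumes k: "Im (cnj a * b) = 0"
  shows "interior (convex hull {0, a, b}) = {}"
proof -
  obtain n where n: "n \<noteq> 0" "n \<bullet> a = 0" "n \<bullet> b = 0"
  proof (cases "a = 0")
    case True
    show ?thesis
    proof (cases "b = 0")
      case True
      then show ?thesis using that[of 1] \<open>a = 0\<close> by simp
    next
      case False
      then show ?thesis using that[of "\<i> * b"] \<open>a = 0\<close> by (simp add: inner_complex_def)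
    qed
  next
    case False
    then show ?thesis
      using that[of "\<i> * a"] k by (simp add: inner_complex_def algebra_simps)
  qed
  have "convex hull {0, a, b} \<subseteq> {z. n \<bullet> z = 0}"
    by (rule hull_minimal) (use n convex_hyperplane in auto)
  then have "interior (convex hull {0, a, b}) \<subseteq> interior {z. n \<bullet> z = 0}"
    by (rule interior_mono)
  then show ?thesis
    using interior_hyperplane[OF n(1), of 0] by auto
qed

text \<open>Compares the contribution of the side \<open>a b\<close> to a winding number with the
  oriented triangle over that side. The two spokes from the origin enter as a difference, so they
  telescope around a closed polygon. In a degenerate triangle the interior is empty, and a point off
  the edges lies outside.\<close>

lemma winding_number_triangle_origin:
  fixes a b z :: complex
  assumes z: "z \<notin> closed_segment 0 a" "z \<notin> closed_segment a b" "z \<notin> closed_segment b 0"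
  shows "winding_number (linepath 0 a) z + winding_number (linepath a b) z - winding_number (linepath 0 b) z
    = of_real (sgn (Im (cnj a * b)) * indicator (convex hull {0, a, b}) z)"
proof -
  let ?\<gamma> = "linepath 0 a +++ linepath a b +++ linepath b 0"
  have "winding_number (linepath b 0) z = - winding_number (linepath 0 b) z"
    using winding_number_reversepath[of "linepath 0 b" z] z by (simp add: closed_segment_commute)
  then have "winding_number ?\<gamma> z
      = winding_number (linepath 0 a) z + winding_number (linepath a b) z - winding_number (linepath 0 b) z"
    using z by (simp add: winding_number_join path_image_join)
  moreover have "winding_number ?\<gamma> z = of_real (sgn (Im (cnj a * b)) * indicator (convex hull {0, a, b}) z)"
  proof (cases "z \<in> convex hull {0, a, b}")
    case True
    moreover have "z \<notin> frontier (convex hull {0, a, b})"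
      using z by (simp add: frontier_of_triangle)
    ultimately have int: "z \<in> interior (convex hull {0, a, b})"
      using closure_subset by (auto simp: frontier_def)
    then have k: "Im (cnj a * (b - a)) \<noteq> 0"
      using interior_triangle_degenerate[of a b] by (auto simp: algebra_simps)
    obtain r q where rq: "z = of_real r * a + of_real q * (b - a)" "0 \<le> q"
      using True unfolding triangle_hull_eq by blast
    have "q \<noteq> 0"
    proof
      assume "q = 0"
      moreover have "r \<in> {0..1}"
        using True triangle_hull_iff[OF k, of r q] rq by auto
      ultimately have "z \<in> closed_segment 0 a"
        unfolding closed_segment_def rq by (auto simp: scaleR_conv_of_real)
      then show False using z by blast
    qed
    then have "q > 0" using rq by simp
    \<comment> \<open>The winding number around a triangle is decided by the side of the line
      \<open>0 a\<close> on which \<open>z\<close> lies. In cone coordinates that quantity is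
      \<open>q\<close> times the determinant of \<open>a\<close> and \<open>b\<close>, with
      \<open>q\<close> positive.\<close>
    have "Im ((a - 0) * cnj (a - z)) = q * Im (cnj a * (b - a))"
      unfolding rq by (simp add: algebra_simps)
    also have "Im (cnj a * (b - a)) = Im (cnj a * b)"
      by (simp add: algebra_simps)
    finally have "0 < Im ((a - 0) * cnj (a - z)) \<longleftrightarrow> 0 < Im (cnj a * b)"
      using \<open>q > 0\<close> by (simp only: zero_less_mult_iff) (meson less_asym)
    then show ?thesis
      unfolding winding_number_triangle[OF int] using True k by (simp add: sgn_if algebra_simps)
  next
    case False
    have "winding_number ?\<gamma> z = 0"
    proof (rule winding_number_zero_outside[OF _ convex_convex_hull _ False])
      show "path_image ?\<gamma> \<subseteq> convex hull {0, a, b}"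
        by (simp add: path_image_join closed_segment_subset_convex_hull hull_inc)
    qed auto
    then show ?thesis using False by simp
  qed
  ultimately show ?thesis by simp
qed

lemma null_sets_closed_segment: "closed_segment a b \<in> null_sets (lborel :: complex measure)"
proof -
  have "negligible (closed_segment a b)"
    by (simp add: negligible_convex_interior interior_closed_segment_ge2)
  then show ?thesis
    by (simp add: negligible_iff_null_sets null_sets_completion_iff borel_closed)
qed

lemma polygonal_path_ends:
  assumes "xs \<noteq> []"
  shows "pathstart (polygonal_path xs) = hd xs" "pathfinish (polygonal_path xs) = last xs"
  using assms by (induction xs rule: polygonal_path.induct) auto

lemma path_polygonal_path: "path (polygonal_path xs)"
proof (induction xs rule: polygonal_path.induct)
  case (4 a b c xs)
  then show ?case by (simp add: path_join_eq polygonal_path_ends)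
qed (auto simp: path_def)

lemma path_image_polygonal_path:
  "2 \<le> length xs \<Longrightarrow> path_image (polygonal_path xs) = (\<Union>i<length xs - 1. closed_segment (xs ! i) (xs ! Suc i))"
proof (induction xs rule: polygonal_path.induct)
  case (4 a b c xs)
  have "path_image (polygonal_path (a # b # c # xs))
      = closed_segment a b \<union> (\<Union>i<length (b # c # xs) - 1. closed_segment ((b # c # xs) ! i) ((b # c # xs) ! Suc i))"
    using 4 by (simp add: path_image_join polygonal_path_ends)
  also have "\<dots> = (\<Union>i<Suc (length (b # c # xs) - 1). closed_segment ((a # b # c # xs) ! i) ((a # b # c # xs) ! Suc i))"
    by (simp only: lessThan_Suc_eq_insert_0 UN_insert image_image UN_simps(10)) simp
  finally show ?case by simp
qed auto

lemma winding_number_polygonal_path: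
  "2 \<le> length xs \<Longrightarrow> z \<notin> path_image (polygonal_path xs) \<Longrightarrow>
    winding_number (polygonal_path xs) z = (\<Sum>i<length xs - 1. winding_number (linepath (xs ! i) (xs ! Suc i)) z)"
proof (induction xs rule: polygonal_path.induct)
  case (4 a b c xs)
  have z: "z \<notin> closed_segment a b" "z \<notin> path_image (polygonal_path (b # c # xs))"
    using 4 by (simp_all add: path_image_join polygonal_path_ends)
  have "winding_number (polygonal_path (a # b # c # xs)) z
      = winding_number (linepath a b) z + (\<Sum>i<length (b # c # xs) - 1. winding_number (linepath ((b # c # xs) ! i) ((b # c # xs) ! Suc i)) z)"
    using 4 z by (simp add: winding_number_join path_polygonal_path polygonal_path_ends)
  also have "\<dots> = (\<Sum>i<Suc (length (b # c # xs) - 1). winding_number (linepath ((a # b # c # xs) ! i) ((a # b # c # xs) ! Suc i)) z)"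
    by (subst sum.lessThan_Suc_shift) simp
  finally show ?case by simp
qed auto

definition cyclic_nth :: "'a list \<Rightarrow> nat \<Rightarrow> 'a" where
  "cyclic_nth xs i = xs ! (i mod length xs)"

lemma cyclic_nth_simps:
  "i < length xs \<Longrightarrow> cyclic_nth xs i = xs ! i" "cyclic_nth xs (length xs) = cyclic_nth xs 0"
  by (simp_all add: cyclic_nth_def)

lemma append_hd_nth: "xs \<noteq> [] \<Longrightarrow> i \<le> length xs \<Longrightarrow> (xs @ [hd xs]) ! i = cyclic_nth xs i"
  by (auto simp: nth_append cyclic_nth_def hd_conv_nth le_less)

lemma boundary_path_facts:
  assumes "xs \<noteq> []"
  shows "path (boundary_path xs)" "pathstart (boundary_path xs) = hd xs" "pathfinish (boundary_path xs) = hd xs"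
    and "path_image (boundary_path xs) = (\<Union>i<length xs. closed_segment (cyclic_nth xs i) (cyclic_nth xs (Suc i)))"
    and "z \<notin> path_image (boundary_path xs) \<Longrightarrow> winding_number (boundary_path xs) z
      = (\<Sum>i<length xs. winding_number (linepath (cyclic_nth xs i) (cyclic_nth xs (Suc i))) z)"
proof -
  show "path (boundary_path xs)" "pathstart (boundary_path xs) = hd xs" "pathfinish (boundary_path xs) = hd xs"
    using assms by (simp_all add: boundary_path_def path_polygonal_path polygonal_path_ends)
  have len: "2 \<le> length (xs @ [hd xs])"
    using assms by (cases xs) auto
  show "path_image (boundary_path xs) = (\<Union>i<length xs. closed_segment (cyclic_nth xs i) (cyclic_nth xs (Suc i)))"
    unfolding boundary_path_def path_image_polygonal_path[OF len] using assms by (simp add: append_hd_nth)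
  show "winding_number (boundary_path xs) z
      = (\<Sum>i<length xs. winding_number (linepath (cyclic_nth xs i) (cyclic_nth xs (Suc i))) z)"
    if "z \<notin> path_image (boundary_path xs)"
    using winding_number_polygonal_path[OF len, of z] that assms by (simp add: boundary_path_def append_hd_nth)
qed

lemma cyclic_nth_in_set: "xs \<noteq> [] \<Longrightarrow> cyclic_nth xs i \<in> set xs"
  by (simp add: cyclic_nth_def)

text \<open>Away from the null set \<open>N\<close> of sides and spokes, the sum of the oriented
  triangle indicators is the winding number of the boundary. For a simple closed curve this is a
  constant \<open>\<epsilon>\<close> inside and 0 outside. Integrating against the density turns the
  sum of indicators into the sum of half areas.\<close>

theorem hyp_area_polygon_region:
  assumes poly: "hyp_polygon xs"
  obtains \<epsilon> where "\<bar>\<epsilon>\<bar> = 1"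
    "hyp_area (polygon_region xs) = \<epsilon> * 2 * (\<Sum>i<length xs. half_area (poincare (cyclic_nth xs i)) (poincare (cyclic_nth xs (Suc i))))"
proof -
  let ?x = "cyclic_nth xs" and ?n = "length xs" and ?\<gamma> = "boundary_path xs"
  have ne: "xs \<noteq> []" and disc: "set xs \<subseteq> klein_disc" and simple: "simple_path ?\<gamma>"
    using poly by (auto simp: hyp_polygon_def)
  note facts = boundary_path_facts[OF ne]
  have x: "cmod (?x i) < 1" for i
    using disc cyclic_nth_in_set[OF ne, of i] by (auto simp: klein_disc_def)
  have loop: "pathfinish ?\<gamma> = pathstart ?\<gamma>"
    by (simp add: facts)
  obtain \<epsilon> :: real where \<epsilon>: "\<bar>\<epsilon>\<bar> = 1" "\<And>z. z \<in> inside (path_image ?\<gamma>) \<Longrightarrow> winding_number ?\<gamma> z = of_real \<epsilon>"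
  proof (rule simple_closed_path_winding_number_inside[OF simple])
    assume "\<And>z. z \<in> inside (path_image ?\<gamma>) \<Longrightarrow> winding_number ?\<gamma> z = 1"
    then show ?thesis using that[of 1] by simp
  next
    assume "\<And>z. z \<in> inside (path_image ?\<gamma>) \<Longrightarrow> winding_number ?\<gamma> z = - 1"
    then show ?thesis using that[of "- 1"] by simp
  qed
  have \<epsilon>2: "\<epsilon> * \<epsilon> = 1"
    using \<epsilon>(1) by (metis abs_mult_self_eq mult_1)
  define N where "N = (\<Union>i<?n. closed_segment 0 (?x i) \<union> closed_segment (?x i) (?x (Suc i)) \<union> closed_segment (?x (Suc i)) 0)"
  have "N \<in> null_sets lborel"
    unfolding N_def by (intro null_sets_UN' null_sets.Un null_sets_closed_segment) auto
  define k where "k i = Im (cnj (?x i) * ?x (Suc i))" for i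
  define H where "H i = convex hull {0, ?x i, ?x (Suc i)}" for i
  have key: "indicator (polygon_region xs) z = \<epsilon> * (\<Sum>i<?n. sgn (k i) * indicator (H i) z)" if z: "z \<notin> N" for z
  proof -
    have zP: "z \<notin> path_image ?\<gamma>"
      using z unfolding facts(4) N_def by blast
    let ?W = "\<lambda>i. winding_number (linepath 0 (?x i)) z"
    have "of_real (\<Sum>i<?n. sgn (k i) * indicator (H i) z)
        = (\<Sum>i<?n. ?W i + winding_number (linepath (?x i) (?x (Suc i))) z - ?W (Suc i))"
      unfolding of_real_sum
    proof (rule sum.cong)
      fix i assume "i \<in> {..<?n}"
      then have "z \<notin> closed_segment 0 (?x i)" "z \<notin> closed_segment (?x i) (?x (Suc i))" "z \<notin> closed_segment (?x (Suc i)) 0"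
        using z unfolding N_def by blast+
      then show "of_real (sgn (k i) * indicator (H i) z) = ?W i + winding_number (linepath (?x i) (?x (Suc i))) z - ?W (Suc i)"
        unfolding k_def H_def by (rule winding_number_triangle_origin[symmetric])
    qed simp
    also have "\<dots> = (\<Sum>i<?n. winding_number (linepath (?x i) (?x (Suc i))) z) + (\<Sum>i<?n. ?W i - ?W (Suc i))"
      by (simp add: sum.distrib[symmetric] algebra_simps)
    also have "(\<Sum>i<?n. ?W i - ?W (Suc i)) = 0"
      using sum_lessThan_telescope'[of ?W ?n] by (simp add: cyclic_nth_simps)
    finally have W: "of_real (\<Sum>i<?n. sgn (k i) * indicator (H i) z) = winding_number ?\<gamma> z"
      using facts(5)[OF zP] by simp
    show ?thesis
    proof (cases "z \<in> inside (path_image ?\<gamma>)")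
      case True
      then have "(\<Sum>i<?n. sgn (k i) * indicator (H i) z) = \<epsilon>"
        using W \<epsilon>(2) by (metis of_real_eq_iff)
      then show ?thesis
        using True \<epsilon>2 by (simp add: polygon_region_def)
    next
      case False
      then have "z \<in> outside (path_image ?\<gamma>)"
        using zP inside_Un_outside by blast
      then have "(\<Sum>i<?n. sgn (k i) * indicator (H i) z) = 0"
        using W winding_number_zero_in_outside[OF facts(1) loop] by (metis of_real_eq_0_iff)
      then show ?thesis
        using False zP by (simp add: polygon_region_def)
    qed
  qed
  have [measurable]: "H i \<in> sets borel" for i
    unfolding H_def by (intro borel_closed compact_imp_closed compact_convex_hull) auto
  have [measurable]: "polygon_region xs \<in> sets borel"
    unfolding polygon_region_def union_with_inside
    by (intro borel_comp borel_open open_outside closed_path_image facts)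
  have "hyp_area (polygon_region xs) = (\<integral>z. indicator (polygon_region xs) z * hyp_density z \<partial>lborel)"
    unfolding hyp_area_def set_lebesgue_integral_def by (simp only: real_scaleR_def)
  also have "\<dots> = (\<integral>z. \<epsilon> * (\<Sum>i<?n. sgn (k i) * indicator (H i) z * hyp_density z) \<partial>lborel)"
  proof (rule integral_cong_AE)
    show "AE z in lborel. indicator (polygon_region xs) z * hyp_density z
        = \<epsilon> * (\<Sum>i<?n. sgn (k i) * indicator (H i) z * hyp_density z)"
      using AE_not_in[OF \<open>N \<in> null_sets lborel\<close>]
    proof eventually_elim
      case (elim z)
      then show ?case
        unfolding key[OF elim] by (simp only: sum_distrib_right mult.assoc)
    qed
  qed measurable
  also have "\<dots> = \<epsilon> * (\<Sum>i<?n. 2 * half_area (poincare (?x i)) (poincare (?x (Suc i))))"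
  proof (rule has_bochner_integral_integral_eq)
    have "has_bochner_integral lborel (\<lambda>z. sgn (k i) * indicator (H i) z * hyp_density z)
        (2 * half_area (poincare (?x i)) (poincare (?x (Suc i))))" for i
      unfolding k_def H_def by (rule has_bochner_integral_triangle[OF x x])
    then show "has_bochner_integral lborel (\<lambda>z. \<epsilon> * (\<Sum>i<?n. sgn (k i) * indicator (H i) z * hyp_density z))
        (\<epsilon> * (\<Sum>i<?n. 2 * half_area (poincare (?x i)) (poincare (?x (Suc i)))))"
      by (intro has_bochner_integral_mult_right has_bochner_integral_sum)
  qed
  finally show ?thesis
    using that[OF \<epsilon>(1)] by (simp add: sum_distrib_left mult_ac)
qed

section \<open>Convex position\<close>

text \<open>Twice the signed Euclidean area of the triangle. As Klein geodesics are straight, its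
  sign is also the hyperbolic orientation.\<close>

definition orient :: "complex \<Rightarrow> complex \<Rightarrow> complex \<Rightarrow> real" where
  "orient x y z = Im (cnj (y - x) * (z - x))"

lemma orient_cycle: "orient x y z = orient y z x"
  by (simp add: orient_def algebra_simps)

lemma orient_same [simp]: "orient x y x = 0" "orient x y y = 0" "orient x x z = 0"
  by (simp_all add: orient_def algebra_simps)

lemma orient_eq_inner: "orient x y z = (\<i> * (y - x)) \<bullet> z - (\<i> * (y - x)) \<bullet> x"
  by (simp add: orient_def inner_complex_def algebra_simps)

lemma orient_convex_combination:
  "orient x y ((1 - t) *\<^sub>R u + t *\<^sub>R v) = (1 - t) * orient x y u + t * orient x y v"
  unfolding orient_eq_inner by (simp add: inner_add_right algebra_simps)

lemma orient_zero_on_segment: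
  assumes z: "z \<in> closed_segment u v" "orient x y z = 0"
    and uv: "orient x y u \<ge> 0" "orient x y v \<ge> 0" "orient x y u + orient x y v > 0"
  shows "z = u \<and> orient x y u = 0 \<or> z = v \<and> orient x y v = 0"
proof -
  obtain t where t: "0 \<le> t" "t \<le> 1" "z = (1 - t) *\<^sub>R u + t *\<^sub>R v"
    using z(1) by (auto simp: closed_segment_def)
  have s: "(1 - t) * orient x y u + t * orient x y v = 0"
    using z(2) unfolding t(3) orient_convex_combination .
  have "0 \<le> (1 - t) * orient x y u" "0 \<le> t * orient x y v"
    using t uv by simp_all
  then have "(1 - t) * orient x y u = 0" "t * orient x y v = 0"
    using s by linarith+
  then show ?thesis
    using uv t(3) by auto
qed

lemma orient_on_segment: "z \<in> closed_segment x y \<Longrightarrow> orient x y z = 0"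
  by (auto simp: closed_segment_def orient_convex_combination)

text \<open>All vertices behind an edge lie strictly to its left, so the rest of the path can meet
  the first edge only in their common vertex; this drives the induction.\<close>

lemma arc_polygonal_path:
  assumes "2 \<le> length ys"
    and "\<And>i j. Suc i < j \<Longrightarrow> j < length ys \<Longrightarrow> orient (ys ! i) (ys ! Suc i) (ys ! j) > 0"
    and "\<And>i. Suc i < length ys \<Longrightarrow> ys ! i \<noteq> ys ! Suc i"
  shows "arc (polygonal_path ys)"
  using assms
proof (induction ys rule: polygonal_path.induct)
  case (3 a b)
  then show ?case by (force simp: arc_linepath)
next
  case (4 a b c xs)
  let ?ys = "b # c # xs"
  have pos: "orient a b (?ys ! j) > 0" if "0 < j" "j < length ?ys" for j
    using 4(3)[of 0 "Suc j"] that by simp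
  have "arc (polygonal_path ?ys)"
  proof (rule 4(1))
    show "orient (?ys ! i) (?ys ! Suc i) (?ys ! j) > 0" if "Suc i < j" "j < length ?ys" for i j
      using 4(3)[of "Suc i" "Suc j"] that by simp
    show "?ys ! i \<noteq> ?ys ! Suc i" if "Suc i < length ?ys" for i
      using 4(4)[of "Suc i"] that by simp
  qed simp
  moreover have "arc (linepath a b)"
    using 4(4)[of 0] by (simp add: arc_linepath)
  moreover have "path_image (linepath a b) \<inter> path_image (polygonal_path ?ys) \<subseteq> {b}"
  proof
    fix z assume "z \<in> path_image (linepath a b) \<inter> path_image (polygonal_path ?ys)"
    then obtain i where z: "orient a b z = 0" and i: "i < length ?ys - 1" "z \<in> closed_segment (?ys ! i) (?ys ! Suc i)"
      by (auto simp: path_image_polygonal_path orient_on_segment)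
    have "orient a b (?ys ! i) \<ge> 0" "orient a b (?ys ! Suc i) > 0"
      using pos[of i] pos[of "Suc i"] i by (cases i; force)+
    then have "z = ?ys ! i" "orient a b (?ys ! i) = 0"
      using orient_zero_on_segment[OF i(2) z] by auto
    then show "z \<in> {b}"
      using pos[of i] i by (cases i) auto
  qed
  ultimately show ?case
    by (simp add: arc_join polygonal_path_ends)
qed auto

text \<open>Asking for all increasing triples, and not only for left turns at consecutive vertices,
  rules out star polygons that turn left but wind several times.\<close>

definition convex_position :: "complex list \<Rightarrow> bool" where
  "convex_position xs \<longleftrightarrow> (\<forall>i j l. i < j \<longrightarrow> j < l \<longrightarrow> l < length xs \<longrightarrow> orient (xs ! i) (xs ! j) (xs ! l) > 0)"

text \<open>Every edge lies on a supporting line of the vertex set. The edge that wraps around, and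
  vertices preceding an edge, are reduced to increasing triples by
  \<open>orient_cycle\<close>.\<close>

lemma convex_position_edge:
  assumes cp: "convex_position xs" and i: "i < length xs" and j: "j < length xs"
  shows "orient (cyclic_nth xs i) (cyclic_nth xs (Suc i)) (xs ! j) \<ge> 0"
    and "j \<noteq> i \<Longrightarrow> j \<noteq> Suc i mod length xs \<Longrightarrow> orient (cyclic_nth xs i) (cyclic_nth xs (Suc i)) (xs ! j) > 0"
proof -
  have "(j = i \<or> j = Suc i mod length xs) \<or> orient (cyclic_nth xs i) (cyclic_nth xs (Suc i)) (xs ! j) > 0"
  proof (cases "Suc i = length xs")
    case True
    show ?thesis
    proof (cases "j = i \<or> j = 0")
      case False
      then have "orient (xs ! 0) (xs ! j) (xs ! i) > 0"
        using cp i j True by (auto simp: convex_position_def)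
      then show ?thesis
        using True i by (simp add: cyclic_nth_def orient_cycle[of "xs ! i"])
    qed (use True in auto)
  next
    case False
    then have si: "Suc i < length xs" using i by simp
    consider "j < i" | "j = i \<or> j = Suc i" | "Suc i < j"
      by linarith
    then show ?thesis
    proof cases
      case 1
      then have "orient (xs ! j) (xs ! i) (xs ! Suc i) > 0"
        using cp si by (auto simp: convex_position_def)
      then show ?thesis
        using si by (simp add: cyclic_nth_def orient_cycle[of "xs ! j"])
    next
      case 3
      then have "orient (xs ! i) (xs ! Suc i) (xs ! j) > 0"
        using cp j by (auto simp: convex_position_def)
      then show ?thesis
        using si by (simp add: cyclic_nth_def)
    qed (use si in auto)
  qed
  then show "orient (cyclic_nth xs i) (cyclic_nth xs (Suc i)) (xs ! j) \<ge> 0"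
    "j \<noteq> i \<Longrightarrow> j \<noteq> Suc i mod length xs \<Longrightarrow> orient (cyclic_nth xs i) (cyclic_nth xs (Suc i)) (xs ! j) > 0"
    using i by (auto simp: cyclic_nth_def)
qed

lemma convex_position_distinct_edge:
  assumes cp: "convex_position xs" and n: "3 \<le> length xs" and i: "i < length xs"
  shows "cyclic_nth xs i \<noteq> cyclic_nth xs (Suc i)"
proof -
  have "card {i, Suc i mod length xs} \<le> 2"
    by (simp add: card_insert_if)
  then obtain j where "j < length xs" "j \<noteq> i" "j \<noteq> Suc i mod length xs"
    using n card_mono[of "{i, Suc i mod length xs}" "{..<length xs}"] by fastforce
  then have "orient (cyclic_nth xs i) (cyclic_nth xs (Suc i)) (xs ! j) > 0"
    using convex_position_edge[OF cp i] by blast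
  then show ?thesis by auto
qed

text \<open>The boundary is cut into its first edge and the arc formed by the others. That arc lies
  in the closed half plane to the left of the first edge and touches its line only at
  \<open>a\<close> and \<open>b\<close>.\<close>

lemma simple_boundary_path:
  assumes cp: "convex_position xs" and n: "3 \<le> length xs"
  shows "simple_path (boundary_path xs)"
proof -
  obtain a b c zs where xs: "xs = a # b # c # zs"
    using n by (metis One_nat_def Suc_1 Suc_le_length_iff numeral_3_eq_3)
  let ?ys = "b # c # zs @ [a]"
  have bp: "boundary_path xs = linepath a b +++ polygonal_path ?ys"
    by (simp add: boundary_path_def xs)
  \<comment> \<open>Positions in \<open>?ys\<close> are shifted by one, and its last entry is the
    first vertex again, hence the cyclic index.\<close>
  have ys_nth: "?ys ! i = cyclic_nth xs (Suc i)" if "i < length ?ys" for i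
    using that append_hd_nth[of xs "Suc i"] by (simp add: xs)
  have len: "length ?ys = length xs"
    by (simp add: xs)
  have ab: "cyclic_nth xs 0 = a" "cyclic_nth xs (Suc 0) = b" "xs ! 0 = a" "xs ! 1 = b"
    by (simp_all add: xs cyclic_nth_def)
  have edge: "orient a b (xs ! j) \<ge> 0" "2 \<le> j \<Longrightarrow> orient a b (xs ! j) > 0" if "j < length xs" for j
  proof -
    have "0 < length xs" "Suc 0 mod length xs = 1"
      by (simp_all add: xs)
    then show "orient a b (xs ! j) \<ge> 0" "2 \<le> j \<Longrightarrow> orient a b (xs ! j) > 0"
      using convex_position_edge[OF cp _ that, of 0, unfolded ab] by auto
  qed
  show ?thesis
    unfolding bp
  proof (rule simple_path_join_loop)
    show "arc (linepath a b)"
    proof -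
      have "0 < length xs" using n by linarith
      from convex_position_distinct_edge[OF cp n this] show ?thesis
        by (simp add: ab arc_linepath)
    qed
    show "arc (polygonal_path ?ys)"
    proof (rule arc_polygonal_path)
      show "orient (?ys ! i) (?ys ! Suc i) (?ys ! j) > 0" if ij: "Suc i < j" "j < length ?ys" for i j
      proof -
        have "Suc j mod length xs = (if Suc j = length xs then 0 else Suc j)"
          using ij unfolding len by auto
        then have "Suc j mod length xs \<noteq> Suc i" "Suc j mod length xs \<noteq> Suc (Suc i) mod length xs"
          using ij unfolding len by auto
        then have "orient (cyclic_nth xs (Suc i)) (cyclic_nth xs (Suc (Suc i))) (xs ! (Suc j mod length xs)) > 0"
          using ij len by (intro convex_position_edge(2)[OF cp]) (auto intro: mod_less_divisor)
        then show ?thesis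
          using ij by (simp only: ys_nth cyclic_nth_def[of xs "Suc j"])
      qed
      show "?ys ! i \<noteq> ?ys ! Suc i" if "Suc i < length ?ys" for i
      proof -
        have i: "i < length ?ys" "Suc i < length xs"
          using that len by linarith+
        show ?thesis
          unfolding ys_nth[OF i(1)] ys_nth[OF that]
          by (rule convex_position_distinct_edge[OF cp n i(2)])
      qed
    qed simp
    show "path_image (linepath a b) \<inter> path_image (polygonal_path ?ys)
        \<subseteq> {pathstart (linepath a b), pathstart (polygonal_path ?ys)}"
    proof
      fix z assume z: "z \<in> path_image (linepath a b) \<inter> path_image (polygonal_path ?ys)"
      then have z0: "orient a b z = 0"
        by (auto simp: orient_on_segment)
      obtain i where i: "i < length ?ys - 1" and zi: "z \<in> closed_segment (?ys ! i) (?ys ! Suc i)"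
        using z by (subst (asm) path_image_polygonal_path) auto
      have i': "Suc i < length xs" and y: "?ys ! i = xs ! Suc i" "?ys ! Suc i = cyclic_nth xs (Suc (Suc i))"
        using i ys_nth[of i] ys_nth[of "Suc i"] len by (auto simp: cyclic_nth_def)
      have md: "k mod length xs < length xs" for k
        using n by (intro mod_less_divisor) linarith
      have nonneg: "orient a b (?ys ! i) \<ge> 0" "orient a b (?ys ! Suc i) \<ge> 0"
        unfolding y cyclic_nth_def using edge(1) i' md by auto
      have "orient a b (?ys ! i) > 0 \<or> orient a b (?ys ! Suc i) > 0"
      proof (cases i)
        case 0
        then show ?thesis
          unfolding y cyclic_nth_def using edge(2)[of 2] n by (simp add: numeral_2_eq_2)
      next
        case (Suc i0)
        then show ?thesis
          unfolding y using edge(2)[of "Suc i"] i' by simp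
      qed
      then have "(z = ?ys ! i \<and> orient a b (?ys ! i) = 0) \<or> (z = ?ys ! Suc i \<and> orient a b (?ys ! Suc i) = 0)"
        using orient_zero_on_segment[OF zi z0] nonneg by auto
      moreover have "xs ! l \<in> {a, b}" if "l < length xs" "orient a b (xs ! l) = 0" for l
      proof -
        have "l < 2"
          using edge(2)[OF that(1)] that(2) by linarith
        then have "l = 0 \<or> l = 1" by linarith
        then show ?thesis using ab by auto
      qed
      ultimately have "z \<in> {a, b}"
        unfolding y cyclic_nth_def using i' md by blast
      then show "z \<in> {pathstart (linepath a b), pathstart (polygonal_path ?ys)}"
        by (simp add: polygonal_path_ends)
    qed
  qed (simp_all add: polygonal_path_ends)
qed

text \<open>The supporting lines keep the interior of the hull \<open>K\<close> off the boundary
  curve. Being connected and containing the inside of the curve, this interior cannot also meet the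
  outside, so it equals the inside; taking closures gives the claim.\<close>

lemma polygon_region_convex_position:
  assumes cp: "convex_position xs" and n: "3 \<le> length xs"
  shows "polygon_region xs = convex hull (set xs)"
proof -
  define K where "K = convex hull (set xs)"
  define P where "P = path_image (boundary_path xs)"
  have ne: "xs \<noteq> []" using n by auto
  note facts = boundary_path_facts[OF ne]
  have simple: "simple_path (boundary_path xs)"
    by (rule simple_boundary_path[OF cp n])
  have K: "convex K" "closed K"
    by (simp_all add: K_def compact_imp_closed compact_convex_hull finite_imp_compact)
  have PK: "P \<subseteq> K"
    unfolding P_def facts(4) K_def
    by (intro UN_least closed_segment_subset_convex_hull hull_inc cyclic_nth_in_set[OF ne])
  have disj: "interior K \<inter> P = {}"
  proof (rule ccontr)
    assume "interior K \<inter> P \<noteq> {}"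
    then obtain z i where z: "z \<in> interior K" and i: "i < length xs"
      and zi: "z \<in> closed_segment (cyclic_nth xs i) (cyclic_nth xs (Suc i))"
      unfolding P_def facts(4) by blast
    define x y where "x = cyclic_nth xs i" and "y = cyclic_nth xs (Suc i)"
    define w where "w = \<i> * (y - x)"
    have "w \<noteq> 0"
      using convex_position_distinct_edge[OF cp n i] by (auto simp: w_def x_def y_def)
    have "set xs \<subseteq> {v. w \<bullet> v \<ge> w \<bullet> x}"
      using convex_position_edge(1)[OF cp i] unfolding orient_eq_inner w_def x_def y_def
      by (auto simp: in_set_conv_nth)
    then have "K \<subseteq> {v. w \<bullet> v \<ge> w \<bullet> x}"
      unfolding K_def by (intro hull_minimal convex_halfspace_ge)
    then have "interior K \<subseteq> {v. w \<bullet> v > w \<bullet> x}"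
      using interior_mono interior_halfspace_ge[OF \<open>w \<noteq> 0\<close>] by blast
    then have "orient x y z > 0"
      using z unfolding orient_eq_inner w_def by auto
    then show False
      using orient_on_segment[OF zi] by (simp add: x_def y_def)
  qed
  have J: "inside P \<noteq> {}" "open (inside P)" "open (outside P)" "inside P \<inter> outside P = {}"
    "inside P \<union> outside P = - P" "frontier (inside P) = P"
    using Jordan_inside_outside[OF simple] facts by (auto simp: P_def)
  have "inside P \<subseteq> K"
    using convex_in_outside[OF K(1)] outside_mono[OF PK] J(4) by blast
  then have sub: "inside P \<subseteq> interior K"
    using J(2) by (rule interior_maximal)
  have "interior K \<subseteq> inside P"
    using connectedD[OF convex_connected[OF convex_interior[OF K(1)]] J(2,3)] J(1,4,5) sub disj by blast
  then have inside_eq: "inside P = interior K"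
    using sub by blast
  then have "interior K \<noteq> {}"
    using J(1) by simp
  then have "K = closure (inside P)"
    using convex_closure_interior[OF K(1)] K(2) by (simp add: inside_eq)
  also have "\<dots> = inside P \<union> P"
    by (metis J(6) closure_Un_frontier)
  finally show ?thesis
    by (simp add: polygon_region_def K_def P_def Un_commute)
qed

lemma hyp_polygon_convex_position:
  "convex_position xs \<Longrightarrow> 3 \<le> length xs \<Longrightarrow> set xs \<subseteq> klein_disc \<Longrightarrow> hyp_polygon xs"
  by (simp add: hyp_polygon_def simple_boundary_path)

section \<open>Cyclic and semicyclic polygons\<close>

lemma norm_poincare_one_plus:
  assumes "cmod x < 1"
  shows "1 + (cmod (poincare x))\<^sup>2 = 2 / (1 + sqrt (1 - (cmod x)\<^sup>2))"
    and "1 - (cmod (poincare x))\<^sup>2 = 2 * sqrt (1 - (cmod x)\<^sup>2) / (1 + sqrt (1 - (cmod x)\<^sup>2))"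
proof -
  define s where "s = sqrt (1 - (cmod x)\<^sup>2)"
  have s: "0 < s"
    using one_minus_norm_sq_pos[OF assms] by (simp add: s_def)
  have p: "(cmod (poincare x))\<^sup>2 = (1 - s) / (1 + s)"
    unfolding s_def by (rule norm_poincare_sq[OF assms])
  have "1 + (1 - s) / (1 + s) = 2 / (1 + s)" "1 - (1 - s) / (1 + s) = 2 * s / (1 + s)"
    using s by (simp_all add: divide_simps)
  then show "1 + (cmod (poincare x))\<^sup>2 = 2 / (1 + sqrt (1 - (cmod x)\<^sup>2))"
    "1 - (cmod (poincare x))\<^sup>2 = 2 * sqrt (1 - (cmod x)\<^sup>2) / (1 + sqrt (1 - (cmod x)\<^sup>2))"
    unfolding p s_def by blast+
qed

lemma poincare_inverse:
  assumes "cmod x < 1"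
  shows "x = (2 / (1 + (cmod (poincare x))\<^sup>2)) *\<^sub>R poincare x"
proof -
  define s where "s = sqrt (1 - (cmod x)\<^sup>2)"
  have s: "0 < s"
    using one_minus_norm_sq_pos[OF assms] by (simp add: s_def)
  have "poincare x = (1 / (1 + s)) *\<^sub>R x"
    by (simp add: poincare_def s_def scaleR_conv_of_real)
  then show ?thesis
    unfolding norm_poincare_one_plus(1)[OF assms] s_def[symmetric] using s by simp
qed

text \<open>Both sides are \<open>cosh\<close> of the distance: the right one is the Klein formula,
  the left one is \<open>1 + 2 sinh^2\<close> of half the distance.\<close>

lemma chord_sq_poincare:
  assumes x: "cmod x < 1" and y: "cmod y < 1"
  shows "1 + 2 * chord_sq (poincare x) (poincare y)
    = (1 - x \<bullet> y) / (sqrt (1 - (cmod x)\<^sup>2) * sqrt (1 - (cmod y)\<^sup>2))"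
proof -
  define s t where "s = sqrt (1 - (cmod x)\<^sup>2)" and "t = sqrt (1 - (cmod y)\<^sup>2)"
  have s: "0 < s" "(cmod x)\<^sup>2 = 1 - s * s" and t: "0 < t" "(cmod y)\<^sup>2 = 1 - t * t"
    using one_minus_norm_sq_pos[OF x] one_minus_norm_sq_pos[OF y] by (simp_all add: s_def t_def)
  have "poincare x = (1 / (1 + s)) *\<^sub>R x" "poincare y = (1 / (1 + t)) *\<^sub>R y"
    by (simp_all add: poincare_def s_def t_def scaleR_conv_of_real)
  then have inner: "Re (poincare x * cnj (poincare y)) = (x \<bullet> y) / ((1 + s) * (1 + t))"
    by (simp add: inner_complex_def add_divide_distrib mult.commute)
  have "chord_sq (poincare x) (poincare y) = ((1 - s) / (1 + s) + (1 - t) / (1 + t) - 2 * ((x \<bullet> y) / ((1 + s) * (1 + t))))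
      / ((2 * s / (1 + s)) * (2 * t / (1 + t)))"
    unfolding chord_sq_def norm_sq_diff inner norm_poincare_one_plus(2)[OF x] norm_poincare_one_plus(2)[OF y]
    unfolding norm_poincare_sq[OF x] norm_poincare_sq[OF y] s_def t_def ..
  also have "\<dots> = (1 - s * t - x \<bullet> y) / (2 * s * t)"
  proof -
    define u v where "u = 1 + s" and "v = 1 + t"
    have uv: "0 < u" "0 < v" "s = u - 1" "t = v - 1"
      using s t by (simp_all add: u_def v_def)
    have "(1 - s) / u + (1 - t) / v - 2 * (X / (u * v)) = 2 * (1 - s * t - X) / (u * v)" for X
      using uv(1,2) unfolding uv(3,4) by (simp add: divide_simps) (simp add: algebra_simps)
    moreover have "2 * Y / (u * v) / (2 * s / u * (2 * t / v)) = Y / (2 * s * t)" for Y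
      using uv(1,2) s(1) t(1) by (simp add: divide_simps)
    ultimately show ?thesis
      by (simp only: u_def[symmetric] v_def[symmetric])
  qed
  finally have "1 + 2 * chord_sq (poincare x) (poincare y) = (1 - x \<bullet> y) / (s * t)"
    using s(1) t(1) by (simp add: field_simps)
  then show ?thesis
    by (simp only: s_def t_def)
qed

lemma chord_sq_nonneg: "cmod p < 1 \<Longrightarrow> cmod q < 1 \<Longrightarrow> 0 \<le> chord_sq p q"
  using one_minus_norm_sq_pos by (simp add: chord_sq_def less_imp_le)

lemma hyp_dist_chord:
  assumes x: "cmod x < 1" and y: "cmod y < 1"
  shows "hyp_dist x y \<ge> 0" "chord_sq (poincare x) (poincare y) = (sinh (hyp_dist x y / 2))\<^sup>2"
proof -
  have ge: "1 \<le> 1 + 2 * chord_sq (poincare x) (poincare y)"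
    using chord_sq_nonneg norm_poincare_less x y by simp
  have h: "hyp_dist x y = arcosh (1 + 2 * chord_sq (poincare x) (poincare y))"
    unfolding hyp_dist_def chord_sq_poincare[OF x y] ..
  show "hyp_dist x y \<ge> 0"
    unfolding h using ge by (rule arcosh_nonneg_real)
  have "cosh (2 * (hyp_dist x y / 2)) = 1 + 2 * chord_sq (poincare x) (poincare y)"
    unfolding h using ge by simp
  then show "chord_sq (poincare x) (poincare y) = (sinh (hyp_dist x y / 2))\<^sup>2"
    unfolding cosh_double cosh_square_eq by simp
qed

text \<open>
  The determinant of the rows \<open>(1 + |p|\<^sup>2, Re p, Im p)\<close>, which up to positive factors are the points
  on the hyperboloid; on these rows disc automorphisms act as Lorentz transformations.
\<close>

definition orient_disc :: "complex \<Rightarrow> complex \<Rightarrow> complex \<Rightarrow> real" where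
  "orient_disc p q r = (1 + (cmod p)\<^sup>2) * Im (cnj q * r) + (1 + (cmod q)\<^sup>2) * Im (cnj r * p)
    + (1 + (cmod r)\<^sup>2) * Im (cnj p * q)"

text \<open>The Klein point is \<open>2 p / (1 + |p|^2)\<close>, so dividing each row of the
  determinant by its first entry gives affine Klein coordinates up to the factor 2.\<close>

lemma orient_eq_orient_disc:
  assumes "cmod x < 1" "cmod y < 1" "cmod z < 1"
  shows "orient x y z = 4 * orient_disc (poincare x) (poincare y) (poincare z)
    / ((1 + (cmod (poincare x))\<^sup>2) * (1 + (cmod (poincare y))\<^sup>2) * (1 + (cmod (poincare z))\<^sup>2))"
proof -
  have expand: "orient x y z = Im (cnj y * z) + Im (cnj z * x) + Im (cnj x * y)"
    by (simp add: orient_def algebra_simps)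
  define p q r where "p = poincare x" and "q = poincare y" and "r = poincare z"
  define P Q R where "P = 1 + (cmod p)\<^sup>2" and "Q = 1 + (cmod q)\<^sup>2" and "R = 1 + (cmod r)\<^sup>2"
  have pos: "0 < P" "0 < Q" "0 < R"
    by (simp_all add: P_def Q_def R_def add_pos_nonneg)
  have xyz: "x = (2 / P) *\<^sub>R p" "y = (2 / Q) *\<^sub>R q" "z = (2 / R) *\<^sub>R r"
    unfolding P_def Q_def R_def p_def q_def r_def by (rule poincare_inverse; fact)+
  have scale: "Im (cnj (a *\<^sub>R u) * (b *\<^sub>R v)) = a * b * Im (cnj u * v)" for a b u v
    by (simp add: algebra_simps)
  have "orient x y z = 2 / Q * (2 / R) * Im (cnj q * r) + 2 / R * (2 / P) * Im (cnj r * p) + 2 / P * (2 / Q) * Im (cnj p * q)"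
    unfolding expand by (simp only: xyz scale)
  also have "\<dots> = 4 * (P * Im (cnj q * r) + Q * Im (cnj r * p) + R * Im (cnj p * q)) / (P * Q * R)"
  proof -
    have "2 / Q * (2 / R) * a + 2 / R * (2 / P) * b + 2 / P * (2 / Q) * c = 4 * (P * a + Q * b + R * c) / (P * Q * R)" for a b c
      using pos by (simp add: divide_simps)
    then show ?thesis .
  qed
  finally show ?thesis
    by (simp add: orient_disc_def P_def Q_def R_def p_def q_def r_def)
qed

lemma orient_disc_moebius_pos_iff:
  assumes c: "cmod c < 1" and p: "cmod p < 1" and q: "cmod q < 1" and r: "cmod r < 1"
  shows "orient_disc (moebius c p) (moebius c q) (moebius c r) > 0 \<longleftrightarrow> orient_disc p q r > 0"
    and "orient_disc (moebius c p) (moebius c q) (moebius c r) = 0 \<longleftrightarrow> orient_disc p q r = 0"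
proof -
  define c1 c2 where "c1 = Re c" and "c2 = Im c"
  define N where "N z = (cmod (1 - z * cnj c))\<^sup>2" for z
  \<comment> \<open>\<open>A\<close>, \<open>X\<close> and \<open>Y\<close> are the components of a
    linear map on rows \<open>(a, x, y)\<close>; dividing by \<open>N\<close> gives the row of the
    image point. The map scales the form \<open>a^2 - 4 x^2 - 4 y^2\<close> by
    \<open>(1 - |c|^2)^2\<close>, which accounts for its determinant
    \<open>k = (1 - |c|^2)^3\<close>.\<close>
  define A where "A a x y = (1 + c1 * c1 + c2 * c2) * a - 4 * (c1 * x + c2 * y)" for a x y
  define X where "X a x y = x - c1 * a + (c1 * c1 - c2 * c2) * x + 2 * c1 * c2 * y" for a x y
  define Y where "Y a x y = y - c2 * a - (c1 * c1 - c2 * c2) * y + 2 * c1 * c2 * x" for a x y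
  define a where "a z = 1 + (cmod z)\<^sup>2" for z :: complex
  have Npos: "0 < N z" if "cmod z < 1" for z
    using one_minus_cnj_nonzero[OF that c] by (simp add: N_def)
  have V: "Re (moebius c z) = X (a z) (Re z) (Im z) / N z" "Im (moebius c z) = Y (a z) (Re z) (Im z) / N z"
    "1 + (cmod (moebius c z))\<^sup>2 = A (a z) (Re z) (Im z) / N z" if z: "cmod z < 1" for z
  proof -
    have nz: "1 - cnj c * z \<noteq> 0"
      using one_minus_cnj_nonzero[OF z c] by (simp add: mult.commute)
    have NN: "of_real (N z) = (1 - cnj c * z) * cnj (1 - cnj c * z)"
      unfolding N_def complex_norm_square by (simp add: mult.commute)
    have "moebius c z * of_real (N z) = (z - c) * cnj (1 - cnj c * z)"
      unfolding NN Moebius_function_simple using nz by simp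
    also have "\<dots> = Complex (X (a z) (Re z) (Im z)) (Y (a z) (Re z) (Im z))"
      unfolding complex_eq_iff a_def cmod_power2
      by (simp add: X_def Y_def c1_def c2_def) (simp add: power2_eq_square algebra_simps)
    finally have "Re (moebius c z) * N z = X (a z) (Re z) (Im z)" "Im (moebius c z) * N z = Y (a z) (Re z) (Im z)"
      by (simp_all add: complex_eq_iff)
    then show "Re (moebius c z) = X (a z) (Re z) (Im z) / N z" "Im (moebius c z) = Y (a z) (Re z) (Im z) / N z"
      using Npos[OF z] by (simp_all add: eq_divide_eq)
    have "(1 - (cmod (moebius c z))\<^sup>2) * N z = (1 - (cmod z)\<^sup>2) * (1 - (cmod c)\<^sup>2)"
      unfolding one_minus_norm_moebius[OF c z] N_def[symmetric] using Npos[OF z] by simp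
    moreover have "2 * N z - (1 - (cmod z)\<^sup>2) * (1 - (cmod c)\<^sup>2) = A (a z) (Re z) (Im z)"
      unfolding N_def a_def A_def c1_def c2_def cmod_power2 by (simp add: power2_eq_square algebra_simps)
    moreover have "(1 + u) * n = 2 * n - (1 - u) * n" for u n :: real
      by (simp add: algebra_simps)
    ultimately have "(1 + (cmod (moebius c z))\<^sup>2) * N z = A (a z) (Re z) (Im z)"
      by metis
    then show "1 + (cmod (moebius c z))\<^sup>2 = A (a z) (Re z) (Im z) / N z"
      using Npos[OF z] by (simp add: eq_divide_eq)
  qed
  have cross: "Im (cnj u * v) = Re u * Im v - Im u * Re v" for u v
    by (simp add: algebra_simps)
  define k where "k = (1 - c1 * c1 - c2 * c2) ^ 3"
  have "1 - c1 * c1 - c2 * c2 = 1 - (cmod c)\<^sup>2"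
    unfolding cmod_power2 c1_def c2_def by (simp add: power2_eq_square)
  then have k: "0 < k"
    using one_minus_norm_sq_pos[OF c] by (simp add: k_def)
  have "orient_disc (moebius c p) (moebius c q) (moebius c r) = k * orient_disc p q r / (N p * N q * N r)"
  proof -
    have det: "A a1 x1 y1 * (X a2 x2 y2 * Y a3 x3 y3 - Y a2 x2 y2 * X a3 x3 y3)
      + A a2 x2 y2 * (X a3 x3 y3 * Y a1 x1 y1 - Y a3 x3 y3 * X a1 x1 y1)
      + A a3 x3 y3 * (X a1 x1 y1 * Y a2 x2 y2 - Y a1 x1 y1 * X a2 x2 y2)
      = k * (a1 * (x2 * y3 - y2 * x3) + a2 * (x3 * y1 - y3 * x1) + a3 * (x1 * y2 - y1 * x2))"
      for a1 a2 a3 x1 x2 x3 y1 y2 y3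
      unfolding A_def X_def Y_def k_def by algebra
    have frac: "A1 / n1 * (X2 / n2 * (Y3 / n3) - Y2 / n2 * (X3 / n3)) + A2 / n2 * (X3 / n3 * (Y1 / n1) - Y3 / n3 * (X1 / n1))
      + A3 / n3 * (X1 / n1 * (Y2 / n2) - Y1 / n1 * (X2 / n2))
      = (A1 * (X2 * Y3 - Y2 * X3) + A2 * (X3 * Y1 - Y3 * X1) + A3 * (X1 * Y2 - Y1 * X2)) / (n1 * n2 * n3)"
      for A1 A2 A3 X1 X2 X3 Y1 Y2 Y3 n1 n2 n3 :: real
      by (simp add: diff_divide_distrib[symmetric] add_divide_distrib[symmetric] mult.commute mult.left_commute)
    show ?thesis
      unfolding orient_disc_def cross V[OF p] V[OF q] V[OF r] frac det a_def ..
  qed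
  moreover have "0 < k * d / n \<longleftrightarrow> 0 < d" "k * d / n = 0 \<longleftrightarrow> d = 0" if "0 < n" for d n :: real
    using k that by (simp_all add: zero_less_divide_iff zero_less_mult_iff)
  moreover have "0 < N p * N q * N r"
    using Npos p q r by simp
  ultimately show "orient_disc (moebius c p) (moebius c q) (moebius c r) > 0 \<longleftrightarrow> orient_disc p q r > 0"
    "orient_disc (moebius c p) (moebius c q) (moebius c r) = 0 \<longleftrightarrow> orient_disc p q r = 0"
    by (simp_all only:)
qed

lemma orient_pos_iff:
  assumes "cmod x < 1" "cmod y < 1" "cmod z < 1"
  shows "orient x y z > 0 \<longleftrightarrow> orient_disc (poincare x) (poincare y) (poincare z) > 0"
    and "orient x y z = 0 \<longleftrightarrow> orient_disc (poincare x) (poincare y) (poincare z) = 0"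
proof -
  have "0 < (1 + (cmod (poincare x))\<^sup>2) * (1 + (cmod (poincare y))\<^sup>2) * (1 + (cmod (poincare z))\<^sup>2)"
    by (intro mult_pos_pos add_pos_nonneg) auto
  moreover have "0 < 4 * d / n \<longleftrightarrow> 0 < d" "4 * d / n = 0 \<longleftrightarrow> d = 0" if "0 < n" for d n :: real
    using that by (simp_all add: zero_less_divide_iff)
  ultimately show "orient x y z > 0 \<longleftrightarrow> orient_disc (poincare x) (poincare y) (poincare z) > 0"
    "orient x y z = 0 \<longleftrightarrow> orient_disc (poincare x) (poincare y) (poincare z) = 0"
    unfolding orient_eq_orient_disc[OF assms] by (simp_all only:)
qed

section \<open>Vertices on a semicircle about the origin\<close>

locale semicircle =
  fixes m :: nat and e :: "nat \<Rightarrow> complex" and \<beta> :: "nat \<Rightarrow> real" and \<rho> S :: real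
  assumes rho: "0 < \<rho>" "\<rho> < 1" and S_def: "S = 2 * \<rho> / (1 - \<rho>\<^sup>2)"
    and norm_e0: "cmod (e 0) = \<rho>"
    and e_eq: "\<And>j. j \<le> m \<Longrightarrow> e j = e 0 * cis (\<beta> j)"
    and \<beta>_mono: "\<And>i j. i < j \<Longrightarrow> j \<le> m \<Longrightarrow> \<beta> i < \<beta> j"
    and \<beta>_ends: "\<beta> 0 = 0" "\<beta> m = pi"
begin

lemma norm_e: "j \<le> m \<Longrightarrow> cmod (e j) = \<rho>"
  by (subst e_eq) (simp_all add: norm_mult norm_e0)

lemma cnj_e_mult: "i \<le> m \<Longrightarrow> j \<le> m \<Longrightarrow> cnj (e i) * e j = of_real (\<rho>\<^sup>2) * cis (\<beta> j - \<beta> i)"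
proof -
  assume i: "i \<le> m" and j: "j \<le> m"
  have "cnj (e i) * e j = (e 0 * cnj (e 0)) * (cis (\<beta> j) * cis (- \<beta> i))"
    unfolding e_eq[OF i] e_eq[OF j] by (simp add: cis_cnj mult_ac)
  then show ?thesis
    by (simp only: cis_mult norm_sq_cnj[symmetric] norm_e0) simp
qed

lemma Im_cnj_e_mult: "i \<le> m \<Longrightarrow> j \<le> m \<Longrightarrow> Im (cnj (e i) * e j) = \<rho>\<^sup>2 * sin (\<beta> j - \<beta> i)"
  by (simp only: cnj_e_mult) simp

lemma Re_cnj_e_mult: "i \<le> m \<Longrightarrow> j \<le> m \<Longrightarrow> Re (cnj (e i) * e j) = \<rho>\<^sup>2 * cos (\<beta> j - \<beta> i)"
  by (simp only: cnj_e_mult) simp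

lemma \<beta>_le: "\<beta> j \<le> pi" "0 \<le> \<beta> j" if "j \<le> m"
proof -
  show "\<beta> j \<le> pi"
    using \<beta>_mono[of j m] \<beta>_ends that by (cases "j = m") auto
  show "0 \<le> \<beta> j"
    using \<beta>_mono[of 0 j] \<beta>_ends that by (cases "j = 0") auto
qed

text \<open>On a circle about 0 the determinant is a positive multiple of
  \<open>sin x + sin y - sin (x + y)\<close>, where \<open>x\<close> and \<open>y\<close> are
  consecutive angle differences. This equals \<open>sin x (1 - cos y) + sin y (1 - cos x)\<close>,
  positive because \<open>x + y \<le> pi\<close>.\<close>

lemma orient_disc_pos:
  assumes "i < j" "j < l" "l \<le> m"
  shows "orient_disc (e i) (e j) (e l) > 0"
proof -
  define x y where "x = \<beta> j - \<beta> i" and "y = \<beta> l - \<beta> j"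
  have bounds: "0 < x" "0 < y" "x + y \<le> pi"
    using \<beta>_mono[of i j] \<beta>_mono[of j l] \<beta>_le[of i] \<beta>_le[of l] assms by (auto simp: x_def y_def)
  have le: "i \<le> m" "j \<le> m" "l \<le> m"
    using assms by auto
  have "orient_disc (e i) (e j) (e l) = (1 + \<rho>\<^sup>2) * \<rho>\<^sup>2 * (sin y + sin (- (x + y)) + sin x)"
    unfolding orient_disc_def Im_cnj_e_mult[OF le(2,3)] Im_cnj_e_mult[OF le(3,1)] Im_cnj_e_mult[OF le(1,2)]
      norm_e[OF le(1)] norm_e[OF le(2)] norm_e[OF le(3)]
    by (simp add: x_def y_def distrib_left mult.assoc)
  also have "sin y + sin (- (x + y)) + sin x = sin x * (1 - cos y) + sin y * (1 - cos x)"
  proof -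
    have "sin (- (x + y)) = - (sin x * cos y + cos x * sin y)"
      by (simp only: sin_minus sin_add)
    then show ?thesis
      by (simp add: algebra_simps)
  qed
  also have "(1 + \<rho>\<^sup>2) * \<rho>\<^sup>2 * \<dots> > 0"
  proof (intro mult_pos_pos add_pos_pos)
    show "0 < sin x" "0 < sin y"
      using bounds by (intro sin_gt_zero; linarith)+
    have "cos x < cos 0" "cos y < cos 0"
      using bounds by (intro cos_monotone_0_pi; linarith)+
    then show "0 < 1 - cos y" "0 < 1 - cos x"
      by simp_all
  qed (use rho in \<open>auto simp: add_pos_nonneg\<close>)
  finally show ?thesis .
qed

lemma chord:
  assumes "j < m"
  shows "chord_sq (e j) (e (Suc j)) = (S * sin ((\<beta> (Suc j) - \<beta> j) / 2))\<^sup>2"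
    and "half_area (e j) (e (Suc j)) = isosceles_half_area S (S * sin ((\<beta> (Suc j) - \<beta> j) / 2))"
    and "arcsin (S * sin ((\<beta> (Suc j) - \<beta> j) / 2) / S) = (\<beta> (Suc j) - \<beta> j) / 2"
    and "0 \<le> S * sin ((\<beta> (Suc j) - \<beta> j) / 2)" "S * sin ((\<beta> (Suc j) - \<beta> j) / 2) \<le> S"
proof -
  define t where "t = (\<beta> (Suc j) - \<beta> j) / 2"
  have j: "j \<le> m" "Suc j \<le> m" using assms by auto
  have t: "0 < t" "t \<le> pi / 2"
    using \<beta>_mono[of j "Suc j"] \<beta>_le[of j] \<beta>_le[of "Suc j"] j by (auto simp: t_def)
  have sint: "0 < sin t"
    using t by (intro sin_gt_zero) auto
  have r: "0 < 1 - \<rho>\<^sup>2"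
    using one_minus_norm_sq_pos[of "e 0"] rho by (simp add: norm_e0)
  have S: "0 < S"
    using rho r by (simp add: S_def)
  have t2: "\<beta> (Suc j) - \<beta> j = 2 * t"
    by (simp add: t_def)
  have cm: "Re (e j * cnj (e (Suc j))) = \<rho>\<^sup>2 * cos (2 * t)"
    using Re_cnj_e_mult[OF j] unfolding t2 by (simp add: mult.commute)
  have "(cmod (e j - e (Suc j)))\<^sup>2 = 4 * \<rho>\<^sup>2 * (sin t)\<^sup>2"
    unfolding norm_sq_diff cm norm_e[OF j(1)] norm_e[OF j(2)] cos_double_sin by (simp add: algebra_simps)
  then have chord_eq: "chord_sq (e j) (e (Suc j)) = (S * sin t)\<^sup>2"
    unfolding chord_sq_def norm_e[OF j(1)] norm_e[OF j(2)]
    by (simp add: S_def power_mult_distrib power_divide power2_eq_square)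
  have "Im (1 - e j * cnj (e (Suc j))) = \<rho>\<^sup>2 * sin (2 * t)"
    using Im_cnj_e_mult[OF j] unfolding t2 by (simp add: mult.commute)
  also have "\<dots> \<ge> 0"
    using t by (intro mult_nonneg_nonneg sin_ge_zero) auto
  finally have "half_area (e j) (e (Suc j)) \<ge> 0"
    unfolding half_area_def Arg_less_0 .
  moreover have "\<bar>half_area (e j) (e (Suc j))\<bar> = isosceles_half_area S (S * sin t)"
    using S sint by (intro abs_half_area_circle[OF norm_e[OF j(1)] norm_e[OF j(2)] rho(2) S_def chord_eq]) simp
  ultimately have half_eq: "half_area (e j) (e (Suc j)) = isosceles_half_area S (S * sin t)"
    by simp
  have "arcsin (S * sin t / S) = t"
    using S t arcsin_sin[of t] by simp
  moreover have "S * sin t \<le> S * 1"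
    using S by (intro mult_left_mono) auto
  ultimately show "chord_sq (e j) (e (Suc j)) = (S * sin ((\<beta> (Suc j) - \<beta> j) / 2))\<^sup>2"
    "half_area (e j) (e (Suc j)) = isosceles_half_area S (S * sin ((\<beta> (Suc j) - \<beta> j) / 2))"
    "arcsin (S * sin ((\<beta> (Suc j) - \<beta> j) / 2) / S) = (\<beta> (Suc j) - \<beta> j) / 2"
    "0 \<le> S * sin ((\<beta> (Suc j) - \<beta> j) / 2)" "S * sin ((\<beta> (Suc j) - \<beta> j) / 2) \<le> S"
    using chord_eq half_eq S sint by (simp_all add: t_def[symmetric])
qed

text \<open>The equality case of \<open>chain_half_area_le\<close>: the half angles add up to
  exactly \<open>pi / 2\<close>, all sides run counterclockwise, and the closing side is a diameter
  without area.\<close>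

lemma chain_facts:
  assumes D: "\<And>j. j < m \<Longrightarrow> chord_sq (e j) (e (Suc j)) = (D j)\<^sup>2" "\<And>j. j < m \<Longrightarrow> 0 \<le> D j"
  shows "\<And>j. j < m \<Longrightarrow> D j \<le> S"
    and "(\<Sum>j<m. arcsin (D j / S)) = pi / 2"
    and "chain_half_area m e = (\<Sum>j<m. isosceles_half_area S (D j))"
proof -
  have D_eq: "D j = S * sin ((\<beta> (Suc j) - \<beta> j) / 2)" if "j < m" for j
    using D[OF that] chord[OF that] by (simp add: power2_eq_iff_nonneg)
  show "D j \<le> S" if "j < m" for j
    using chord(5)[OF that] by (simp add: D_eq that)
  have "(\<Sum>j<m. arcsin (D j / S)) = (\<Sum>j<m. (\<beta> (Suc j) - \<beta> j) / 2)"
    by (rule sum.cong) (simp_all only: lessThan_iff D_eq chord(3))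
  also have "\<dots> = pi / 2"
    using sum_lessThan_telescope[of "\<lambda>j. \<beta> j / 2" m] unfolding diff_divide_distrib by (simp add: \<beta>_ends)
  finally show "(\<Sum>j<m. arcsin (D j / S)) = pi / 2" .
  have "e m = - e 0"
    using e_eq[of m] by (simp add: \<beta>_ends)
  then have "half_area (e m) (e 0) = 0"
    using half_area_opposite[of "e m"] norm_e[of m] rho by simp
  then show "chain_half_area m e = (\<Sum>j<m. isosceles_half_area S (D j))"
    unfolding chain_half_area_def by (simp add: D_eq chord)
qed

end

text \<open>Recovers real angles from signs of orientations alone: positivity against
  \<open>e 0\<close> places each \<open>Arg\<close> in the upper half turn, and positivity of the
  other pairs orders them. The pair \<open>(0, m)\<close> is exempt because antipodal points have
  determinant 0.\<close>

lemma semicircleI: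
  fixes e :: "nat \<Rightarrow> complex"
  assumes \<rho>: "0 < \<rho>" "\<rho> < 1" and m: "0 < m" and ne: "\<And>j. j \<le> m \<Longrightarrow> cmod (e j) = \<rho>" and em: "e m = - e 0"
    and pos: "\<And>i j. i < j \<Longrightarrow> j \<le> m \<Longrightarrow> (i, j) \<noteq> (0, m) \<Longrightarrow> Im (cnj (e i) * e j) > 0"
  obtains \<beta> where "semicircle m e \<beta> \<rho> (2 * \<rho> / (1 - \<rho>\<^sup>2))"
proof -
  define \<beta> where "\<beta> j = Arg (e j / e 0)" for j
  have e0: "e 0 \<noteq> 0"
    using ne[of 0] \<rho> by auto
  have e_eq: "e j = e 0 * cis (\<beta> j)" if "j \<le> m" for j
  proof -
    have "e j / e 0 \<noteq> 0" "cmod (e j / e 0) = 1"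
      using ne[OF that] ne[of 0] \<rho> e0 by (auto simp: norm_divide)
    then have "cis (\<beta> j) = e j / e 0"
      by (simp add: \<beta>_def cis_Arg sgn_eq)
    then show ?thesis using e0 by simp
  qed
  have ends: "\<beta> 0 = 0" "\<beta> m = pi"
    using e0 by (simp_all add: \<beta>_def em Arg_minus)
  have im: "Im (cnj (e i) * e j) = \<rho>\<^sup>2 * sin (\<beta> j - \<beta> i)" if "i \<le> m" "j \<le> m" for i j
  proof -
    have "cnj (e i) * e j = (e 0 * cnj (e 0)) * (cis (\<beta> j) * cis (- \<beta> i))"
      using e_eq[OF that(1)] e_eq[OF that(2)] by (simp add: cis_cnj mult_ac)
    then show ?thesis
      using ne[of 0] by (simp only: cis_mult norm_sq_cnj[symmetric]) simp
  qed
  have range: "0 \<le> \<beta> j \<and> \<beta> j \<le> pi" if "j \<le> m" for j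
  proof (cases "j = 0 \<or> j = m")
    case False
    then have "0 < \<rho>\<^sup>2 * sin (\<beta> j)"
      using pos[of 0 j] im[of 0 j] that ends by simp
    then have "0 < sin (\<beta> j)"
      using \<rho> by (simp add: zero_less_mult_iff)
    moreover have "- pi < \<beta> j" "\<beta> j \<le> pi"
      using Arg_bounded by (auto simp: \<beta>_def)
    moreover have "sin (\<beta> j) \<le> 0" if "\<beta> j \<le> 0"
      using sin_ge_zero[of "- \<beta> j"] that \<open>- pi < \<beta> j\<close> by simp
    ultimately show ?thesis by force
  qed (use ends in auto)
  have mono: "\<beta> i < \<beta> j" if "i < j" "j \<le> m" for i j
  proof (cases "(i, j) = (0, m)")
    case True
    then show ?thesis using ends by simp
  next
    case False
    then have "0 < \<rho>\<^sup>2 * sin (\<beta> j - \<beta> i)"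
      using pos[OF that False] im[of i j] that by simp
    then have s: "0 < sin (\<beta> j - \<beta> i)"
      using \<rho> by (simp add: zero_less_mult_iff)
    show ?thesis
    proof (rule ccontr)
      assume "\<not> ?thesis"
      then have "0 \<le> sin (\<beta> i - \<beta> j)"
        using range[of i] range[of j] that by (intro sin_ge_zero) auto
      then show False
        using s sin_minus[of "\<beta> i - \<beta> j"] by (simp only: minus_diff_eq)
    qed
  qed
  show ?thesis
    by (rule that, unfold_locales) (fact \<rho> refl ne[OF le0] e_eq mono ends)+
qed

lemma orient_polar:
  assumes "y - x = of_real a * cis \<phi>" "z - x = of_real b * cis \<psi>"
  shows "orient x y z = a * b * sin (\<psi> - \<phi>)"
  unfolding orient_def assms by (simp add: sin_diff algebra_simps)

lemma circle_points_norm: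
  fixes e :: complex
  assumes "cmod e < 1" "chord_sq 0 e = (sinh (r / 2))\<^sup>2" "0 < r"
  shows "cmod e = tanh (r / 2)"
proof -
  define T where "T = (sinh (r / 2))\<^sup>2"
  have T: "0 \<le> T" by (simp add: T_def)
  have pos: "0 < 1 - (cmod e)\<^sup>2"
    by (rule one_minus_norm_sq_pos[OF assms(1)])
  have "(cmod e)\<^sup>2 / (1 - (cmod e)\<^sup>2) = T"
    using assms(2) by (simp add: chord_sq_def T_def)
  then have "(cmod e)\<^sup>2 = T * (1 - (cmod e)\<^sup>2)"
    using pos by (simp add: divide_eq_eq)
  then have "(cmod e)\<^sup>2 * (1 + T) = T"
    by (simp add: algebra_simps)
  then have "(cmod e)\<^sup>2 = T / (1 + T)"
    using T by (simp add: eq_divide_eq)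
  also have "\<dots> = (tanh (r / 2))\<^sup>2"
    by (simp add: T_def tanh_def power_divide cosh_square_eq add.commute)
  finally show ?thesis
    using assms(3) by (simp add: power2_eq_iff_nonneg)
qed

lemma opposite_points:
  fixes p q :: complex
  assumes p: "cmod p = \<rho>" and q: "cmod q = \<rho>" and \<rho>: "\<rho> < 1" and S: "S = 2 * \<rho> / (1 - \<rho>\<^sup>2)"
    and chord: "chord_sq p q = S\<^sup>2"
  shows "p = - q"
proof -
  have r: "0 < 1 - \<rho>\<^sup>2" "0 \<le> \<rho>"
    using one_minus_norm_sq_pos[of p] p \<rho> by auto
  have "(cmod (p - q))\<^sup>2 / (1 - \<rho>\<^sup>2)\<^sup>2 = 4 * \<rho>\<^sup>2 / (1 - \<rho>\<^sup>2)\<^sup>2"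
    using chord unfolding chord_sq_def p q S by (simp add: power_divide power_mult_distrib power2_eq_square)
  then have "(cmod (p - q))\<^sup>2 = 4 * \<rho>\<^sup>2"
    using r by simp
  moreover have "(cmod (p - q))\<^sup>2 = \<rho>\<^sup>2 + \<rho>\<^sup>2 - 2 * Re (p * cnj q)"
    "(cmod (p + q))\<^sup>2 = \<rho>\<^sup>2 + \<rho>\<^sup>2 + 2 * Re (p * cnj q)"
    using norm_sq_diff[of p q] norm_sq_diff[of p "- q"] by (simp_all add: p q)
  ultimately have "(cmod (p + q))\<^sup>2 = 0" by linarith
  then show ?thesis by (simp add: eq_neg_iff_add_eq_0)
qed

text \<open>The directions \<open>\<theta>\<close> are Klein directions at \<open>c\<close>, so
  their values do not survive the Moebius map that centres the circle, but orientation signs do. The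
  final side is a diameter, so its ends are collinear with \<open>c\<close> and span an angle
  \<open>pi\<close> at \<open>c\<close>. All other pairs then span an angle strictly between 0 and
  \<open>pi\<close>, hence have positive orientation, and this sign is what reaches
  \<open>semicircleI\<close>.\<close>

lemma semicyclic_chain:
  fixes y :: "nat \<Rightarrow> complex" and m :: nat
  assumes cyc: "cyclic_polygon xs c r" and k: "k < length xs" and diam: "side_length xs k = 2 * r"
    and y_def: "y = (\<lambda>j. cyclic_nth xs (Suc k + j))" and m_def: "m = length xs - 1"
  obtains e \<beta> \<rho> where "semicircle m e \<beta> \<rho> (2 * \<rho> / (1 - \<rho>\<^sup>2))"
    "\<And>j. j \<le> m \<Longrightarrow> cmod (poincare (y j)) < 1"
    "cmod (poincare c) < 1" "e = (\<lambda>j. moebius (poincare c) (poincare (y j)))"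
proof -
  let ?n = "length xs"
  have n: "3 \<le> ?n" and c: "cmod c < 1" and r: "0 < r"
    and on_circle: "\<And>x. x \<in> set xs \<Longrightarrow> cmod x < 1 \<and> hyp_dist c x = r"
    using cyc by (auto simp: cyclic_polygon_def klein_disc_def)
  obtain \<theta> :: "nat \<Rightarrow> real" where
    \<theta>: "\<And>i. i < ?n \<Longrightarrow> xs ! i - c = of_real (cmod (xs ! i - c)) * cis (\<theta> i)"
    "\<And>i j. i < j \<Longrightarrow> j < ?n \<Longrightarrow> \<theta> i < \<theta> j \<and> \<theta> j < \<theta> i + 2 * pi"
    using cyc unfolding cyclic_polygon_def by metis
  have nn: "?n = Suc m" "0 < m"
    using n by (auto simp: m_def)
  \<comment> \<open>Vertices are counted from the one after the final side. Passing the end of the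
    list adds a full turn, which keeps the directions increasing.\<close>
  define \<psi> where "\<psi> j = (if Suc k + j < ?n then \<theta> (Suc k + j) else \<theta> (Suc k + j - ?n) + 2 * pi)" for j
  have y_nth: "y j = xs ! (if Suc k + j < ?n then Suc k + j else Suc k + j - ?n)" if "j \<le> m" for j
    using that k nn(1) by (auto simp: y_def cyclic_nth_def mod_if)
  have y_polar: "y j - c = of_real (cmod (y j - c)) * cis (\<psi> j)" if "j \<le> m" for j
  proof (cases "Suc k + j < ?n")
    case True
    then show ?thesis using \<theta>(1)[OF True] by (simp only: y_nth[OF that] \<psi>_def if_True)
  next
    case False
    then have "Suc k + j - ?n < ?n" using that k nn by linarith
    moreover have "cis (\<theta> i + 2 * pi) = cis (\<theta> i)" for i
      by (simp add: complex_eq_iff)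
    ultimately show ?thesis using \<theta>(1) False by (simp only: y_nth[OF that] \<psi>_def if_False)
  qed
  have \<psi>_mono: "\<psi> i < \<psi> j \<and> \<psi> j < \<psi> i + 2 * pi" if ij: "i < j" "j \<le> m" for i j
  proof -
    consider "Suc k + j < ?n" | "Suc k + i < ?n" "\<not> Suc k + j < ?n" | "\<not> Suc k + i < ?n"
      using ij by linarith
    then show ?thesis
    proof cases
      case 1
      then show ?thesis using \<theta>(2)[of "Suc k + i" "Suc k + j"] ij by (simp add: \<psi>_def)
    next
      case 2
      then have "Suc k + j - ?n < Suc k + i" using ij nn by linarith
      then show ?thesis
        using \<theta>(2)[of "Suc k + j - ?n" "Suc k + i"] 2 unfolding \<psi>_def by simp
    next
      case 3
      then have "Suc k + i - ?n < Suc k + j - ?n" "Suc k + j - ?n < ?n" using ij k nn by linarith+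
      then show ?thesis
        using \<theta>(2)[of "Suc k + i - ?n" "Suc k + j - ?n"] 3 ij unfolding \<psi>_def by simp
    qed
  qed
  have y_set: "y j \<in> set xs" for j
    unfolding y_def using n by (intro cyclic_nth_in_set) auto
  have y1: "cmod (y j) < 1" and y_dist: "hyp_dist c (y j) = r" for j
    using on_circle[OF y_set] by auto
  define C where "C = poincare c"
  define p where "p j = poincare (y j)" for j
  define e where "e j = moebius C (p j)" for j
  have C1: "cmod C < 1" and p1: "cmod (p j) < 1" and e1: "cmod (e j) < 1" for j
    using norm_poincare_less[OF c] norm_poincare_less[OF y1] by (auto simp: C_def p_def e_def norm_moebius_less)
  have chord_e: "chord_sq (e i) (e j) = (sinh (hyp_dist (y i) (y j) / 2))\<^sup>2" for i j
    unfolding e_def chord_sq_moebius[OF C1 p1 p1] unfolding p_def by (rule hyp_dist_chord(2)[OF y1 y1])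
  define \<rho> where "\<rho> = tanh (r / 2)"
  have \<rho>: "0 < \<rho>" "\<rho> < 1"
    using r by (simp_all add: \<rho>_def tanh_real_lt_1)
  have norm_e: "cmod (e j) = \<rho>" for j
    unfolding \<rho>_def
  proof (rule circle_points_norm[OF e1 _ r])
    have "chord_sq (moebius C C) (moebius C (p j)) = chord_sq C (p j)"
      by (rule chord_sq_moebius[OF C1 C1 p1])
    then show "chord_sq 0 (e j) = (sinh (r / 2))\<^sup>2"
      using hyp_dist_chord(2)[OF c y1[of j]] by (simp add: e_def C_def p_def y_dist)
  qed
  have ym: "y m = xs ! k" "y 0 = xs ! (Suc k mod ?n)"
  proof -
    have "Suc k + m = k + ?n" using nn by simp
    then show "y m = xs ! k"
      using k by (simp only: y_def cyclic_nth_def mod_add_self2 mod_less)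
  qed (simp add: y_def cyclic_nth_def)
  have em: "e m = - e 0"
  proof (rule opposite_points[OF norm_e norm_e \<rho>(2) refl])
    have "chord_sq (e m) (e 0) = (sinh r)\<^sup>2"
      using chord_e[of m 0] diam by (simp add: ym side_length_def)
    also have "sinh r = 2 * sinh (r / 2) * cosh (r / 2)"
      using sinh_double[of "r / 2"] by simp
    also have "\<dots> = 2 * \<rho> / (1 - \<rho>\<^sup>2)"
    proof -
      have "1 - \<rho>\<^sup>2 = ((cosh (r / 2))\<^sup>2 - (sinh (r / 2))\<^sup>2) / (cosh (r / 2))\<^sup>2"
        by (simp add: \<rho>_def tanh_def power_divide diff_divide_distrib)
      then have "1 - \<rho>\<^sup>2 = 1 / (cosh (r / 2))\<^sup>2"
        by (simp only: hyperbolic_pythagoras)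
      then show ?thesis
        by (simp add: \<rho>_def tanh_def power2_eq_square)
    qed
    finally show "chord_sq (e m) (e 0) = (2 * \<rho> / (1 - \<rho>\<^sup>2))\<^sup>2" .
  qed
  have ne: "0 < cmod (y j - c)" for j
  proof -
    have "y j \<noteq> c"
    proof
      assume "y j = c"
      then have "e j = 0" by (simp add: e_def p_def C_def)
      then show False using norm_e[of j] \<rho> by simp
    qed
    then show ?thesis by simp
  qed
  have cross: "orient_disc (moebius C C) (e i) (e j) = Im (cnj (e i) * e j)" for i j
    by (simp add: orient_disc_def)
  have o_pos: "orient c (y i) (y j) > 0 \<longleftrightarrow> Im (cnj (e i) * e j) > 0"
    and o_zero: "orient c (y i) (y j) = 0 \<longleftrightarrow> Im (cnj (e i) * e j) = 0" for i j
    using orient_disc_moebius_pos_iff[OF C1 C1 p1 p1, of i j] orient_pos_iff[OF c y1 y1, of i j]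
    unfolding C_def[symmetric] p_def[symmetric] e_def[symmetric] cross by simp_all
  have o_sin: "orient c (y i) (y j) = cmod (y i - c) * cmod (y j - c) * sin (\<psi> j - \<psi> i)" if "i \<le> m" "j \<le> m" for i j
    by (rule orient_polar[OF y_polar[OF that(1)] y_polar[OF that(2)]])
  have "Im (cnj (e 0) * e m) = 0"
    unfolding em by simp
  then have "sin (\<psi> m - \<psi> 0) = 0"
    using o_zero[of 0 m] o_sin[of 0 m] ne[of 0] ne[of m] by (metis le0 le_refl mult_eq_0_iff less_irrefl)
  moreover have "0 < \<psi> m - \<psi> 0" "\<psi> m - \<psi> 0 < 2 * pi"
    using \<psi>_mono[of 0 m] nn by auto
  ultimately have \<psi>m: "\<psi> m - \<psi> 0 = pi"
    using sin_gt_zero[of "\<psi> m - \<psi> 0"] sin_lt_zero[of "\<psi> m - \<psi> 0"] by force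
  have pos: "Im (cnj (e i) * e j) > 0" if ij: "i < j" "j \<le> m" "(i, j) \<noteq> (0, m)" for i j
  proof -
    have "\<psi> 0 \<le> \<psi> i" "\<psi> j \<le> \<psi> m" "\<psi> i < \<psi> j"
      using \<psi>_mono[of 0 i] \<psi>_mono[of j m] \<psi>_mono[of i j] ij by (cases "i = 0"; cases "j = m"; force)+
    moreover have "\<psi> 0 < \<psi> i \<or> \<psi> j < \<psi> m"
      using \<psi>_mono[of 0 i] \<psi>_mono[of j m] ij by (cases "i = 0") auto
    ultimately have "0 < sin (\<psi> j - \<psi> i)"
      using \<psi>m by (intro sin_gt_zero) linarith+
    then have "orient c (y i) (y j) > 0"
      using o_sin[of i j] ij ne by simp
    then show ?thesis using o_pos by blast
  qed
  obtain \<beta> where "semicircle m e \<beta> \<rho> (2 * \<rho> / (1 - \<rho>\<^sup>2))"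
    by (rule semicircleI[OF \<rho> nn(2) norm_e em pos])
  then show ?thesis
    by (rule that) (use p1 C1 in \<open>auto simp: p_def C_def e_def\<close>)
qed

section \<open>Comparison and existence\<close>

lemma side_length_cyclic_nth:
  "i < length xs \<Longrightarrow> side_length xs i = hyp_dist (cyclic_nth xs i) (cyclic_nth xs (Suc i))"
  by (simp add: side_length_def cyclic_nth_def)

lemma cyclic_nth_rotate: "xs \<noteq> [] \<Longrightarrow> cyclic_nth (rotate k xs) i = cyclic_nth xs (k + i)"
  by (simp add: cyclic_nth_def nth_rotate mod_add_right_eq)

lemma cyclic_nth_mod: "cyclic_nth xs (i mod length xs) = cyclic_nth xs i"
  "cyclic_nth xs (Suc (i mod length xs)) = cyclic_nth xs (Suc i)"
  by (simp_all add: cyclic_nth_def mod_Suc_eq)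

lemma bij_betw_rotate_index:
  fixes n k :: nat
  assumes "k < n"
  shows "bij_betw (\<lambda>j. (Suc k + j) mod n) {..<n - 1} ({..<n} - {k})"
proof (rule bij_betw_byWitness[where f' = "\<lambda>i. if k < i then i - Suc k else i + n - Suc k"])
  have mod: "Suc (k + j) mod n = (if Suc k + j < n then Suc k + j else Suc k + j - n)" if "j < n - 1" for j
    using assms that by (auto simp: mod_if)
  show "\<forall>j\<in>{..<n - 1}. (if k < (Suc k + j) mod n then (Suc k + j) mod n - Suc k else (Suc k + j) mod n + n - Suc k) = j"
    using assms by (auto simp: mod)
  show "(\<lambda>j. (Suc k + j) mod n) ` {..<n - 1} \<subseteq> {..<n} - {k}"
    using assms by (auto simp: mod)
  show "\<forall>i\<in>{..<n} - {k}. (Suc k + (if k < i then i - Suc k else i + n - Suc k)) mod n = i"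
    using assms by auto
  show "(\<lambda>i. if k < i then i - Suc k else i + n - Suc k) ` ({..<n} - {k}) \<subseteq> {..<n - 1}"
    using assms by auto
qed

lemma sum_rotate_index:
  fixes f :: "nat \<Rightarrow> real"
  assumes k: "k < n" and per: "\<And>i. f (i mod n) = f i"
  shows "(\<Sum>i<n. f i) = (\<Sum>j<n - 1. f (Suc k + j)) + f k"
proof -
  have "(\<Sum>j<n - 1. f (Suc k + j)) = (\<Sum>j<n - 1. f ((Suc k + j) mod n))"
    by (simp only: per)
  also have "\<dots> = (\<Sum>i\<in>{..<n} - {k}. f i)"
    by (rule sum.reindex_bij_betw[OF bij_betw_rotate_index[OF k]])
  finally show ?thesis
    using k sum.remove[of "{..<n}" k f] by simp
qed

lemma sides_except_rotate:
  assumes sides: "sides_except xs k d"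
  shows "sides_except (rotate (Suc k) xs) (length xs - 1) d"
proof -
  let ?n = "length xs" and ?\<tau> = "\<lambda>j. (Suc k + j) mod length xs" and ?ys = "rotate (Suc k) xs"
  obtain \<sigma> where k: "k < ?n" and \<sigma>: "bij_betw \<sigma> {1..?n - 1} ({..<?n} - {k})"
    "\<And>i. i \<in> {1..?n - 1} \<Longrightarrow> side_length xs (\<sigma> i) = d i"
    using sides by (auto simp: sides_except_def)
  have ne: "xs \<noteq> []" using k by auto
  note \<tau> = bij_betw_rotate_index[OF k]
  define \<sigma>' where "\<sigma>' = inv_into {..<?n - 1} ?\<tau> \<circ> \<sigma>"
  have bij: "bij_betw \<sigma>' {1..?n - 1} {..<?n - 1}"
    unfolding \<sigma>'_def by (rule bij_betw_trans[OF \<sigma>(1) bij_betw_inv_into[OF \<tau>]])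
  have "side_length ?ys (\<sigma>' i) = d i" if i: "i \<in> {1..?n - 1}" for i
  proof -
    have "\<sigma> i \<in> {..<?n} - {k}"
      using bij_betwE[OF \<sigma>(1)] i by blast
    then have \<tau>\<sigma>: "?\<tau> (\<sigma>' i) = \<sigma> i"
      unfolding \<sigma>'_def using bij_betw_inv_into_right[OF \<tau>] by simp
    have "\<sigma>' i < length ?ys"
      using bij_betwE[OF bij] i by fastforce
    then have "side_length ?ys (\<sigma>' i) = hyp_dist (cyclic_nth xs (Suc k + \<sigma>' i)) (cyclic_nth xs (Suc (Suc k + \<sigma>' i)))"
      by (simp only: side_length_cyclic_nth cyclic_nth_rotate[OF ne] add_Suc_right)
    also have "\<dots> = hyp_dist (cyclic_nth xs (?\<tau> (\<sigma>' i))) (cyclic_nth xs (Suc (?\<tau> (\<sigma>' i))))"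
      by (simp only: cyclic_nth_mod)
    also have "\<dots> = side_length xs (\<sigma> i)"
      using \<open>\<sigma> i \<in> {..<?n} - {k}\<close> by (simp only: \<tau>\<sigma>) (simp add: side_length_cyclic_nth)
    finally show ?thesis using \<sigma>(2)[OF i] by simp
  qed
  moreover have "{..<?n} - {?n - 1} = {..<?n - 1}"
    using k by auto
  ultimately show ?thesis
    unfolding sides_except_def using bij k by auto
qed

text \<open>Equality of sums for every \<open>g\<close> expresses that the two families of lengths
  agree as multisets, whatever the permutation; it is applied to angles, to areas and to an
  indicator of too long sides.\<close>

lemma sides_except_last:
  assumes sides: "sides_except ys (length ys - 1) d" and m: "m = length ys - 1"
  shows "(\<Sum>j<m. g (hyp_dist (cyclic_nth ys j) (cyclic_nth ys (Suc j)))) = (\<Sum>i\<in>{1..m}. g (d i))"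
    and "j < m \<Longrightarrow> hyp_dist (cyclic_nth ys j) (cyclic_nth ys (Suc j)) \<in> d ` {1..m}"
proof -
  have eq: "{..<length ys} - {m} = {..<m}"
    by (auto simp: m)
  obtain \<sigma> where \<sigma>: "bij_betw \<sigma> {1..m} {..<m}"
    "\<And>i. i \<in> {1..m} \<Longrightarrow> side_length ys (\<sigma> i) = d i"
    using sides unfolding sides_except_def m[symmetric] eq by auto
  have side: "side_length ys j = hyp_dist (cyclic_nth ys j) (cyclic_nth ys (Suc j))" if "j < m" for j
    using that m by (intro side_length_cyclic_nth) auto
  have "(\<Sum>j<m. g (hyp_dist (cyclic_nth ys j) (cyclic_nth ys (Suc j)))) = (\<Sum>j<m. g (side_length ys j))"
    by (simp add: side)
  also have "\<dots> = (\<Sum>i\<in>{1..m}. g (side_length ys (\<sigma> i)))"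
    by (rule sum.reindex_bij_betw[OF \<sigma>(1), symmetric])
  finally show "(\<Sum>j<m. g (hyp_dist (cyclic_nth ys j) (cyclic_nth ys (Suc j)))) = (\<Sum>i\<in>{1..m}. g (d i))"
    by (simp add: \<sigma>(2))
  show "hyp_dist (cyclic_nth ys j) (cyclic_nth ys (Suc j)) \<in> d ` {1..m}" if j: "j < m"
  proof -
    obtain i where "i \<in> {1..m}" "\<sigma> i = j"
      using \<sigma>(1) j unfolding bij_betw_def by (metis imageE lessThan_iff)
    then show ?thesis
      using \<sigma>(2) side[OF j] by (metis imageI)
  qed
qed

lemma cyclic_sum_half_area:
  fixes p :: "nat \<Rightarrow> complex"
  assumes k: "k < length xs" and p: "p = (\<lambda>j. poincare (cyclic_nth xs (Suc k + j)))" and m: "m = length xs - 1"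
  shows "(\<Sum>i<length xs. half_area (poincare (cyclic_nth xs i)) (poincare (cyclic_nth xs (Suc i)))) = chain_half_area m p"
proof -
  let ?f = "\<lambda>i. half_area (poincare (cyclic_nth xs i)) (poincare (cyclic_nth xs (Suc i)))"
  have "(\<Sum>i<length xs. ?f i) = (\<Sum>j<m. ?f (Suc k + j)) + ?f k"
    unfolding m by (rule sum_rotate_index[OF k]) (simp only: cyclic_nth_mod)
  moreover have "p m = poincare (cyclic_nth xs k)" "p 0 = poincare (cyclic_nth xs (Suc k))"
  proof -
    have "Suc k + m = k + length xs" using k m by simp
    then show "p m = poincare (cyclic_nth xs k)"
      by (simp only: p cyclic_nth_def mod_add_self2)
  qed (simp add: p)
  ultimately show ?thesis
    by (simp add: chain_half_area_def p)
qed

section \<open>The area bound and its equality case\<close>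

lemma chord_sq_cnj: "chord_sq (cnj p) (cnj q) = chord_sq p q"
  by (simp add: chord_sq_def flip: complex_cnj_diff)

lemma chain_half_area_cnj:
  assumes "\<And>i. i \<le> m \<Longrightarrow> cmod (p i) < 1"
  shows "chain_half_area m (\<lambda>i. cnj (p i)) = - chain_half_area m p"
  using assms by (simp add: chain_half_area_def half_area_cnj sum_negf)

text \<open>Translates a polygon into a chain in the Poincare disc that starts behind the final
  side, so that the closing side of the chain is the side of free length. Absolute values appear
  since the orientation of the boundary is unknown.\<close>

lemma hyp_polygon_chain:
  assumes poly: "hyp_polygon xs" and sides: "sides_except xs k d" and m: "m = length xs - 1"
    and p_def: "p = (\<lambda>j. poincare (cyclic_nth xs (Suc k + j)))"
    and D_def: "D = (\<lambda>j. sinh (hyp_dist (cyclic_nth xs (Suc k + j)) (cyclic_nth xs (Suc (Suc k + j))) / 2))"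
  shows "cmod (p j) < 1"
    and "chord_sq (p j) (p (Suc j)) = (D j)\<^sup>2"
    and "\<bar>hyp_area (polygon_region xs)\<bar> = 2 * \<bar>chain_half_area m p\<bar>"
    and "(\<Sum>j<m. g (D j)) = (\<Sum>i\<in>{1..m}. g (sinh (d i / 2)))"
    and "j < m \<Longrightarrow> D j \<in> (\<lambda>i. sinh (d i / 2)) ` {1..m}"
proof -
  have k: "k < length xs"
    using sides by (simp add: sides_except_def)
  then have ne: "xs \<noteq> []" by auto
  have x: "cmod (cyclic_nth xs i) < 1" for i
    using poly cyclic_nth_in_set[OF ne, of i] by (auto simp: hyp_polygon_def klein_disc_def)
  show "cmod (p j) < 1"
    unfolding p_def by (rule norm_poincare_less[OF x])
  show "chord_sq (p j) (p (Suc j)) = (D j)\<^sup>2"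
    unfolding p_def D_def using hyp_dist_chord(2)[OF x x] by simp
  show "\<bar>hyp_area (polygon_region xs)\<bar> = 2 * \<bar>chain_half_area m p\<bar>"
    by (rule hyp_area_polygon_region[OF poly]) (simp add: cyclic_sum_half_area[OF k p_def m] abs_mult)
  let ?ys = "rotate (Suc k) xs"
  have ys: "sides_except ?ys (length ?ys - 1) d" "m = length ?ys - 1"
    using sides_except_rotate[OF sides] m by simp_all
  have D_eq: "D j = sinh (hyp_dist (cyclic_nth ?ys j) (cyclic_nth ?ys (Suc j)) / 2)" for j
    unfolding D_def by (simp only: cyclic_nth_rotate[OF ne] add_Suc_right)
  show "(\<Sum>j<m. g (D j)) = (\<Sum>i\<in>{1..m}. g (sinh (d i / 2)))"
    unfolding D_eq using sides_except_last(1)[OF ys, of "\<lambda>l. g (sinh (l / 2))"] .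
  show "j < m \<Longrightarrow> D j \<in> (\<lambda>i. sinh (d i / 2)) ` {1..m}"
    unfolding D_eq using sides_except_last(2)[OF ys, of j] by auto
qed

text \<open>Reflection preserves all chords and reverses the signed area, so the chain bound applied
  to \<open>p\<close> and to its conjugate bounds the absolute value.\<close>

theorem hyp_area_polygon_le:
  assumes poly: "hyp_polygon xs" and sides: "sides_except xs k d" and m: "m = length xs - 1"
    and d: "\<And>i. i \<in> {1..m} \<Longrightarrow> 0 < d i"
    and S: "\<And>i. i \<in> {1..m} \<Longrightarrow> sinh (d i / 2) \<le> S" "(\<Sum>i\<in>{1..m}. arcsin (sinh (d i / 2) / S)) \<le> pi / 2"
  shows "hyp_area (polygon_region xs) \<le> 2 * (\<Sum>i\<in>{1..m}. isosceles_half_area S (sinh (d i / 2)))"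
proof -
  define p where "p = (\<lambda>j. poincare (cyclic_nth xs (Suc k + j)))"
  define D where "D = (\<lambda>j. sinh (hyp_dist (cyclic_nth xs (Suc k + j)) (cyclic_nth xs (Suc (Suc k + j))) / 2))"
  note facts = hyp_polygon_chain[OF poly sides m p_def D_def]
  have m0: "0 < m"
    using poly m by (simp add: hyp_polygon_def)
  have D: "0 < D j" "D j \<le> S" if "j < m" for j
    using facts(5)[OF that] d S(1) by (auto simp: image_iff)
  have bound: "chain_half_area m q \<le> (\<Sum>j<m. isosceles_half_area S (D j))"
    if "\<And>i. cmod (q i) < 1" "\<And>i. chord_sq (q i) (q (Suc i)) = (D i)\<^sup>2" for q
    using facts(4)[of "\<lambda>x. arcsin (x / S)"] S(2) D that
    by (intro chain_half_area_le[OF m0]) auto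
  have "chain_half_area m p \<le> (\<Sum>j<m. isosceles_half_area S (D j))"
    by (rule bound) (fact facts)+
  moreover have "chain_half_area m (\<lambda>i. cnj (p i)) \<le> (\<Sum>j<m. isosceles_half_area S (D j))"
    by (rule bound) (simp_all add: facts chord_sq_cnj)
  moreover have "chain_half_area m (\<lambda>i. cnj (p i)) = - chain_half_area m p"
    using facts(1) by (rule chain_half_area_cnj)
  ultimately have "\<bar>chain_half_area m p\<bar> \<le> (\<Sum>j<m. isosceles_half_area S (D j))"
    by linarith
  then show ?thesis
    using facts(3) facts(4)[of "isosceles_half_area S"] by linarith
qed

text \<open>The \<open>S\<close> obtained is \<open>sinh\<close> of the circumradius. It is returned
  with exactly the two conditions under which \<open>hyp_area_polygon_le\<close> bounds every
  competitor by the same sum.\<close>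

theorem semicyclic_polygon_area:
  assumes cyc: "cyclic_polygon xs c r" and sides: "sides_except xs k d" and diam: "side_length xs k = 2 * r"
    and m: "m = length xs - 1" and d: "\<And>i. i \<in> {1..m} \<Longrightarrow> 0 < d i"
  obtains S ys where "hyp_polygon ys" "length ys = length xs" "sides_except ys m d"
    "convex hull (set xs) = polygon_region ys"
    "\<And>i. i \<in> {1..m} \<Longrightarrow> sinh (d i / 2) \<le> S" "(\<Sum>i\<in>{1..m}. arcsin (sinh (d i / 2) / S)) \<le> pi / 2"
    "hyp_area (convex hull (set xs)) = 2 * (\<Sum>i\<in>{1..m}. isosceles_half_area S (sinh (d i / 2)))"
proof -
  have n: "3 \<le> length xs" and disc: "set xs \<subseteq> klein_disc"
    using cyc by (auto simp: cyclic_polygon_def)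
  have k: "k < length xs"
    using sides by (simp add: sides_except_def)
  have ne: "xs \<noteq> []" using n by auto
  define ys where "ys = rotate (Suc k) xs"
  have ys: "length ys = length xs" "set ys = set xs" "ys \<noteq> []"
    using ne by (simp_all add: ys_def)
  have sides_ys: "sides_except ys m d"
    unfolding ys_def m by (rule sides_except_rotate[OF sides])
  define y where "y = (\<lambda>j. cyclic_nth xs (Suc k + j))"
  have y_ys: "y j = cyclic_nth ys j" for j
    unfolding y_def ys_def by (rule cyclic_nth_rotate[OF ne, symmetric])
  obtain e \<beta> \<rho> where semi: "semicircle m e \<beta> \<rho> (2 * \<rho> / (1 - \<rho>\<^sup>2))"
    and p1: "\<And>j. j \<le> m \<Longrightarrow> cmod (poincare (y j)) < 1" and C1: "cmod (poincare c) < 1"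
    and e_def: "e = (\<lambda>j. moebius (poincare c) (poincare (y j)))"
    by (rule semicyclic_chain[OF cyc k diam y_def m]) (rule that; blast)
  define S where "S = 2 * \<rho> / (1 - \<rho>\<^sup>2)"
  interpret semicircle m e \<beta> \<rho> S
    using semi by (simp add: S_def)
  have y1: "cmod (y j) < 1" for j
    using disc ys cyclic_nth_in_set[OF ys(3), of j] by (auto simp: y_ys klein_disc_def)
  have convex: "convex_position ys"
    unfolding convex_position_def
  proof (intro allI impI)
    fix i j l assume ijl: "i < j" "j < l" "l < length ys"
    then have le: "i \<le> m" "j \<le> m" "l \<le> m"
      using m ys by auto
    have "orient_disc (e i) (e j) (e l) > 0"
      using ijl le by (intro orient_disc_pos) auto
    then have "orient (y i) (y j) (y l) > 0"
      unfolding e_def using orient_disc_moebius_pos_iff(1)[OF C1 p1 p1 p1, OF le] orient_pos_iff(1)[OF y1 y1 y1] by simp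
    then show "orient (ys ! i) (ys ! j) (ys ! l) > 0"
      using ijl by (simp add: y_ys cyclic_nth_simps)
  qed
  have poly: "hyp_polygon ys"
    using convex n disc ys by (intro hyp_polygon_convex_position) simp_all
  have region: "convex hull (set xs) = polygon_region ys"
    using polygon_region_convex_position[OF convex] n ys by simp
  \<comment> \<open>After the rotation the final side has index \<open>m\<close>, so the offset
    \<open>Suc m\<close> is a full turn and \<open>p j\<close> is simply
    \<open>poincare (y j)\<close>.\<close>
  define p where "p = (\<lambda>j. poincare (cyclic_nth ys (Suc m + j)))"
  define D where "D = (\<lambda>j. sinh (hyp_dist (cyclic_nth ys (Suc m + j)) (cyclic_nth ys (Suc (Suc m + j))) / 2))"
  have m_ys: "m = length ys - 1" and m0: "0 < m"
    using m ys n by auto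
  note facts = hyp_polygon_chain[OF poly sides_ys m_ys p_def D_def]
  have p_eq: "p j = poincare (y j)" for j
  proof -
    have "Suc m + j = j + length ys" using m_ys m0 by simp
    then show ?thesis by (simp only: p_def y_ys cyclic_nth_def mod_add_self2)
  qed
  have D: "0 < D j" if "j < m" for j
    using facts(5)[OF that] d by (auto simp: image_iff)
  have chord: "chord_sq (e j) (e (Suc j)) = (D j)\<^sup>2" if "j < m" for j
    using facts(2)[of j] chord_sq_moebius[OF C1 p1 p1, of j "Suc j"] that by (simp add: e_def p_eq)
  note chain = chain_facts[OF chord less_imp_le[OF D]]
  have chain_eq: "chain_half_area m p = (\<Sum>j<m. isosceles_half_area S (D j))"
    using chain(3) chain_half_area_moebius[OF C1, of m p] facts(1) by (simp add: e_def p_eq)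
  have "0 \<le> (\<Sum>j<m. isosceles_half_area S (D j))"
    using D chain(1) by (intro sum_nonneg isosceles_half_area_nonneg) (auto intro: less_imp_le)
  \<comment> \<open>Both sides are nonnegative, so the equation between absolute values holds
    without them.\<close>
  moreover have "0 \<le> hyp_area (polygon_region ys)"
    unfolding hyp_area_def set_lebesgue_integral_def by (intro Bochner_Integration.integral_nonneg) simp
  ultimately have area: "hyp_area (polygon_region ys) = 2 * (\<Sum>i\<in>{1..m}. isosceles_half_area S (sinh (d i / 2)))"
    using facts(3) chain_eq facts(4)[of "isosceles_half_area S"] by linarith
  have S_sides: "sinh (d i / 2) \<le> S" if i: "i \<in> {1..m}" for i
  proof -
    \<comment> \<open>Counting the sides that exceed \<open>S\<close> transfers the bound from the
      chain order to the given indexing by \<open>d\<close>.\<close>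
    have "(\<Sum>j<m. if D j \<le> S then 0 else 1 :: real) = (\<Sum>i\<in>{1..m}. if sinh (d i / 2) \<le> S then 0 else 1)"
      by (rule facts(4))
    then have "(\<Sum>i\<in>{1..m}. if sinh (d i / 2) \<le> S then 0 else 1 :: real) = 0"
      using chain(1) by simp
    then show ?thesis
      using i by (subst (asm) sum_nonneg_eq_0_iff) (auto split: if_splits)
  qed
  show ?thesis
  proof (rule that)
    show "(\<Sum>i\<in>{1..m}. arcsin (sinh (d i / 2) / S)) \<le> pi / 2"
      using facts(4)[of "\<lambda>x. arcsin (x / S)"] chain(2) by simp
    show "hyp_area (convex hull (set xs)) = 2 * (\<Sum>i\<in>{1..m}. isosceles_half_area S (sinh (d i / 2)))"
      using area region by simp
  qed (fact poly ys(1) sides_ys region S_sides)+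
qed

text \<open>Intermediate value theorem for the sum of the half angles. At the largest
  \<open>D i\<close> that side alone has half angle \<open>pi / 2\<close>. At the sum of all
  \<open>D i\<close>, Jordan's inequality \<open>2 x / pi \<le> sin x\<close> bounds each half angle
  by \<open>pi / 2\<close> times its share, so the total is at most \<open>pi / 2\<close>. With a
  second side present no single half angle can reach \<open>pi / 2\<close>, hence
  \<open>D i < S\<close>.\<close>

lemma circumradius_exists:
  fixes D :: "nat \<Rightarrow> real"
  assumes m: "2 \<le> m" and D: "\<And>i. i < m \<Longrightarrow> 0 < D i"
  obtains S where "\<And>i. i < m \<Longrightarrow> D i < S" "(\<Sum>i<m. arcsin (D i / S)) = pi / 2"
proof -
  define M where "M = Max (D ` {..<m})"
  define f where "f S = (\<Sum>i<m. arcsin (D i / S))" for S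
  have le_M: "D i \<le> M" if "i < m" for i
    using that by (simp add: M_def)
  have "M \<in> D ` {..<m}"
    unfolding M_def using m by (intro Max_in) (auto simp: lessThan_empty_iff)
  then obtain a where a: "a < m" "M = D a" by auto
  have M: "0 < M" using D[OF a(1)] a(2) by simp
  have D_sum: "D i \<le> (\<Sum>i<m. D i)" if "i < m" for i
    using that D by (intro member_le_sum) (auto intro: less_imp_le)
  have ratio: "0 < D i / S \<and> D i / S \<le> 1" if "i < m" "M \<le> S" for i S
    using D[OF that(1)] le_M[OF that(1)] that(2) M by simp
  have pos: "0 < arcsin (D i / S)" if "i < m" "M \<le> S" for i S
    using ratio[OF that] arcsin_less_arcsin[of 0 "D i / S"] by simp
  have strict: "arcsin (D j / S) < f S" if j: "j < m" and S: "M \<le> S" for j S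
  proof -
    obtain b where b: "b < m" "b \<noteq> j"
      using m by (metis One_nat_def Suc_1 Suc_le_eq less_trans nat_neq_iff zero_less_Suc less_one)
    have "arcsin (D j / S) < arcsin (D j / S) + arcsin (D b / S)"
      using pos[OF b(1) S] by simp
    also have "\<dots> = (\<Sum>i\<in>{j, b}. arcsin (D i / S))"
      using b by simp
    also have "\<dots> \<le> f S"
      unfolding f_def using j b pos[OF _ S] by (intro sum_mono2) (auto intro: less_imp_le)
    finally show ?thesis .
  qed
  have "\<exists>S\<ge>M. S \<le> (\<Sum>i<m. D i) \<and> f S = pi / 2"
  proof (rule IVT2')
    show "pi / 2 \<le> f M"
      using strict[OF a(1), of M] M by (simp add: a(2))
    have "f (\<Sum>i<m. D i) \<le> (\<Sum>i<m. pi / 2 * (D i / (\<Sum>i<m. D i)))"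
      unfolding f_def
    proof (rule sum_mono)
      fix i assume "i \<in> {..<m}"
      then have r: "0 < D i / (\<Sum>i<m. D i)" "D i / (\<Sum>i<m. D i) \<le> 1"
        using ratio[of i "\<Sum>i<m. D i"] D_sum[OF a(1)] a(2) by auto
      define x where "x = arcsin (D i / (\<Sum>i<m. D i))"
      have x: "sin x = D i / (\<Sum>i<m. D i)" "0 \<le> x" "x \<le> pi / 2"
        using r arcsin_le_arcsin[of 0 "D i / (\<Sum>i<m. D i)"] arcsin_ubound[of "D i / (\<Sum>i<m. D i)"]
        by (simp_all add: x_def)
      have "2 / pi * x \<le> sin x"
      proof (cases "x = 0")
        case False
        define u where "u = 2 / pi * x"
        have u: "0 \<le> u" "u \<le> 1"
          using x by (auto simp: u_def field_simps)
        have "concave_on {0..pi} sin"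
        proof (rule f''_le0_imp_concave)
          show "(sin has_real_derivative cos t) (at t)" if "t \<in> {0..pi}" for t
            by (rule DERIV_sin)
          show "(cos has_real_derivative - sin t) (at t)" if "t \<in> {0..pi}" for t
            by (rule DERIV_cos)
          show "- sin t \<le> 0" if "t \<in> {0..pi}" for t
            using that by (simp add: sin_ge_zero)
        qed simp
        then have "(1 - u) * sin 0 + u * sin (pi / 2) \<le> sin ((1 - u) *\<^sub>R 0 + u *\<^sub>R (pi / 2))"
          using u by (intro concave_onD) auto
        then show ?thesis
          by (simp add: u_def)
      qed simp
      then show "arcsin (D i / (\<Sum>i<m. D i)) \<le> pi / 2 * (D i / (\<Sum>i<m. D i))"
        unfolding x(1) unfolding x_def by (simp add: field_simps)
    qed
    also have "\<dots> = pi / 2"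
    proof -
      have "(\<Sum>i<m. D i) \<noteq> 0"
        using D_sum[OF a(1)] D[OF a(1)] by linarith
      then show ?thesis
        by (simp add: sum_distrib_left[symmetric] sum_divide_distrib[symmetric])
    qed
    finally show "f (\<Sum>i<m. D i) \<le> pi / 2" .
    show "M \<le> (\<Sum>i<m. D i)"
      using D_sum[OF a(1)] a(2) by simp
    show "continuous_on {M..\<Sum>i<m. D i} f"
      unfolding f_def
    proof (intro continuous_intros ballI)
      show "x \<noteq> 0" if "x \<in> {M..\<Sum>i<m. D i}" for x
        using that M by auto
      show "- 1 \<le> D i / x \<and> D i / x \<le> 1" if "i \<in> {..<m}" "x \<in> {M..\<Sum>i<m. D i}" for i x
        using ratio[of i x] that by auto
    qed
  qed
  then obtain S where S: "M \<le> S" "f S = pi / 2" by blast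
  have less: "D i < S" if i: "i < m" for i
  proof (rule ccontr)
    assume "\<not> ?thesis"
    then have "S = D i" using le_M[OF i] S(1) by simp
    then have "arcsin (D i / S) = pi / 2"
      using D[OF i] by simp
    then show False
      using strict[OF i S(1)] S(2) by simp
  qed
  show ?thesis
    by (rule that[OF less S(2)[unfolded f_def]])
qed

text \<open>The circle is centred at 0, where Klein directions are the true angles. The strict
  bounds \<open>D i < S\<close> make the diameter longer than every prescribed side.\<close>

lemma semicyclic_ngon_exists:
  fixes d :: "nat \<Rightarrow> real"
  assumes n: "3 \<le> n" and d: "\<And>i. i \<in> {1..n - 1} \<Longrightarrow> 0 < d i"
  shows "semicyclic_ngons_with_sides n d \<noteq> {}"
proof -
  define m where "m = n - 1"
  have m: "2 \<le> m" "n = Suc m" using n by (auto simp: m_def)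
  define D where "D i = sinh (d (Suc i) / 2)" for i
  have d': "0 < d (Suc i)" if "i < m" for i
    using d[of "Suc i"] that m by auto
  have D: "0 < D i" if "i < m" for i
    using d'[OF that] by (simp add: D_def)
  obtain S where S: "\<And>i. i < m \<Longrightarrow> D i < S" "(\<Sum>i<m. arcsin (D i / S)) = pi / 2"
    using circumradius_exists[of m D] m(1) D by blast
  have S0: "0 < S"
    using S(1)[of 0] D[of 0] m by linarith
  define r where "r = arsinh S"
  have r: "0 < r" "sinh r = S"
    using S0 by (simp_all add: r_def)
  have ch: "(cosh r)\<^sup>2 = 1 + S\<^sup>2" "0 < cosh r"
    using cosh_square_eq[of r] r(2) by simp_all
  \<comment> \<open>\<open>\<kappa> = tanh r\<close> is the Euclidean radius, in the Klein disc, of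
    the circle of radius \<open>r\<close> about 0.\<close>
  define \<kappa> where "\<kappa> = S / cosh r"
  have \<kappa>2: "1 - \<kappa>\<^sup>2 = 1 / (cosh r)\<^sup>2"
    using ch by (simp add: \<kappa>_def power_divide diff_divide_eq_iff add_nonneg_eq_0_iff)
  have \<kappa>: "0 < \<kappa>" "\<kappa> < 1"
  proof -
    show "0 < \<kappa>" using S0 ch(2) by (simp add: \<kappa>_def)
    have "0 < 1 - \<kappa>\<^sup>2" unfolding \<kappa>2 using ch(2) by simp
    then show "\<kappa> < 1" using \<open>0 < \<kappa>\<close> by (simp add: abs_square_less_1)
  qed
  define t where "t i = arcsin (D i / S)" for i
  have t: "0 < t i" "sin (t i) = D i / S" if "i < m" for i
  proof -
    have "0 < D i / S" "D i / S \<le> 1"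
      using D[OF that] S(1)[OF that] S0 by auto
    then show "0 < t i" "sin (t i) = D i / S"
      using arcsin_less_arcsin[of 0 "D i / S"] by (simp_all add: t_def)
  qed
  \<comment> \<open>Side \<open>i\<close> subtends the central angle \<open>2 * t i\<close>; these
    angles fill half a turn, so the final side is a diameter.\<close>
  define \<beta> where "\<beta> j = 2 * (\<Sum>i<j. t i)" for j
  have \<beta>_ends: "\<beta> 0 = 0" "\<beta> m = pi"
    using S(2) by (simp_all add: \<beta>_def t_def)
  have \<beta>_less: "\<beta> i < \<beta> j" if "i < j" "j \<le> m" for i j
  proof -
    have "(\<Sum>l<i. t l) < (\<Sum>l<j. t l)"
      using that t(1) by (intro sum_strict_mono2[of _ _ i]) (auto intro: less_imp_le)
    then show ?thesis by (simp add: \<beta>_def)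
  qed
  have \<beta>_range: "0 \<le> \<beta> j" "\<beta> j \<le> pi" if "j \<le> m" for j
    using \<beta>_less[of 0 j] \<beta>_less[of j m] that \<beta>_ends by (cases "j = 0"; cases "j = m"; force)+
  define x where "x j = of_real \<kappa> * cis (\<beta> j)" for j
  define xs where "xs = map x [0..<n]"
  have len: "length xs = n" and xs_nth: "\<And>i. i < n \<Longrightarrow> xs ! i = x i"
    by (simp_all add: xs_def)
  have norm_x: "cmod (x j) = \<kappa>" for j
    using \<kappa> by (simp add: x_def norm_mult)
  have sq: "sqrt (1 - \<kappa>\<^sup>2) = 1 / cosh r"
    unfolding \<kappa>2 using ch(2) by (simp add: real_sqrt_divide)
  have dist0: "hyp_dist 0 (x j) = r" for j
    unfolding hyp_dist_def norm_x using r ch(2) by (simp add: sq arcosh_cosh_real)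
  have dist: "hyp_dist (x i) (x j) = arcosh (1 + 2 * (S * sin ((\<beta> j - \<beta> i) / 2))\<^sup>2)" for i j
  proof -
    define v u where "v = (\<beta> j - \<beta> i) / 2" and "u = sin v"
    have v: "\<beta> j - \<beta> i = 2 * v"
      by (simp add: v_def)
    have "x i \<bullet> x j = \<kappa>\<^sup>2 * cos (\<beta> j - \<beta> i)"
      by (simp add: x_def inner_complex_def cos_diff algebra_simps power2_eq_square)
    also have "\<dots> = \<kappa>\<^sup>2 * (1 - 2 * u\<^sup>2)"
      unfolding v cos_double_sin u_def ..
    finally have "(1 - x i \<bullet> x j) / (sqrt (1 - \<kappa>\<^sup>2) * sqrt (1 - \<kappa>\<^sup>2)) = (1 - \<kappa>\<^sup>2 * (1 - 2 * u\<^sup>2)) * (cosh r)\<^sup>2"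
      unfolding sq using ch(2) by (simp add: power2_eq_square)
    also have "\<dots> = (1 - \<kappa>\<^sup>2) * (cosh r)\<^sup>2 + 2 * (\<kappa> * cosh r)\<^sup>2 * u\<^sup>2"
      by (simp only: power_mult_distrib) (simp only: ring_distribs mult_1 mult_ac)
    also have "\<dots> = 1 + 2 * (S * u)\<^sup>2"
      unfolding \<kappa>2 using ch(2) by (simp add: \<kappa>_def power_mult_distrib)
    finally show ?thesis
      unfolding hyp_dist_def norm_x u_def v_def by simp
  qed
  have arcosh: "arcosh (1 + 2 * (sinh l)\<^sup>2) = 2 * l" if "0 \<le> l" for l :: real
  proof -
    have "1 + 2 * (sinh l)\<^sup>2 = cosh (2 * l)"
      unfolding cosh_double cosh_square_eq by simp
    then show ?thesis
      using that by (simp add: arcosh_cosh_real)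
  qed
  have side: "side_length xs i = d (Suc i)" if i: "i < m" for i
  proof -
    have "(\<beta> (Suc i) - \<beta> i) / 2 = t i"
      by (simp add: \<beta>_def)
    then have "hyp_dist (x i) (x (Suc i)) = d (Suc i)"
      unfolding dist using t(2)[OF i] S0 arcosh[of "d (Suc i) / 2"] d'[OF i] by (simp add: D_def)
    then show ?thesis
      using i m by (simp add: side_length_def len xs_nth)
  qed
  have last: "side_length xs m = 2 * r"
  proof -
    have "hyp_dist (x m) (x 0) = 2 * r"
      unfolding dist \<beta>_ends using arcosh[of r] r by simp
    then show ?thesis
      using m by (simp add: side_length_def len xs_nth)
  qed
  have d_less: "d (Suc i) < 2 * r" if i: "i < m" for i
  proof -
    have "sinh (d (Suc i) / 2) < sinh r"
      using S(1)[OF i] r(2) by (simp add: D_def)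
    then show ?thesis by simp
  qed
  have sides: "sides_except xs m d"
    unfolding sides_except_def len
  proof (intro conjI exI ballI)
    show "bij_betw (\<lambda>i. i - 1) {1..n - 1} ({..<n} - {m})"
      by (rule bij_betw_byWitness[where f' = Suc]) (use m in auto)
    show "side_length xs (i - 1) = d i" if "i \<in> {1..n - 1}" for i
      using side[of "i - 1"] that m by auto
  qed (use m in simp)
  have "cyclic_polygon xs 0 r"
    unfolding cyclic_polygon_def
  proof (intro conjI exI[of _ \<beta>] ballI allI impI)
    show "3 \<le> length xs" "0 < r" "0 \<in> klein_disc"
      using n r by (simp_all add: len klein_disc_def)
    show "y \<in> klein_disc" "hyp_dist 0 y = r" if "y \<in> set xs" for y
      using that \<kappa> by (auto simp: xs_def klein_disc_def norm_x dist0)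
    show "xs ! i - 0 = of_real (cmod (xs ! i - 0)) * cis (\<beta> i)" if "i < length xs" for i
      using that by (simp add: len xs_nth norm_x) (simp add: x_def)
    show "\<beta> i < \<beta> j" "\<beta> j < \<beta> i + 2 * pi" if "i < j \<and> j < length xs" for i j
      using that \<beta>_less[of i j] \<beta>_range[of i] \<beta>_range[of j] m pi_gt_zero by (auto simp: len)
  qed
  moreover have "Max (side_length xs ` {..<length xs}) = 2 * r"
  proof (rule Max_eqI)
    show "y \<le> 2 * r" if y: "y \<in> side_length xs ` {..<length xs}" for y
    proof -
      obtain i where i: "i \<le> m" "y = side_length xs i"
        using y m by (auto simp: len less_Suc_eq_le)
      then show ?thesis
        using last side[of i] d_less[of i] by (cases "i = m") (auto intro: less_imp_le)
    qed
    show "2 * r \<in> side_length xs ` {..<length xs}"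
      using last m by (auto simp: len image_iff intro!: bexI[of _ m])
  qed simp
  ultimately have "semicyclic_polygon xs"
    unfolding semicyclic_polygon_def by force
  moreover have "Max (d ` {1..n - 1}) < side_length xs m"
  proof -
    have "d i < 2 * r" if "i \<in> {1..n - 1}" for i
      using d_less[of "i - 1"] that m by auto
    then show ?thesis
      using m by (subst Max_less_iff) (auto simp: last)
  qed
  ultimately have "convex hull (set xs) \<in> semicyclic_ngons_with_sides n d"
    unfolding semicyclic_ngons_with_sides_def using sides len by blast
  then show ?thesis by blast
qed

theorem corollary4p11:
  fixes n :: nat and d :: "nat \<Rightarrow> real"
  assumes "n \<ge> 3"
    and "\<And>i. i \<in> {1..n - 1} \<Longrightarrow> d i > 0"
  shows "semicyclic_ngons_with_sides n d \<noteq> {} \<and>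
    (\<forall>Q\<in>semicyclic_ngons_with_sides n d.
       is_arg_max hyp_area (\<lambda>P. P \<in> ngons_with_sides n d) Q)"
proof (intro conjI ballI)
  show "semicyclic_ngons_with_sides n d \<noteq> {}"
    using assms by (rule semicyclic_ngon_exists)
  fix Q assume "Q \<in> semicyclic_ngons_with_sides n d"
  then obtain xs k where Q: "Q = convex hull (set xs)" and semi: "semicyclic_polygon xs" and len: "length xs = n"
    and sides: "sides_except xs k d" and final: "side_length xs k > Max (d ` {1..n - 1})"
    by (auto simp: semicyclic_ngons_with_sides_def)
  obtain c r where cyc: "cyclic_polygon xs c r" and r: "r = Max (side_length xs ` {..<length xs}) / 2"
    using semi unfolding semicyclic_polygon_def by blast
  obtain \<sigma> where k: "k < n" and \<sigma>: "bij_betw \<sigma> {1..n - 1} ({..<n} - {k})"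
    "\<And>i. i \<in> {1..n - 1} \<Longrightarrow> side_length xs (\<sigma> i) = d i"
    using sides by (auto simp: sides_except_def len)
  \<comment> \<open>Exceeding all prescribed lengths makes the final side the longest one, so it is
    the side that equals twice the circumradius.\<close>
  have "Max (side_length xs ` {..<length xs}) = side_length xs k"
  proof (rule Max_eqI)
    show "y \<le> side_length xs k" if y: "y \<in> side_length xs ` {..<length xs}" for y
    proof -
      obtain j where j: "j < n" "y = side_length xs j"
        using y by (auto simp: len)
      show ?thesis
      proof (cases "j = k")
        case False
        then obtain i where i: "i \<in> {1..n - 1}" "j = \<sigma> i"
          using \<sigma>(1) j(1) unfolding bij_betw_def by blast
        then have "y \<le> Max (d ` {1..n - 1})"
          using j(2) \<sigma>(2) by simp
        then show ?thesis using final by simp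
      qed (simp add: j)
    qed
  qed (use k in \<open>simp_all add: len\<close>)
  then have diam: "side_length xs k = 2 * r"
    by (simp add: r)
  have m: "n - 1 = length xs - 1"
    by (simp add: len)
  obtain S ys where ys: "hyp_polygon ys" "length ys = length xs" "sides_except ys (n - 1) d"
    "convex hull (set xs) = polygon_region ys"
    and S: "\<And>i. i \<in> {1..n - 1} \<Longrightarrow> sinh (d i / 2) \<le> S" "(\<Sum>i\<in>{1..n - 1}. arcsin (sinh (d i / 2) / S)) \<le> pi / 2"
    and area: "hyp_area (convex hull (set xs)) = 2 * (\<Sum>i\<in>{1..n - 1}. isosceles_half_area S (sinh (d i / 2)))"
    by (rule semicyclic_polygon_area[OF cyc sides diam m assms(2)]; (assumption | (rule that; (assumption | blast))))
  have "Q \<in> ngons_with_sides n d"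
    unfolding ngons_with_sides_def Q ys(4) using ys len by blast
  \<comment> \<open>The \<open>S\<close> of the fixed polygon \<open>Q\<close> bounds every
    competitor, and the bound is the area of \<open>Q\<close>.\<close>
  moreover have "hyp_area P \<le> hyp_area Q" if P: "P \<in> ngons_with_sides n d" for P
  proof -
    obtain zs l where "P = polygon_region zs" "hyp_polygon zs" "length zs = n" "sides_except zs l d"
      using P by (auto simp: ngons_with_sides_def)
    then show ?thesis
      using hyp_area_polygon_le[of zs l d "n - 1" S] assms(2) S area Q by simp
  qed
  ultimately show "is_arg_max hyp_area (\<lambda>P. P \<in> ngons_with_sides n d) Q"
    by (auto simp: is_arg_max_def not_less)
qed

end
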